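(* Let $H=H(G,\chi,\chi^t,b,c,0)$, where $G$ is a finitely generated abelian group, $\eta=\chi^t$, $q=\eta(b)=\chi(c)^{-1}$ is a primitive $n$th root of unity, $\langle q\rangle=\mathrm{Im}(\chi)$, and $t$ is relatively prime to $n$. Let $N=\ker(\chi)$. Then any $x$- and $y$-torsion-free simple $H$-module $V$ has dimension $n$ and is isomorphic to an induced module $H\otimes_{R[N]}M$ for some one-dimensional $R[N]$-module $M$, where $R=\mathbb{K}[x,y]$. In particular, there exist $\alpha_x,\alpha_y\in\mathbb{K}^\times$ and $\lambda\in\widehat{N}$ such that $V$ has a $\mathbb{K}$-basis $\{v_0,\ldots,v_{n-1}\}$ and $$x\cdot v_i=\alpha_xq^{-i}v_i,\qquad y\cdot v_i=\alpha_yq^{-it}v_i,\qquad c^jh\cdot v_i=\lambda(h)v_{i+j},$$ for all $0\le i,j\le n-1$ and $h\in N$, where indices are taken modulo $n$. Denote $V$ by $V_{xy}(\alpha_x,\alpha_y,\lambda)$. Moreover, $$V_{xy}(\alpha_x,\alpha_y,\lambda)\simeq V_{xy}(\alpha_x',\alpha_y',\lambda')$$ if and only if $\lambda=\lambda'$, $\alpha_x=q^{-i}\alpha_x'$, and $\alpha_y=q^{-it}\alpha_y'$ for some $i$.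
   Context: $\mathbb{K}$ is an algebraically closed field of characteristic zero; $\widehat{G}$ is the group of homomorphisms $G\to\mathbb{K}^\times$ (similarly $\widehat{N}$); $b,c\in G$, and $\chi\in\widehat{G}$ has finite order. The Hopf algebra $H(G,\chi,\eta,b,c,0)$ (where $\eta(b)=\chi(c)^{-1}$) is written, after replacing its second Ore variable $y$ by $c^{-1}y$, as the skew group ring $\mathbb{K}[x,y]\#G$: it is generated by $G,x,y$ with $xy=yx$, $xg=\chi(g)gx$, $yg=\eta(g)gy$ for $g\in G$, and has $\mathbb{K}$-basis $\{x^iy^jg\mid i,j\ge 0,\ g\in G\}$ (elements of $G$ group-like, $\Delta(x)=x\otimes1+b\otimes x$, $\Delta(y)=y\otimes c^{-1}+1\otimes y$). The subalgebra generated by $R=\mathbb{K}[x,y]$ and $N$ is the commutative group ring $R[N]$. A module is $x$-torsion-free if none of its nonzero elements is killed by a power $x^k$, $k\ge1$; similarly for $y$.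
   Formalization: The action formula is corrected to c^j h·v_i = λ(h) λ(c^n)^{⌊(i+j)/n⌋} v_{(i+j) mod n}; as printed, indices modulo n would force λ(c^n)=1, which fails e.g. for G=ℤ, c=1, λ(n)=2 with n≥2. *)

theory Defs
  imports
    "HOL-Algebra.Multiplicative_Group"
    "HOL-Algebra.Generated_Rings"
    "HOL-Algebra.Free_Abelian_Groups"
    "HOL-Computational_Algebra.Polynomial"
    "Jordan_Normal_Form.VS_Connect"
begin

hide_const (open) Multiset.mult Polynomial.smult Modules.module

section \<open>The algebra\<close>

abbreviation field_units :: "'k::field monoid"  (* the multiplicative group of the field *)
  where "field_units \<equiv> mult_of class_ring"

definition primitive_root_of_unity :: "nat \<Rightarrow> 'k::field \<Rightarrow> bool"
  where "primitive_root_of_unity n q \<longleftrightarrow>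
    n > 0 \<and> q ^ n = 1 \<and> (\<forall>m. 0 < m \<and> m < n \<longrightarrow> q ^ m \<noteq> 1)"

definition finitely_generated_group :: "('g, 'r) monoid_scheme \<Rightarrow> bool"
  where "finitely_generated_group G \<longleftrightarrow>
    (\<exists>S. finite S \<and> S \<subseteq> carrier G \<and> generate G S = carrier G)"

text \<open>
  The skew group ring of \<open>G\<close> over \<open>K[x,y]\<close>. The key \<open>(i, j, g)\<close> of a finitely supported
  function stands for the basis element \<open>x^i y^j g\<close>. The relations \<open>x g = \<chi>(g) g x\<close> and
  \<open>y g = \<eta>(g) g y\<close> give \<open>g x^k y^l = \<chi>(g)^(-k) \<eta>(g)^(-l) x^k y^l g\<close>, whence the product.
  This is the algebra underlying the Hopf algebra \<open>H(G, \<chi>, \<eta>, b, c, 0)\<close>; the elements \<open>b\<close> and \<open>c\<close>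
  enter only its comultiplication, which plays no role for modules.
\<close>

definition hopf_mult :: "('g, 'r) monoid_scheme \<Rightarrow> ('g \<Rightarrow> 'k::field) \<Rightarrow> ('g \<Rightarrow> 'k) \<Rightarrow>
    (nat \<times> nat \<times> 'g \<Rightarrow>\<^sub>0 'k) \<Rightarrow> (nat \<times> nat \<times> 'g \<Rightarrow>\<^sub>0 'k) \<Rightarrow> (nat \<times> nat \<times> 'g \<Rightarrow>\<^sub>0 'k)"
  where "hopf_mult G \<chi> \<eta> a b =
    (\<Sum>(i, j, g)\<in>Poly_Mapping.keys a. \<Sum>(k, l, h)\<in>Poly_Mapping.keys b.
      Poly_Mapping.single (i + k, j + l, g \<otimes>\<^bsub>G\<^esub> h)
        (Poly_Mapping.lookup a (i, j, g) * Poly_Mapping.lookup b (k, l, h)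
          * inverse (\<chi> g) ^ k * inverse (\<eta> g) ^ l))"

definition hopf_algebra :: "('g, 'r) monoid_scheme \<Rightarrow> ('g \<Rightarrow> 'k::field) \<Rightarrow> ('g \<Rightarrow> 'k) \<Rightarrow>
    (nat \<times> nat \<times> 'g \<Rightarrow>\<^sub>0 'k) ring"
  where "hopf_algebra G \<chi> \<eta> =
    \<lparr>carrier = {a. Poly_Mapping.keys a \<subseteq> UNIV \<times> UNIV \<times> carrier G},
     mult = hopf_mult G \<chi> \<eta>,
     one = Poly_Mapping.single (0, 0, \<one>\<^bsub>G\<^esub>) 1,
     ring.zero = 0,
     add = (+)\<rparr>"

definition scalar :: "('g, 'r) monoid_scheme \<Rightarrow> 'k::field \<Rightarrow> (nat \<times> nat \<times> 'g \<Rightarrow>\<^sub>0 'k)"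
  where "scalar G a = Poly_Mapping.single (0, 0, \<one>\<^bsub>G\<^esub>) a"

definition gen_x :: "('g, 'r) monoid_scheme \<Rightarrow> (nat \<times> nat \<times> 'g \<Rightarrow>\<^sub>0 'k::field)"
  where "gen_x G = Poly_Mapping.single (1, 0, \<one>\<^bsub>G\<^esub>) 1"

definition gen_y :: "('g, 'r) monoid_scheme \<Rightarrow> (nat \<times> nat \<times> 'g \<Rightarrow>\<^sub>0 'k::field)"
  where "gen_y G = Poly_Mapping.single (0, 1, \<one>\<^bsub>G\<^esub>) 1"

definition grp :: "'g \<Rightarrow> (nat \<times> nat \<times> 'g \<Rightarrow>\<^sub>0 'k::field)"
  where "grp g = Poly_Mapping.single (0, 0, g) 1"

definition poly_group_ring :: "('g, 'r) monoid_scheme \<Rightarrow> ('g \<Rightarrow> 'k::field) \<Rightarrow> ('g \<Rightarrow> 'k) \<Rightarrow> 'g set \<Rightarrow>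
    (nat \<times> nat \<times> 'g \<Rightarrow>\<^sub>0 'k) ring"  (* R[N], where R = K[x,y] *)
  where "poly_group_ring G \<chi> \<eta> N = (hopf_algebra G \<chi> \<eta>)
    \<lparr>carrier := {a. Poly_Mapping.keys a \<subseteq> UNIV \<times> UNIV \<times> N}\<rparr>"

text \<open>
  These operations make a ring satisfying the defining relations, and \<open>R[N]\<close> is the subalgebra generated
  by \<open>x\<close>, \<open>y\<close> and \<open>N\<close>.
\<close>

context
  fixes G :: "('g,'r) monoid_scheme" and \<chi> \<eta> :: "'g \<Rightarrow> 'k::field"
  assumes G: "comm_group G" and chi: "\<chi> \<in> hom G field_units" and eta: "\<eta> \<in> hom G field_units"
begin

interpretation G: comm_group G by (rule G)

lemma hopf_mult_superset:
  assumes "finite A" "finite B" "Poly_Mapping.keys a \<subseteq> A" "Poly_Mapping.keys b \<subseteq> B"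
  shows "hopf_mult G \<chi> \<eta> a b = (\<Sum>(i, j, g)\<in>A. \<Sum>(k, l, h)\<in>B.
      Poly_Mapping.single (i + k, j + l, g \<otimes>\<^bsub>G\<^esub> h)
        (Poly_Mapping.lookup a (i, j, g) * Poly_Mapping.lookup b (k, l, h)
          * inverse (\<chi> g) ^ k * inverse (\<eta> g) ^ l))"
proof -
  have 1: "(\<Sum>(k, l, h)\<in>Poly_Mapping.keys b. Poly_Mapping.single (i + k, j + l, g \<otimes>\<^bsub>G\<^esub> h)
        (Poly_Mapping.lookup a (i, j, g) * Poly_Mapping.lookup b (k, l, h)
          * inverse (\<chi> g) ^ k * inverse (\<eta> g) ^ l))
     = (\<Sum>(k, l, h)\<in>B. Poly_Mapping.single (i + k, j + l, g \<otimes>\<^bsub>G\<^esub> h)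
        (Poly_Mapping.lookup a (i, j, g) * Poly_Mapping.lookup b (k, l, h)
          * inverse (\<chi> g) ^ k * inverse (\<eta> g) ^ l))" for i j g
    by (rule sum.mono_neutral_left) (use assms in \<open>auto simp: in_keys_iff\<close>)
  show ?thesis unfolding hopf_mult_def 1
    by (rule sum.mono_neutral_left) (use assms in \<open>auto simp: in_keys_iff intro!: sum.neutral\<close>)
qed

lemma hopf_mult_add_left: "hopf_mult G \<chi> \<eta> (a + a') b = hopf_mult G \<chi> \<eta> a b + hopf_mult G \<chi> \<eta> a' b"
proof -
  let ?A = "Poly_Mapping.keys a \<union> Poly_Mapping.keys a'" and ?B = "Poly_Mapping.keys b"
  have k: "Poly_Mapping.keys (a + a') \<subseteq> ?A" by (rule Poly_Mapping.keys_add)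
  show ?thesis
    by (subst (1 2 3) hopf_mult_superset[of ?A ?B])
       (use k in \<open>auto simp: lookup_add algebra_simps single_add sum.distrib split_def\<close>)
qed

lemma hopf_mult_add_right: "hopf_mult G \<chi> \<eta> b (a + a') = hopf_mult G \<chi> \<eta> b a + hopf_mult G \<chi> \<eta> b a'"
proof -
  let ?A = "Poly_Mapping.keys a \<union> Poly_Mapping.keys a'" and ?B = "Poly_Mapping.keys b"
  have k: "Poly_Mapping.keys (a + a') \<subseteq> ?A" by (rule Poly_Mapping.keys_add)
  show ?thesis
    by (subst (1 2 3) hopf_mult_superset[of ?B ?A])
       (use k in \<open>auto simp: lookup_add algebra_simps single_add sum.distrib split_def\<close>)
qed

lemma hopf_mult_zero: "hopf_mult G \<chi> \<eta> 0 b = 0" "hopf_mult G \<chi> \<eta> b 0 = 0"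
  by (auto simp: hopf_mult_def)

lemma hopf_mult_single: "hopf_mult G \<chi> \<eta> (Poly_Mapping.single (i,j,g) p) (Poly_Mapping.single (k,l,h) q) =
    Poly_Mapping.single (i + k, j + l, g \<otimes>\<^bsub>G\<^esub> h) (p * q * inverse (\<chi> g) ^ k * inverse (\<eta> g) ^ l)"
  by (subst hopf_mult_superset[of "{(i,j,g)}" "{(k,l,h)}"]) auto

lemma hopf_mult_keys:
  assumes "Poly_Mapping.keys a \<subseteq> UNIV \<times> UNIV \<times> carrier G" "Poly_Mapping.keys b \<subseteq> UNIV \<times> UNIV \<times> carrier G"
  shows "Poly_Mapping.keys (hopf_mult G \<chi> \<eta> a b) \<subseteq> UNIV \<times> UNIV \<times> carrier G"
proof -
  have S: "Poly_Mapping.keys (sum f A) \<subseteq> UNIV \<times> UNIV \<times> carrier G" if "\<And>x. x \<in> A \<Longrightarrow> Poly_Mapping.keys (f x) \<subseteq> UNIV \<times> UNIV \<times> carrier G"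
    for A and f :: "nat \<times> nat \<times> 'g \<Rightarrow> (nat \<times> nat \<times> 'g \<Rightarrow>\<^sub>0 'k)"
    using Poly_Mapping.keys_sum[of f A] that by (meson UN_least order_trans)
  show ?thesis unfolding hopf_mult_def split_def
    by (intro S) (use assms in \<open>force split: if_splits\<close>)
qed

lemma hopf_induct [consumes 1, case_names zero single add]:
  assumes "Poly_Mapping.keys a \<subseteq> UNIV \<times> UNIV \<times> carrier G" "P 0"
    "\<And>i j g p. g \<in> carrier G \<Longrightarrow> P (Poly_Mapping.single (i,j,g) (p::'k))"
    "\<And>a b. P a \<Longrightarrow> P b \<Longrightarrow> P (a + b)"
  shows "P a"
proof -
  have "P (\<Sum>z\<in>A. Poly_Mapping.single z (Poly_Mapping.lookup a z))" if "finite A" "A \<subseteq> UNIV \<times> UNIV \<times> carrier G" for A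
    using that
  proof (induction A rule: finite_induct)
    case (insert z A) then show ?case by (cases z) (auto intro!: assms)
  qed (use assms in auto)
  moreover have "(\<Sum>z\<in>Poly_Mapping.keys a. Poly_Mapping.single z (Poly_Mapping.lookup a z)) = a"
    by (rule poly_mapping_eqI) (auto simp: lookup_sum lookup_single when_def in_keys_iff)
  ultimately show ?thesis using assms(1) finite_keys by metis
qed

lemma hopf_mult_assoc:
  assumes "Poly_Mapping.keys a \<subseteq> UNIV \<times> UNIV \<times> carrier G" "Poly_Mapping.keys b \<subseteq> UNIV \<times> UNIV \<times> carrier G" "Poly_Mapping.keys d \<subseteq> UNIV \<times> UNIV \<times> carrier G"
  shows "hopf_mult G \<chi> \<eta> (hopf_mult G \<chi> \<eta> a b) d = hopf_mult G \<chi> \<eta> a (hopf_mult G \<chi> \<eta> b d)"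
  using assms(1)
proof (induction a rule: hopf_induct)
  case (single i j g p)
  note g = this
  show ?case using assms(2)
  proof (induction b rule: hopf_induct)
    case (single i' j' g' p')
    note g' = this
    show ?case using assms(3)
    proof (induction d rule: hopf_induct)
      case (single i'' j'' g'' p'')
      have "\<chi> (g \<otimes>\<^bsub>G\<^esub> g') = \<chi> g * \<chi> g'" "\<eta> (g \<otimes>\<^bsub>G\<^esub> g') = \<eta> g * \<eta> g'"
        using chi eta g g' by (auto simp: hom_def)
      then show ?case using g g' single
        by (simp add: hopf_mult_single G.m_assoc add.assoc power_add power_mult_distrib mult_ac)
    qed (simp_all add: hopf_mult_zero hopf_mult_add_left hopf_mult_add_right)
  qed (simp_all add: hopf_mult_zero hopf_mult_add_left hopf_mult_add_right)
qed (simp_all add: hopf_mult_zero hopf_mult_add_left hopf_mult_add_right)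

lemma hopf_mult_one:
  assumes "Poly_Mapping.keys a \<subseteq> UNIV \<times> UNIV \<times> carrier G"
  shows "hopf_mult G \<chi> \<eta> (Poly_Mapping.single (0, 0, \<one>\<^bsub>G\<^esub>) 1) a = a"
    "hopf_mult G \<chi> \<eta> a (Poly_Mapping.single (0, 0, \<one>\<^bsub>G\<^esub>) 1) = a"
proof -
  have "\<chi> \<one>\<^bsub>G\<^esub> = 1" "\<eta> \<one>\<^bsub>G\<^esub> = 1"
    using hom_one[OF chi G.is_group] hom_one[OF eta G.is_group]
      field.field_mult_group[OF class_field.field_axioms] by (auto)
  with assms show "hopf_mult G \<chi> \<eta> (Poly_Mapping.single (0, 0, \<one>\<^bsub>G\<^esub>) 1) a = a"
    "hopf_mult G \<chi> \<eta> a (Poly_Mapping.single (0, 0, \<one>\<^bsub>G\<^esub>) 1) = a"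
    by (induction a rule: hopf_induct)
      (simp_all add: hopf_mult_zero hopf_mult_add_left hopf_mult_add_right hopf_mult_single)
qed

lemma ring_hopf_algebra: "ring (hopf_algebra G \<chi> \<eta>)"
proof (rule ringI)
  show "abelian_group (hopf_algebra G \<chi> \<eta>)"
  proof (rule abelian_groupI)
    fix a assume "a \<in> carrier (hopf_algebra G \<chi> \<eta>)"
    then show "\<exists>b\<in>carrier (hopf_algebra G \<chi> \<eta>). b \<oplus>\<^bsub>hopf_algebra G \<chi> \<eta>\<^esub> a = \<zero>\<^bsub>hopf_algebra G \<chi> \<eta>\<^esub>"
      by (intro bexI[of _ "- a"]) (auto simp: hopf_algebra_def)
  qed (use Poly_Mapping.keys_add in \<open>fastforce simp: hopf_algebra_def add_ac\<close>)+
  show "monoid (hopf_algebra G \<chi> \<eta>)"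
    by (rule monoidI) (auto simp: hopf_algebra_def hopf_mult_assoc hopf_mult_one dest: hopf_mult_keys[THEN subsetD, rotated 2] simp: subset_iff split: if_splits)
qed (auto simp: hopf_algebra_def hopf_mult_add_left hopf_mult_add_right)

lemma char_one: "\<chi> \<one>\<^bsub>G\<^esub> = 1" "\<eta> \<one>\<^bsub>G\<^esub> = 1"
  using hom_one[OF chi G.is_group] hom_one[OF eta G.is_group]
    field.field_mult_group[OF class_field.field_axioms] by auto

lemma char_nonzero: "g \<in> carrier G \<Longrightarrow> \<chi> g \<noteq> 0" "g \<in> carrier G \<Longrightarrow> \<eta> g \<noteq> 0"
  using chi eta by (auto simp: hom_def)

lemma hopf_relations:
  shows "gen_x G \<otimes>\<^bsub>hopf_algebra G \<chi> \<eta>\<^esub> gen_y G = gen_y G \<otimes>\<^bsub>hopf_algebra G \<chi> \<eta>\<^esub> gen_x G"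
    and "g \<in> carrier G \<Longrightarrow> gen_x G \<otimes>\<^bsub>hopf_algebra G \<chi> \<eta>\<^esub> grp g =
      scalar G (\<chi> g) \<otimes>\<^bsub>hopf_algebra G \<chi> \<eta>\<^esub> (grp g \<otimes>\<^bsub>hopf_algebra G \<chi> \<eta>\<^esub> gen_x G)"
    and "g \<in> carrier G \<Longrightarrow> gen_y G \<otimes>\<^bsub>hopf_algebra G \<chi> \<eta>\<^esub> grp g =
      scalar G (\<eta> g) \<otimes>\<^bsub>hopf_algebra G \<chi> \<eta>\<^esub> (grp g \<otimes>\<^bsub>hopf_algebra G \<chi> \<eta>\<^esub> gen_y G)"
    and "grp (g \<otimes>\<^bsub>G\<^esub> h) = grp g \<otimes>\<^bsub>hopf_algebra G \<chi> \<eta>\<^esub> grp h"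
  by (simp_all add: hopf_algebra_def gen_x_def gen_y_def grp_def scalar_def hopf_mult_single
      char_one char_nonzero)

lemma gen_pow:
  "gen_x G [^]\<^bsub>hopf_algebra G \<chi> \<eta>\<^esub> (k::nat) = Poly_Mapping.single (k, 0, \<one>\<^bsub>G\<^esub>) 1"
  "gen_y G [^]\<^bsub>hopf_algebra G \<chi> \<eta>\<^esub> (k::nat) = Poly_Mapping.single (0, k, \<one>\<^bsub>G\<^esub>) 1"
  by (induction k) (simp_all add: nat_pow_def gen_x_def gen_y_def hopf_algebra_def hopf_mult_single char_one)

lemma hopf_monomial:
  assumes "g \<in> carrier G"
  shows "Poly_Mapping.single (i, j, g) a =
    scalar G a \<otimes>\<^bsub>hopf_algebra G \<chi> \<eta>\<^esub> (gen_x G [^]\<^bsub>hopf_algebra G \<chi> \<eta>\<^esub> i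
      \<otimes>\<^bsub>hopf_algebra G \<chi> \<eta>\<^esub> gen_y G [^]\<^bsub>hopf_algebra G \<chi> \<eta>\<^esub> j \<otimes>\<^bsub>hopf_algebra G \<chi> \<eta>\<^esub> grp g)"
  using assms by (simp add: gen_pow) (simp add: scalar_def grp_def hopf_algebra_def hopf_mult_single char_one)

lemma poly_group_ring_generated:
  assumes N: "subgroup N G"
  shows "carrier (poly_group_ring G \<chi> \<eta> N) =
    generate_ring (hopf_algebra G \<chi> \<eta>) (range (scalar G) \<union> {gen_x G, gen_y G} \<union> grp ` N)"
    (is "_ = generate_ring ?H ?S")
proof
  interpret ring ?H by (rule ring_hopf_algebra)
  interpret N: subgroup N G by (rule N)
  have pow: "z [^]\<^bsub>?H\<^esub> (k::nat) \<in> generate_ring ?H ?S" if "z \<in> generate_ring ?H ?S" for z k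
    using that by (induction k) (auto intro: generate_ring.intros simp: nat_pow_def)
  have mono: "Poly_Mapping.single (i, j, g) a \<in> generate_ring ?H ?S" if "g \<in> N" for i j g a
    using that by (subst hopf_monomial, simp)
      (intro generate_ring.eng_mult pow; (rule generate_ring.incl, simp))
  show "carrier (poly_group_ring G \<chi> \<eta> N) \<subseteq> generate_ring ?H ?S"
  proof
    fix a assume a: "a \<in> carrier (poly_group_ring G \<chi> \<eta> N)"
    have *: "(\<Sum>z\<in>A. Poly_Mapping.single z (Poly_Mapping.lookup a z)) \<in> generate_ring ?H ?S"
      if "finite A" "A \<subseteq> UNIV \<times> UNIV \<times> N" for A
      using that
    proof (induction A rule: finite_induct)
      case empty
      show ?case using zero_in_generate[of ?S] by (simp add: hopf_algebra_def)
    next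
      case (insert z A)
      then show ?case using generate_ring.eng_add[of "Poly_Mapping.single z (Poly_Mapping.lookup a z)" ?H ?S] mono
        by (cases z) (auto simp: hopf_algebra_def)
    qed
    have "(\<Sum>z\<in>Poly_Mapping.keys a. Poly_Mapping.single z (Poly_Mapping.lookup a z)) = a"
      by (rule poly_mapping_eqI) (auto simp: lookup_sum lookup_single when_def in_keys_iff)
    with *[of "Poly_Mapping.keys a"] a show "a \<in> generate_ring ?H ?S"
      by (simp add: poly_group_ring_def)
  qed
  have inv: "\<ominus>\<^bsub>?H\<^esub> a = - a" if "a \<in> carrier ?H" for a
    using that by (intro minus_equality) (auto simp: hopf_algebra_def)
  have S: "?S \<subseteq> carrier ?H"
    using N.subset by (auto simp: hopf_algebra_def scalar_def gen_x_def gen_y_def grp_def split: if_splits)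
  show "generate_ring ?H ?S \<subseteq> carrier (poly_group_ring G \<chi> \<eta> N)"
  proof
    fix a assume "a \<in> generate_ring ?H ?S"
    then show "a \<in> carrier (poly_group_ring G \<chi> \<eta> N)"
    proof induction
      case (a_inv h)
      then show ?case using inv[OF generate_ring_in_carrier[OF S a_inv.hyps]]
        by (simp add: poly_group_ring_def)
    next
      case (eng_add h1 h2)
      then show ?case using Poly_Mapping.keys_add[of h1 h2]
        by (fastforce simp: poly_group_ring_def hopf_algebra_def)
    next
      case (eng_mult h1 h2)
      have T: "Poly_Mapping.keys (sum f A) \<subseteq> UNIV \<times> UNIV \<times> N"
        if "\<And>x. x \<in> A \<Longrightarrow> Poly_Mapping.keys (f x) \<subseteq> UNIV \<times> UNIV \<times> N"
        for A and f :: "nat \<times> nat \<times> 'g \<Rightarrow> (nat \<times> nat \<times> 'g \<Rightarrow>\<^sub>0 'k)"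
        using Poly_Mapping.keys_sum[of f A] that by (meson UN_least order_trans)
      show ?case using eng_mult.IH
        by (simp add: poly_group_ring_def hopf_algebra_def hopf_mult_def split_def)
          (intro T, force split: if_splits)
    qed (auto simp: poly_group_ring_def hopf_algebra_def scalar_def gen_x_def gen_y_def grp_def split: if_splits)
  qed
qed

end


section \<open>Left modules\<close>

text \<open>The library's locale \<open>module\<close>, with the commutativity of the ring dropped.\<close>

locale left_module = R?: ring R + M?: abelian_group M
  for R :: "('h, 'r) ring_scheme" (structure) and M :: "('h, 'v, 's) module_scheme" (structure) +
  assumes smult_closed:
      "\<lbrakk> a \<in> carrier R; v \<in> carrier M \<rbrakk> \<Longrightarrow> a \<odot>\<^bsub>M\<^esub> v \<in> carrier M"
    and smult_l_distr:
      "\<lbrakk> a \<in> carrier R; b \<in> carrier R; v \<in> carrier M \<rbrakk> \<Longrightarrow>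
        (a \<oplus> b) \<odot>\<^bsub>M\<^esub> v = a \<odot>\<^bsub>M\<^esub> v \<oplus>\<^bsub>M\<^esub> b \<odot>\<^bsub>M\<^esub> v"
    and smult_r_distr:
      "\<lbrakk> a \<in> carrier R; v \<in> carrier M; w \<in> carrier M \<rbrakk> \<Longrightarrow>
        a \<odot>\<^bsub>M\<^esub> (v \<oplus>\<^bsub>M\<^esub> w) = a \<odot>\<^bsub>M\<^esub> v \<oplus>\<^bsub>M\<^esub> a \<odot>\<^bsub>M\<^esub> w"
    and smult_assoc1:
      "\<lbrakk> a \<in> carrier R; b \<in> carrier R; v \<in> carrier M \<rbrakk> \<Longrightarrow>
        (a \<otimes> b) \<odot>\<^bsub>M\<^esub> v = a \<odot>\<^bsub>M\<^esub> (b \<odot>\<^bsub>M\<^esub> v)"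
    and smult_one:
      "v \<in> carrier M \<Longrightarrow> \<one> \<odot>\<^bsub>M\<^esub> v = v"

definition simple_module :: "('h, 'r) ring_scheme \<Rightarrow> ('h, 'v, 's) module_scheme \<Rightarrow> bool"
  where "simple_module R V \<longleftrightarrow> left_module R V \<and> carrier V \<noteq> {\<zero>\<^bsub>V\<^esub>} \<and>
    (\<forall>W. Module.submodule W R V \<longrightarrow> W = {\<zero>\<^bsub>V\<^esub>} \<or> W = carrier V)"

definition torsion_free :: "('h, 'r) ring_scheme \<Rightarrow> ('h, 'v, 's) module_scheme \<Rightarrow> 'h \<Rightarrow> bool"
  where "torsion_free R V r \<longleftrightarrow>
    (\<forall>v\<in>carrier V. v \<noteq> \<zero>\<^bsub>V\<^esub> \<longrightarrow> (\<forall>k::nat. k \<ge> 1 \<longrightarrow> (r [^]\<^bsub>R\<^esub> k) \<odot>\<^bsub>V\<^esub> v \<noteq> \<zero>\<^bsub>V\<^esub>))"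

definition module_iso ::
    "('h, 'r) ring_scheme \<Rightarrow> ('h, 'v, 's) module_scheme \<Rightarrow> ('h, 'w, 't) module_scheme \<Rightarrow> ('v \<Rightarrow> 'w) set"
  where "module_iso R V W = {f \<in> iso (add_monoid V) (add_monoid W).
    \<forall>a\<in>carrier R. \<forall>v\<in>carrier V. f (a \<odot>\<^bsub>V\<^esub> v) = a \<odot>\<^bsub>W\<^esub> f v}"

definition isomorphic_modules ::
    "('h, 'r) ring_scheme \<Rightarrow> ('h, 'v, 's) module_scheme \<Rightarrow> ('h, 'w, 't) module_scheme \<Rightarrow> bool"
  where "isomorphic_modules R V W \<longleftrightarrow> module_iso R V W \<noteq> {}"

text \<open>
  A module over the algebra (or over the group ring inside it), regarded as a vector space over
  the field.
\<close>

definition K_space :: "('g, 'r) monoid_scheme \<Rightarrow> (nat \<times> nat \<times> 'g \<Rightarrow>\<^sub>0 'k::field, 'v, 's) module_scheme \<Rightarrow>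
    ('k, 'v) module"
  where "K_space G V = \<lparr>carrier = carrier V, mult = mult V, one = one V, ring.zero = ring.zero V, add = add V,
    smult = (\<lambda>a v. scalar G a \<odot>\<^bsub>V\<^esub> v)\<rparr>"

text \<open>
  The constant \<open>dim\<close> alone would not do: it is a least element that is unspecified for spaces that
  are not finite-dimensional.
\<close>

definition has_dim :: "('g, 'r) monoid_scheme \<Rightarrow> (nat \<times> nat \<times> 'g \<Rightarrow>\<^sub>0 'k::field, 'v, 's) module_scheme \<Rightarrow>
    nat \<Rightarrow> bool"
  where "has_dim G V d \<longleftrightarrow>
    vectorspace.fin_dim class_ring (K_space G V) \<and> vectorspace.dim class_ring (K_space G V) = d"


section \<open>Induced modules\<close>

text \<open>
  For a subring \<open>S\<close> of \<open>A\<close> and a left \<open>S\<close>-module \<open>M\<close>, the tensor product of \<open>A\<close> and \<open>M\<close> over \<open>S\<close>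
  is the free abelian group on \<open>A \<times> M\<close> modulo the usual relations, and \<open>A\<close> acts on its first factor.
  The fields \<open>mult\<close> and \<open>one\<close> of a module record carry no meaning.
\<close>

definition tensor_relations ::
    "('h, 'r) ring_scheme \<Rightarrow> ('h, 's) ring_scheme \<Rightarrow> ('h, 'm, 't) module_scheme \<Rightarrow> ('h \<times> 'm \<Rightarrow>\<^sub>0 int) set"
  where "tensor_relations A S M =
    {frag_of (a \<oplus>\<^bsub>A\<^esub> b, m) - frag_of (a, m) - frag_of (b, m) | a b m.
      a \<in> carrier A \<and> b \<in> carrier A \<and> m \<in> carrier M} \<union>
    {frag_of (a, m \<oplus>\<^bsub>M\<^esub> m') - frag_of (a, m) - frag_of (a, m') | a m m'.
      a \<in> carrier A \<and> m \<in> carrier M \<and> m' \<in> carrier M} \<union>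
    {frag_of (a \<otimes>\<^bsub>A\<^esub> s, m) - frag_of (a, s \<odot>\<^bsub>M\<^esub> m) | a s m.
      a \<in> carrier A \<and> s \<in> carrier S \<and> m \<in> carrier M}"

definition induced_module ::
    "('h, 'r) ring_scheme \<Rightarrow> ('h, 's) ring_scheme \<Rightarrow> ('h, 'm, 't) module_scheme \<Rightarrow>
      ('h, ('h \<times> 'm \<Rightarrow>\<^sub>0 int) set) module"
  where "induced_module A S M =
    (let F = free_Abelian_group (carrier A \<times> carrier M);
         T = generate F (tensor_relations A S M)
     in \<lparr>carrier = carrier (F Mod T), mult = undefined, one = undefined,
         ring.zero = one (F Mod T), add = mult (F Mod T),
         smult = (\<lambda>a X. \<Union>z\<in>X. T #>\<^bsub>F\<^esub> frag_extend (\<lambda>(b, m). frag_of (a \<otimes>\<^bsub>A\<^esub> b, m)) z)\<rparr>)"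


section \<open>The modules $V_{xy}(\alpha_x, \alpha_y, \lambda)$\<close>

text \<open>
  The action of \<open>G\<close> is that of \<open>c^j h . v_i = \<Lambda>(h) v_(i+j)\<close> where the index wraps around according to
  \<open>v_(i+n) = \<Lambda>(c^n) v_i\<close>. Reducing the index modulo \<open>n\<close> without the factor \<open>\<Lambda>(c^n)\<close> would force
  \<open>\<Lambda>(c^n) = 1\<close>, since \<open>c^n\<close> lies in the kernel of \<open>\<chi>\<close>; the factor is \<open>1\<close> for \<open>i + j < n\<close>, and always
  if \<open>c^n = 1\<close>. Here \<open>\<eta> = \<chi>^t\<close>.
\<close>

definition is_Vxy :: "('g, 'r) monoid_scheme \<Rightarrow> ('g \<Rightarrow> 'k::field) \<Rightarrow> int \<Rightarrow> nat \<Rightarrow> 'k \<Rightarrow> 'g \<Rightarrow>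
    'k \<Rightarrow> 'k \<Rightarrow> ('g \<Rightarrow> 'k) \<Rightarrow> (nat \<times> nat \<times> 'g \<Rightarrow>\<^sub>0 'k, 'v) module \<Rightarrow> bool"
  where "is_Vxy G \<chi> t n q c \<alpha>x \<alpha>y \<Lambda> V \<longleftrightarrow>
    left_module (hopf_algebra G \<chi> (\<lambda>g. \<chi> g powi t)) V \<and>
    \<alpha>x \<in> carrier field_units \<and> \<alpha>y \<in> carrier field_units \<and>
    \<Lambda> \<in> hom (G\<lparr>carrier := kernel G field_units \<chi>\<rparr>) field_units \<and>
    (\<exists>v :: nat \<Rightarrow> 'v.
      inj_on v {..<n} \<and> vectorspace.basis class_ring (K_space G V) (v ` {..<n}) \<and>
      (\<forall>i<n. gen_x G \<odot>\<^bsub>V\<^esub> v i = scalar G (\<alpha>x * q powi (- int i)) \<odot>\<^bsub>V\<^esub> v i) \<and>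
      (\<forall>i<n. gen_y G \<odot>\<^bsub>V\<^esub> v i = scalar G (\<alpha>y * q powi (- (int i * t))) \<odot>\<^bsub>V\<^esub> v i) \<and>
      (\<forall>i<n. \<forall>j<n. \<forall>h\<in>kernel G field_units \<chi>.
        grp (c [^]\<^bsub>G\<^esub> j \<otimes>\<^bsub>G\<^esub> h) \<odot>\<^bsub>V\<^esub> v i =
          scalar G (\<Lambda> h * \<Lambda> (c [^]\<^bsub>G\<^esub> n) ^ ((i + j) div n)) \<odot>\<^bsub>V\<^esub> v ((i + j) mod n)))"

end

theory Submission
  imports Defs "HOL-Algebra.Finite_Extensions"
begin

text \<open>
  Write \<open>R = K[x,y]\<close>. The elements \<open>x^n\<close>, \<open>y^n\<close> and the \<open>n\<close>-th powers of elements of \<open>G\<close> are central, since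
  the values of \<open>\<chi>\<close> and \<open>\<eta>\<close> are \<open>n\<close>-th roots of unity, and the algebra is a finitely generated module over
  the finitely generated commutative algebra \<open>A\<close> that they generate. On a simple module \<open>V\<close> every element of \<open>A\<close>
  acts as zero or surjectively. By Nakayama's argument (\<open>nakayama_inverse\<close>) the image of \<open>A\<close> in the endomorphisms
  of \<open>V\<close> is then a field. It is finitely generated as an algebra over the algebraically closed field \<open>K\<close>, so it
  is \<open>K\<close> by Zariski's lemma (\<open>zariski\<close>), and \<open>A\<close> acts by scalars (\<open>acts_by_scalars\<close>). Consequently every
  \<open>h\<close> in \<open>N\<close> has an eigenvector, and as \<open>h\<close> is central it acts by a scalar \<open>\<Lambda> h\<close>. Likewise the commuting
  operators \<open>x\<close> and \<open>y\<close> have a common eigenvector \<open>u\<close>, with eigenvalues \<open>\<alpha>x\<close> and \<open>\<alpha>y\<close> that are not zero when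
  there is no torsion (\<open>weight_vector_exists\<close>).

  Because \<open>x c = q^(-1) c x\<close> and \<open>y c = q^(-t) c y\<close>, the vector \<open>c^j u\<close> has the eigenvalues \<open>\<alpha>x q^(-j)\<close> and
  \<open>\<alpha>y q^(-jt)\<close>. For \<open>j < n\<close> the eigenvalues of \<open>x\<close> are distinct, hence these vectors are independent; they
  span \<open>V\<close> because the powers of \<open>c\<close> represent the cosets of \<open>N\<close> in \<open>G\<close> (\<open>weight_basis\<close>). As a right module
  over \<open>R[N]\<close> the algebra is generated by \<open>1, c, \<dots>, c^(n-1)\<close>, so every element of the module induced from the line
  \<open>K u\<close> is a sum of tensors \<open>c^j \<otimes> m_j\<close>. Its image \<open>\<Sum> m_j c^j u\<close> in \<open>V\<close> determines the \<open>m_j\<close>, and the natural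
  map from the induced module to \<open>V\<close> is an isomorphism (\<open>isomorphic_induced\<close>).

  The only weight vectors of \<open>V\<close> are the multiples of the \<open>c^j u\<close> (\<open>weight_unique\<close>), which gives the necessary
  conditions for two such modules to be isomorphic. They are sufficient because each \<open>c^j u\<close> may take the
  place of \<open>u\<close>, and modules induced from the same line are equal.
\<close>

section \<open>Finitely generated modules over a commutative ring\<close>

inductive_set module_span ::
    "('h, 'r) ring_scheme \<Rightarrow> ('h, 'v, 's) module_scheme \<Rightarrow> 'v set \<Rightarrow> 'v set"
  for R M W where
    zero: "\<zero>\<^bsub>M\<^esub> \<in> module_span R M W"
  | step: "\<lbrakk>a \<in> carrier R; w \<in> W; v \<in> module_span R M W\<rbrakk> \<Longrightarrow>
      (a \<odot>\<^bsub>M\<^esub> w) \<oplus>\<^bsub>M\<^esub> v \<in> module_span R M W"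

lemma module_span_mono:
  assumes "carrier R \<subseteq> carrier R'" "W \<subseteq> W'"
  shows "module_span R M W \<subseteq> module_span R' M W'"
proof
  fix v assume "v \<in> module_span R M W"
  then show "v \<in> module_span R' M W'"
    using assms by induction (auto intro: module_span.intros)
qed

context left_module
begin

lemma smult_zero [simp]: "a \<in> carrier R \<Longrightarrow> a \<odot>\<^bsub>M\<^esub> \<zero>\<^bsub>M\<^esub> = \<zero>\<^bsub>M\<^esub>"
  using smult_r_distr[of a "\<zero>\<^bsub>M\<^esub>" "\<zero>\<^bsub>M\<^esub>"] smult_closed[of a "\<zero>\<^bsub>M\<^esub>"]
  by (metis M.r_zero M.add.r_cancel_one M.zero_closed)

lemma zero_smult [simp]: "v \<in> carrier M \<Longrightarrow> \<zero> \<odot>\<^bsub>M\<^esub> v = \<zero>\<^bsub>M\<^esub>"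
  using smult_l_distr[of \<zero> \<zero> v] smult_closed[of \<zero> v]
  by (metis R.r_zero R.zero_closed M.add.r_cancel_one)

lemma smult_minus_left:
  assumes "a \<in> carrier R" "v \<in> carrier M"
  shows "(\<ominus> a) \<odot>\<^bsub>M\<^esub> v = \<ominus>\<^bsub>M\<^esub> (a \<odot>\<^bsub>M\<^esub> v)"
  using smult_l_distr[of "\<ominus> a" a v] assms
  by (intro M.minus_equality[symmetric]) (auto simp: smult_closed R.l_neg)

lemma smult_minus_right:
  assumes "a \<in> carrier R" "v \<in> carrier M"
  shows "a \<odot>\<^bsub>M\<^esub> (\<ominus>\<^bsub>M\<^esub> v) = \<ominus>\<^bsub>M\<^esub> (a \<odot>\<^bsub>M\<^esub> v)"
  using smult_r_distr[of a "\<ominus>\<^bsub>M\<^esub> v" v] assms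
  by (intro M.minus_equality[symmetric]) (auto simp: smult_closed M.l_neg)

lemma span_in_carrier:
  assumes "W \<subseteq> carrier M" "v \<in> module_span R M W"
  shows "v \<in> carrier M"
  using assms(2)
proof induction
  case (step a w v)
  then show ?case using assms(1) by (auto simp: smult_closed)
qed simp

lemma span_add:
  assumes "W \<subseteq> carrier M" "u \<in> module_span R M W" "v \<in> module_span R M W"
  shows "u \<oplus>\<^bsub>M\<^esub> v \<in> module_span R M W"
  using assms(2)
proof induction
  case zero
  then show ?case using assms span_in_carrier by auto
next
  case (step a w u)
  have "(a \<odot>\<^bsub>M\<^esub> w \<oplus>\<^bsub>M\<^esub> u) \<oplus>\<^bsub>M\<^esub> v = a \<odot>\<^bsub>M\<^esub> w \<oplus>\<^bsub>M\<^esub> (u \<oplus>\<^bsub>M\<^esub> v)"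
    using step assms span_in_carrier by (intro M.a_assoc) (auto simp: smult_closed)
  then show ?case using step by (auto intro: module_span.step)
qed

lemma span_smult:
  assumes "W \<subseteq> carrier M" "a \<in> carrier R" "v \<in> module_span R M W"
  shows "a \<odot>\<^bsub>M\<^esub> v \<in> module_span R M W"
  using assms(3)
proof induction
  case zero
  then show ?case using assms by (auto intro: module_span.zero)
next
  case (step b w u)
  have "a \<odot>\<^bsub>M\<^esub> (b \<odot>\<^bsub>M\<^esub> w \<oplus>\<^bsub>M\<^esub> u) = (a \<otimes> b) \<odot>\<^bsub>M\<^esub> w \<oplus>\<^bsub>M\<^esub> a \<odot>\<^bsub>M\<^esub> u"
    using step assms span_in_carrier by (subst smult_r_distr) (auto simp: smult_closed smult_assoc1)
  then show ?case using step assms by (auto intro: module_span.step)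
qed

lemma span_incl: 
  assumes "W \<subseteq> carrier M" "w \<in> W" 
  shows "w \<in> module_span R M W"
  using module_span.step[OF R.one_closed assms(2) module_span.zero, of M] assms by (auto simp: smult_one subset_iff)

lemma span_split:
  assumes "W \<subseteq> carrier M" "w \<in> W" "v \<in> module_span R M W"
  shows "\<exists>a\<in>carrier R. \<exists>r\<in>module_span R M (W - {w}). v = a \<odot>\<^bsub>M\<^esub> w \<oplus>\<^bsub>M\<^esub> r"
  using assms(3)
proof induction
  case zero
  then show ?case using assms
    by (intro bexI[of _ \<zero>] bexI[of _ "\<zero>\<^bsub>M\<^esub>"]) (auto intro: module_span.zero)
next
  case (step b w' u)
  then obtain a r where ar: "a \<in> carrier R" "r \<in> module_span R M (W - {w})"
    "u = a \<odot>\<^bsub>M\<^esub> w \<oplus>\<^bsub>M\<^esub> r" by blast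
  have c: "w' \<in> carrier M" "w \<in> carrier M" "r \<in> carrier M"
    using step ar assms span_in_carrier[of "W - {w}" r] by auto
  show ?case
  proof (cases "w' = w")
    case True
    then show ?thesis using ar c step
      by (intro bexI[of _ "b \<oplus> a"] bexI[of _ r]) (auto simp: smult_l_distr M.a_assoc smult_closed)
  next
    case False
    then show ?thesis using ar c step
      by (intro bexI[of _ a] bexI[of _ "b \<odot>\<^bsub>M\<^esub> w' \<oplus>\<^bsub>M\<^esub> r"])
        (auto simp: M.a_lcomm smult_closed intro: module_span.step)
  qed
qed

text \<open>
  Nakayama's argument with a generating set \<open>W\<close> of least size: write \<open>w = z w'\<close> and \<open>w' = c w + r\<close> with
  \<open>r\<close> in the span of the other generators. Then \<open>(1 - z c) w\<close> lies in that span, so if \<open>1 - z c\<close> acted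
  surjectively then \<open>w\<close> could be left out.
\<close>

lemma nakayama_inverse:
  assumes "cring R" and W: "finite W" "W \<subseteq> carrier M" "module_span R M W = carrier M"
    and surj: "\<And>a. a \<in> carrier R \<Longrightarrow> \<exists>v\<in>carrier M. a \<odot>\<^bsub>M\<^esub> v \<noteq> \<zero>\<^bsub>M\<^esub> \<Longrightarrow>
      carrier M \<subseteq> (\<lambda>v. a \<odot>\<^bsub>M\<^esub> v) ` carrier M"
    and z: "z \<in> carrier R" "\<exists>v\<in>carrier M. z \<odot>\<^bsub>M\<^esub> v \<noteq> \<zero>\<^bsub>M\<^esub>"
  shows "\<exists>c\<in>carrier R. \<forall>v\<in>carrier M. (z \<otimes> c) \<odot>\<^bsub>M\<^esub> v = v"
proof -
  interpret R: cring R by fact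
  define gens where "gens W \<longleftrightarrow> finite W \<and> W \<subseteq> carrier M \<and> module_span R M W = carrier M" for W
  have "gens W" using W by (simp add: gens_def)
  from ex_has_least_nat[of gens, OF this, of card]
  obtain W where W: "gens W" "\<And>W'. gens W' \<Longrightarrow> card W \<le> card W'" by blast
  then have Wc: "W \<subseteq> carrier M" "finite W" and Wspan: "module_span R M W = carrier M"
    by (auto simp: gens_def)
  have "W \<noteq> {}"
  proof
    assume "W = {}"
    then have "v = \<zero>\<^bsub>M\<^esub>" if "v \<in> carrier M" for v
      using that Wspan[symmetric] module_span.cases[of v R M W] by auto
    then show False using z by (metis smult_zero)
  qed
  then obtain w where w: "w \<in> W" by blast
  then obtain w' where w': "w' \<in> carrier M" "w = z \<odot>\<^bsub>M\<^esub> w'" using surj[OF z] Wc by blast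
  let ?S = "module_span R M (W - {w})"
  obtain c r where cr: "c \<in> carrier R" "r \<in> ?S" "w' = c \<odot>\<^bsub>M\<^esub> w \<oplus>\<^bsub>M\<^esub> r"
    using span_split[OF Wc(1) w] w' Wspan by blast
  have S: "?S \<subseteq> carrier M" using span_in_carrier[of "W - {w}"] Wc by blast
  have wM: "w \<in> carrier M" "r \<in> carrier M" using w Wc cr S by auto
  define e where "e = \<one> \<ominus> z \<otimes> c"
  have e: "e \<in> carrier R" using cr z by (auto simp: e_def)
  have esm: "e \<odot>\<^bsub>M\<^esub> v = v \<ominus>\<^bsub>M\<^esub> (z \<otimes> c) \<odot>\<^bsub>M\<^esub> v" if "v \<in> carrier M" for v
    using that cr z by (simp add: e_def R.minus_eq M.minus_eq smult_l_distr smult_minus_left smult_one)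
  have "z \<odot>\<^bsub>M\<^esub> (c \<odot>\<^bsub>M\<^esub> w \<oplus>\<^bsub>M\<^esub> r) = (z \<otimes> c) \<odot>\<^bsub>M\<^esub> w \<oplus>\<^bsub>M\<^esub> z \<odot>\<^bsub>M\<^esub> r"
    using cr(1) z(1) wM by (simp add: smult_r_distr smult_assoc1 smult_closed)
  then have "w = (z \<otimes> c) \<odot>\<^bsub>M\<^esub> w \<oplus>\<^bsub>M\<^esub> z \<odot>\<^bsub>M\<^esub> r"
    using w'(2) cr(3) by metis
  moreover have "p \<oplus>\<^bsub>M\<^esub> s \<ominus>\<^bsub>M\<^esub> p = s" if "p \<in> carrier M" "s \<in> carrier M" for p s
    using that by (simp add: M.minus_eq M.a_comm[of p s] M.a_assoc M.r_neg)
  ultimately have "e \<odot>\<^bsub>M\<^esub> w = z \<odot>\<^bsub>M\<^esub> r"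
    using esm[OF wM(1)] smult_closed[OF R.m_closed[OF z(1) cr(1)] wM(1)] smult_closed[OF z(1) wM(2)]
    by metis
  also have "\<dots> \<in> ?S" using span_smult[of "W - {w}"] Wc z cr by blast
  finally have ew: "e \<odot>\<^bsub>M\<^esub> w \<in> ?S" .
  have "e \<odot>\<^bsub>M\<^esub> v = \<zero>\<^bsub>M\<^esub>" if v: "v \<in> carrier M" for v
  proof (rule ccontr)
    assume "e \<odot>\<^bsub>M\<^esub> v \<noteq> \<zero>\<^bsub>M\<^esub>"
    then have sur: "carrier M \<subseteq> (\<lambda>v. e \<odot>\<^bsub>M\<^esub> v) ` carrier M" using surj[OF e] v by blast
    have "carrier M \<subseteq> ?S"
    proof
      fix y assume "y \<in> carrier M"
      then obtain y' where y': "y' \<in> carrier M" "y = e \<odot>\<^bsub>M\<^esub> y'" using sur by blast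
      obtain b s where bs: "b \<in> carrier R" "s \<in> ?S" "y' = b \<odot>\<^bsub>M\<^esub> w \<oplus>\<^bsub>M\<^esub> s"
        using span_split[OF Wc(1) w] y' Wspan by blast
      have "e \<odot>\<^bsub>M\<^esub> (b \<odot>\<^bsub>M\<^esub> w \<oplus>\<^bsub>M\<^esub> s) = b \<odot>\<^bsub>M\<^esub> (e \<odot>\<^bsub>M\<^esub> w) \<oplus>\<^bsub>M\<^esub> e \<odot>\<^bsub>M\<^esub> s"
        using bs(1,2) e wM(1) S by (auto simp: smult_r_distr smult_closed smult_assoc1[symmetric] R.m_comm)
      then have "y = b \<odot>\<^bsub>M\<^esub> (e \<odot>\<^bsub>M\<^esub> w) \<oplus>\<^bsub>M\<^esub> e \<odot>\<^bsub>M\<^esub> s" using y'(2) bs(3) by metis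
      then show "y \<in> ?S" using ew bs(1,2) e Wc
        by (auto intro!: span_add span_smult)
    qed
    then have "gens (W - {w})" using S Wc by (auto simp: gens_def)
    then show False using W(2)[of "W - {w}"] w Wc(2) by (metis card_Diff1_less linorder_not_le)
  qed
  then have "(z \<otimes> c) \<odot>\<^bsub>M\<^esub> v = v" if "v \<in> carrier M" for v
    using esm[OF that] that cr(1) z(1) smult_closed[of "z \<otimes> c" v]
      M.minus_equality[of v "\<ominus>\<^bsub>M\<^esub> ((z \<otimes> c) \<odot>\<^bsub>M\<^esub> v)"] by (auto simp: M.minus_eq)
  then show ?thesis using cr by blast
qed

end

section \<open>Zariski's lemma\<close>

text \<open>
  The field is regarded as a module over several of its subrings. The ring of scalars changes, the module
  does not.
\<close>

definition regular_module :: "('a, 'r) ring_scheme \<Rightarrow> ('a, 'a) module"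
  where "regular_module R = \<lparr>carrier = carrier R, monoid.mult = monoid.mult R, one = one R, ring.zero = ring.zero R,
    add = add R, smult = monoid.mult R\<rparr>"

lemma regular_module_simps [simp]:
  "carrier (regular_module R) = carrier R" "ring.zero (regular_module R) = ring.zero R"
  "add (regular_module R) = add R" "smult (regular_module R) = monoid.mult R"
  by (simp_all add: regular_module_def)

lemma (in ring) regular_module_over_subring:
  assumes "subring S R"
  shows "left_module (R\<lparr>carrier := S\<rparr>) (regular_module R)"
proof (rule left_module.intro)
  show "abelian_group (regular_module R)"
    by (rule abelian_groupI) (use l_neg in \<open>auto simp: a_ac\<close>)
qed (use subringE(1)[OF assms] in \<open>auto simp: subring_is_ring[OF assms] left_module_axioms_def l_distr r_distr m_assoc subset_iff\<close>)

text \<open>For a nonzero \<open>f\<close> in a subring \<open>D\<close> of a field, this is the subring \<open>D[1/f]\<close>.\<close>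

definition (in ring) localization :: "'a set \<Rightarrow> 'a \<Rightarrow> 'a set"
  where "localization D f = {s \<in> carrier R. \<exists>N::nat. f [^] N \<otimes> s \<in> D}"

context field
begin

lemma subring_pow_closed: "subring D R \<Longrightarrow> f \<in> D \<Longrightarrow> f [^] (N::nat) \<in> D"
  by (induction N) (auto simp: subringE)

lemma localization_raise:
  assumes D: "subring D R" "f \<in> D" "s \<in> carrier R" "f [^] (N::nat) \<otimes> s \<in> D"
  shows "f [^] (N + K) \<otimes> s \<in> D"
proof -
  have "f [^] (N + K) \<otimes> s = f [^] K \<otimes> (f [^] N \<otimes> s)"
    using assms subringE(1)[OF D(1)] by (auto simp: nat_pow_mult[symmetric] m_ac)
  then show ?thesis using assms subring_pow_closed[OF D(1,2)] subringE(6)[OF D(1)] by simp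
qed

lemma localizationI: "f [^] (N::nat) \<otimes> s \<in> D \<Longrightarrow> s \<in> carrier R \<Longrightarrow> s \<in> localization D f"
  by (auto simp: localization_def)

lemma subring_localization:
  assumes D: "subring D R" "f \<in> D"
  shows "subring (localization D f) R"
proof (rule subringI)
  note DE = subringE[OF D(1)]
  have f: "f \<in> carrier R" using D(2) DE(1) by blast
  show "localization D f \<subseteq> carrier R" by (auto simp: localization_def)
  show "\<one> \<in> localization D f" using DE(3) by (intro localizationI[of _ 0]) auto
  show "\<ominus> s \<in> localization D f" if s: "s \<in> localization D f" for s
  proof -
    obtain N where N: "f [^] (N::nat) \<otimes> s \<in> D" "s \<in> carrier R" using s by (auto simp: localization_def)
    then show ?thesis using DE(5)[OF N(1)] f by (intro localizationI[of _ N]) (auto simp: r_minus)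
  qed
  fix s s' assume s: "s \<in> localization D f" "s' \<in> localization D f"
  then obtain N M where N: "f [^] (N::nat) \<otimes> s \<in> D" "f [^] (M::nat) \<otimes> s' \<in> D"
    and c: "s \<in> carrier R" "s' \<in> carrier R" by (auto simp: localization_def)
  have "f [^] (N + M) \<otimes> (s \<otimes> s') = (f [^] N \<otimes> s) \<otimes> (f [^] M \<otimes> s')"
    using f c by (simp add: nat_pow_mult[symmetric] m_ac)
  then show "s \<otimes> s' \<in> localization D f" using DE(6)[OF N] c
    by (intro localizationI[of _ "N + M"]) auto
  have "f [^] (N + M) \<otimes> (s \<oplus> s') = f [^] (N + M) \<otimes> s \<oplus> f [^] (M + N) \<otimes> s'"
    using f c by (simp add: r_distr add.commute)
  then show "s \<oplus> s' \<in> localization D f"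
    using DE(7)[OF localization_raise[OF D c(1) N(1), of M] localization_raise[OF D c(2) N(2), of N]] c
    by (intro localizationI[of _ "N + M"]) auto
qed

lemma localization_incl: "subring D R \<Longrightarrow> f \<in> D \<Longrightarrow> D \<subseteq> localization D f"
  using subringE(1)[of D R] by (auto simp: localization_def intro!: exI[of _ "0::nat"])

text \<open>
  The subfield of fractions with numerator and denominator in \<open>D\<close>, expressed without division.
\<close>

definition fractions :: "'a set \<Rightarrow> 'a set"
  where "fractions D = {l \<in> carrier R. \<exists>b\<in>D - {\<zero>}. b \<otimes> l \<in> D}"

lemma fractionsI: "b \<in> D \<Longrightarrow> b \<noteq> \<zero> \<Longrightarrow> b \<otimes> l \<in> D \<Longrightarrow> l \<in> carrier R \<Longrightarrow> l \<in> fractions D"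
  by (auto simp: fractions_def)

lemma subfield_fractions:
  assumes D: "subring D R"
  shows "subfield (fractions D) R"
proof (rule subfieldI'[OF subringI])
  note DE = subringE[OF D(1)]
  have Dc: "d \<in> carrier R" if "d \<in> D" for d using DE that by auto
  show "fractions D \<subseteq> carrier R" by (auto simp: fractions_def)
  show "\<one> \<in> fractions D" using DE(3) by (intro fractionsI[of \<one>]) auto
  show "\<ominus> s \<in> fractions D" if s: "s \<in> fractions D" for s
  proof -
    obtain a where a: "a \<otimes> s \<in> D" "a \<in> D" "a \<noteq> \<zero>" "s \<in> carrier R"
      using s by (auto simp: fractions_def)
    then show ?thesis using DE(5)[OF a(1)] Dc by (intro fractionsI[of a]) (auto simp: r_minus)
  qed
  fix s s' assume s: "s \<in> fractions D" "s' \<in> fractions D"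
  then obtain a b where N: "a \<otimes> s \<in> D" "b \<otimes> s' \<in> D" "a \<in> D" "b \<in> D" "a \<noteq> \<zero>" "b \<noteq> \<zero>"
    and c: "s \<in> carrier R" "s' \<in> carrier R" by (auto simp: fractions_def)
  have ab: "a \<otimes> b \<in> D" "a \<otimes> b \<noteq> \<zero>"
    using N(3,4) DE(6) integral[OF _ Dc[OF N(3)] Dc[OF N(4)]] N(5,6) by blast+
  have "(a \<otimes> b) \<otimes> (s \<otimes> s') = (a \<otimes> s) \<otimes> (b \<otimes> s')"
    using N(3,4) c Dc by (simp add: m_ac)
  then show "s \<otimes> s' \<in> fractions D" using DE(6)[OF N(1,2)] ab c
    by (intro fractionsI[of "a \<otimes> b"]) auto
  have "(a \<otimes> b) \<otimes> (s \<oplus> s') = b \<otimes> (a \<otimes> s) \<oplus> a \<otimes> (b \<otimes> s')"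
    using N(3,4) c Dc by (simp add: m_ac r_distr)
  then show "s \<oplus> s' \<in> fractions D"
    using DE(7)[OF DE(6)[OF N(4,1)] DE(6)[OF N(3,2)]] ab c
    by (intro fractionsI[of "a \<otimes> b"]) auto
next
  note DE = subringE[OF D(1)]
  have Dc: "d \<in> carrier R" if "d \<in> D" for d using DE that by auto
  fix s assume "s \<in> fractions D - {\<zero>}"
  then obtain a where a: "a \<in> D" "a \<noteq> \<zero>" "a \<otimes> s \<in> D" "s \<in> carrier R" "s \<noteq> \<zero>"
    by (auto simp: fractions_def)
  then have i: "inv s \<in> carrier R" "s \<otimes> inv s = \<one>" by (simp_all add: field_Units)
  have "(a \<otimes> s) \<otimes> inv s = a" using a i Dc by (simp add: m_assoc)
  moreover have "a \<otimes> s \<noteq> \<zero>" using a Dc integral by blast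
  ultimately show "inv s \<in> fractions D" using a i by (intro fractionsI[of "a \<otimes> s"]) auto
qed

lemma fractions_incl: "subring D R \<Longrightarrow> D \<subseteq> fractions D"
  using subringE(1,3)[of D R] by (auto intro!: fractionsI[of \<one>])

text \<open>
  Elements of the span over the field of fractions have a common denominator; it is stated so that it
  can be enlarged later.
\<close>

lemma common_denominator:
  assumes D: "subring D R" and us: "set us \<subseteq> carrier R" and l: "l \<in> Span (fractions D) us"
  shows "\<exists>f\<in>D - {\<zero>}. \<forall>g\<in>D. l \<in> module_span (R\<lparr>carrier := localization D (f \<otimes> g)\<rparr>) (regular_module R) (set us)"
  using us l
proof (induction us arbitrary: l)
  case Nil
  then have "l = \<zero>\<^bsub>regular_module R\<^esub>" by simp
  then show ?case using subringE(3)[OF D] by (auto intro!: bexI[of _ \<one>] simp only: module_span.zero) auto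
next
  case (Cons u us)
  then obtain k v where kv: "k \<in> fractions D" "v \<in> Span (fractions D) us" "l = k \<otimes> u \<oplus> v"
    using line_extension_mem_iff[of l "fractions D" u "Span (fractions D) us"] by auto
  obtain f where f: "f \<in> D" "f \<noteq> \<zero>"
    "\<And>g. g \<in> D \<Longrightarrow> v \<in> module_span (R\<lparr>carrier := localization D (f \<otimes> g)\<rparr>) (regular_module R) (set us)"
    using Cons.IH[OF _ kv(2)] Cons.prems by auto
  obtain b where b: "b \<in> D" "b \<noteq> \<zero>" "b \<otimes> k \<in> D" "k \<in> carrier R" using kv by (auto simp: fractions_def)
  note DE = subringE[OF D]
  have c: "b \<in> carrier R" "f \<in> carrier R" using b f DE(1) by auto
  show ?case
  proof (intro bexI[of _ "b \<otimes> f"] ballI)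
    show "b \<otimes> f \<in> D - {\<zero>}" using b f integral[OF _ c] DE(6) by blast
    fix g assume g: "g \<in> D"
    then have gc: "g \<in> carrier R" using DE(1) by auto
    let ?S = "R\<lparr>carrier := localization D (b \<otimes> f \<otimes> g)\<rparr>"
    have "(b \<otimes> f \<otimes> g) [^] (1::nat) \<otimes> k = (f \<otimes> g) \<otimes> (b \<otimes> k)"
      using b(4) c gc by (simp add: m_ac)
    then have "k \<in> localization D (b \<otimes> f \<otimes> g)"
      using DE(6)[OF DE(6)[OF f(1) g] b(3)] b(4) by (intro localizationI[of _ 1]) auto
    moreover have "v \<in> module_span ?S (regular_module R) (set us)"
      using f(3)[OF DE(6)[OF b(1) g]] c gc by (simp add: m_ac)
    then have "v \<in> module_span ?S (regular_module R) (set (u # us))"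
      using module_span_mono[of ?S ?S "set us" "set (u # us)" "regular_module R"] by auto
    ultimately show "l \<in> module_span ?S (regular_module R) (set (u # us))"
      using module_span.step[of k ?S u "set (u # us)" v "regular_module R"] kv(3) by simp
  qed
qed

lemma common_denominator_finite:
  assumes D: "subring D R" and us: "set us \<subseteq> carrier R" and Q: "finite Q" "Q \<subseteq> Span (fractions D) us"
  shows "\<exists>f\<in>D - {\<zero>}. Q \<subseteq> module_span (R\<lparr>carrier := localization D f\<rparr>) (regular_module R) (set us)"
proof -
  note DE = subringE[OF D]
  have "\<exists>f\<in>D - {\<zero>}. \<forall>g\<in>D. Q \<subseteq> module_span (R\<lparr>carrier := localization D (f \<otimes> g)\<rparr>) (regular_module R) (set us)"
    using Q
  proof (induction Q rule: finite_induct)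
    case empty
    then show ?case using DE(3) by (intro bexI[of _ \<one>]) auto
  next
    case (insert l Q)
    then obtain f where f: "f \<in> D - {\<zero>}"
      "\<forall>g\<in>D. Q \<subseteq> module_span (R\<lparr>carrier := localization D (f \<otimes> g)\<rparr>) (regular_module R) (set us)" by auto
    obtain f' where f': "f' \<in> D - {\<zero>}"
      "\<forall>g\<in>D. l \<in> module_span (R\<lparr>carrier := localization D (f' \<otimes> g)\<rparr>) (regular_module R) (set us)"
      using common_denominator[OF D us, of l] insert.prems by auto
    show ?case
    proof (intro bexI[of _ "f \<otimes> f'"] ballI)
      have c: "f \<in> carrier R" "f' \<in> carrier R" using f f' DE(1) by auto
      show "f \<otimes> f' \<in> D - {\<zero>}" using f f' integral[OF _ c] DE(6) by blast
      fix g assume g: "g \<in> D"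
      then have gc: "g \<in> carrier R" using DE(1) by auto
      have "f \<otimes> f' \<otimes> g = f \<otimes> (f' \<otimes> g)" "f \<otimes> f' \<otimes> g = f' \<otimes> (f \<otimes> g)"
        using c gc by (auto simp: m_ac)
      then show "insert l Q \<subseteq> module_span (R\<lparr>carrier := localization D (f \<otimes> f' \<otimes> g)\<rparr>) (regular_module R) (set us)"
        using f f' g DE(6) by (metis Diff_iff insert_subset)
    qed
  qed
  then obtain f where f: "f \<in> D - {\<zero>}"
    "\<forall>g\<in>D. Q \<subseteq> module_span (R\<lparr>carrier := localization D (f \<otimes> g)\<rparr>) (regular_module R) (set us)" by auto
  then have "f \<otimes> \<one> = f" using DE(1) by auto
  with f show ?thesis using DE(3) by metis
qed

text \<open>
  \<open>K[x, 1/f]\<close> is never a field when \<open>x\<close> is transcendental: an inverse of \<open>1 + x f\<close> would make it divide a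
  power of \<open>f\<close>, to which it is coprime, so that it would be a unit of \<open>K[x]\<close> of positive degree.
\<close>

lemma localization_field_imp_algebraic:
  assumes K: "subfield K R" and x: "x \<in> carrier R"
    and f: "f \<in> simple_extension K x" "f \<noteq> \<zero>"
    and inv: "\<And>z. z \<in> localization (simple_extension K x) f \<Longrightarrow> z \<noteq> \<zero> \<Longrightarrow>
      \<exists>c\<in>localization (simple_extension K x) f. z \<otimes> c = \<one>"
  shows "(algebraic over K) x"
proof (rule ccontr)
  define D where "D = simple_extension K x"
  have KR: "subring K R" by (rule subfieldE(1)[OF K])
  have D: "subring D R" unfolding D_def by (rule simple_extension_is_subring[OF KR x])
  note DE = subringE[OF D]
  have Dc: "d \<in> carrier R" if "d \<in> D" for d using DE(1) that by auto
  have Deval: "D = (\<lambda>p. eval p x) ` carrier (K[X])"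
    unfolding D_def by (rule simple_extension_as_eval_img) (use subringE(1)[OF KR] x in auto)
  have xD: "x \<in> D" unfolding D_def by (rule simple_extension_mem[OF KR x])
  assume "\<not> (algebraic over K) x"
  then have inj: "inj_on (\<lambda>p. eval p x) (carrier (K[X]))" by (simp add: over_def transcendental_def)
  interpret UP: domain "K[X]" by (rule univ_poly_is_domain[OF KR])
  interpret ev: ring_hom_ring "K[X]" R "\<lambda>p. eval p x" by (rule eval_ring_hom[OF KR x])
  have X: "X \<in> carrier (K[X])" "eval X x = x" using var_closed(1)[OF KR] eval_var[OF x] by auto
  obtain \<phi> where phi: "\<phi> \<in> carrier (K[X])" "f = eval \<phi> x" using f Deval D_def by auto
  have fD: "f \<in> D" using f D_def by auto
  define p where "p = \<one> \<oplus> x \<otimes> f"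
  define \<pi> where "\<pi> = \<one>\<^bsub>K[X]\<^esub> \<oplus>\<^bsub>K[X]\<^esub> X \<otimes>\<^bsub>K[X]\<^esub> \<phi>"
  have pi: "\<pi> \<in> carrier (K[X])" "eval \<pi> x = p"
    using phi X by (auto simp: \<pi>_def p_def)
  have pD: "p \<in> D" using DE(3,6,7) xD fD by (simp add: p_def)
  have unit: "p = \<zero> \<or> (\<exists>h\<in>D. p \<otimes> h = \<one>)"
  proof (cases "p = \<zero>")
    case False
    have "p \<in> localization D f" using localization_incl[OF D fD] pD by auto
    then obtain c where c: "c \<in> localization D f" "p \<otimes> c = \<one>" using inv False D_def by blast
    then obtain N where N: "f [^] (N::nat) \<otimes> c \<in> D" "c \<in> carrier R" by (auto simp: localization_def)
    define e where "e = x \<otimes> f"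
    have e: "e \<in> D" using DE(6) xD fD by (simp add: e_def)
    \<comment> \<open>\<open>p\<close> divides \<open>1 - (-e)^k\<close> because \<open>p = 1 + e\<close>; for \<open>k = N\<close> it also divides \<open>(-e)^k\<close>\<close>
    have geom: "\<exists>d\<in>D. \<one> = p \<otimes> d \<oplus> (\<ominus> e) [^] k" for k :: nat
    proof (induction k)
      case 0
      then show ?case using DE(2) pD Dc by (intro bexI[of _ \<zero>]) auto
    next
      case (Suc k)
      then obtain d where d: "d \<in> D" "\<one> = p \<otimes> d \<oplus> (\<ominus> e) [^] k" by blast
      have ek: "(\<ominus> e) [^] k \<in> D" using subring_pow_closed[OF D] DE(5) e by auto
      have "(\<ominus> e) [^] k = (\<ominus> e) [^] k \<otimes> (p \<oplus> \<ominus> e)"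
        using Dc[OF e] Dc[OF ek] by (simp add: p_def e_def[symmetric] a_assoc r_neg)
      also have "\<dots> = p \<otimes> (\<ominus> e) [^] k \<oplus> (\<ominus> e) [^] Suc k"
        using Dc[OF e] Dc[OF ek] Dc[OF pD] by (simp add: r_distr m_comm)
      finally have "p \<otimes> (d \<oplus> (\<ominus> e) [^] k) \<oplus> (\<ominus> e) [^] Suc k = p \<otimes> d \<oplus> (\<ominus> e) [^] k"
        using Dc[OF e] Dc[OF ek] Dc[OF pD] Dc[OF d(1)] by (simp only: r_distr a_assoc m_closed nat_pow_closed a_inv_closed)
      then show ?case using DE(7)[OF d(1) ek] d(2) by (intro bexI[of _ "d \<oplus> (\<ominus> e) [^] k"]) auto
    qed
    obtain d where d: "d \<in> D" "\<one> = p \<otimes> d \<oplus> (\<ominus> e) [^] N" using geom by blast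
    have mx: "(\<ominus> x) [^] N \<in> D" using subring_pow_closed[OF D DE(5)[OF xD]] .
    have "(\<ominus> e) [^] N = (\<ominus> x) [^] N \<otimes> f [^] N"
      using x Dc[OF fD] by (simp add: e_def l_minus[symmetric] nat_pow_distrib)
    also have "\<dots> = (\<ominus> x) [^] N \<otimes> f [^] N \<otimes> (p \<otimes> c)" using c(2) x Dc[OF fD] by simp
    also have "\<dots> = p \<otimes> ((\<ominus> x) [^] N \<otimes> (f [^] N \<otimes> c))"
      using x Dc[OF fD] Dc[OF pD] N(2) by (simp add: m_ac)
    finally have "\<one> = p \<otimes> (d \<oplus> (\<ominus> x) [^] N \<otimes> (f [^] N \<otimes> c))"
      using d Dc[OF pD] Dc[OF d(1)] x Dc[OF fD] N(2) by (simp add: r_distr)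
    then show ?thesis using DE(7)[OF d(1) DE(6)[OF mx N(1)]] by metis
  qed simp
  have "\<exists>k\<in>K. p = k"
  proof (cases "p = \<zero>")
    case False
    then obtain h where h: "h \<in> D" "p \<otimes> h = \<one>" using unit by blast
    then obtain \<theta> where th: "\<theta> \<in> carrier (K[X])" "h = eval \<theta> x" using Deval by auto
    have "eval (\<pi> \<otimes>\<^bsub>K[X]\<^esub> \<theta>) x = eval \<one>\<^bsub>K[X]\<^esub> x" using pi th h by simp
    then have "\<pi> \<otimes>\<^bsub>K[X]\<^esub> \<theta> = \<one>\<^bsub>K[X]\<^esub>"
      by (rule inj_onD[OF inj]) (use pi th in simp_all)
    then have "\<pi> \<otimes>\<^bsub>K[X]\<^esub> \<theta> \<in> Units (K[X])" by (simp only: UP.Units_one_closed)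
    then have "\<pi> \<in> Units (K[X])" by (rule UP.unit_factor[OF _ pi(1) th(1)])
    then obtain k where k: "k \<in> K" "\<pi> = [k]" unfolding univ_poly_units[OF K] by blast
    then have "eval \<pi> x = k" using subringE(1)[OF KR] by auto
    then show ?thesis using pi(2) k(1) by blast
  qed (use subringE(2)[OF KR] in auto)
  then obtain k where k: "k \<in> K" "p = k" by blast
  then have kc: "k \<in> carrier R" "k \<ominus> \<one> \<in> K"
    using subringE(1,3,5,7)[OF KR] by (auto simp: a_minus_def)
  have const: "poly_of_const m \<in> carrier (K[X])" "eval (poly_of_const m) x = m" if "m \<in> K" for m
    using that subringE(1)[OF KR] x poly_of_const_over_subfield[OF K] by (auto simp: poly_of_const_def)
  have "eval (X \<otimes>\<^bsub>K[X]\<^esub> \<phi>) x = p \<ominus> \<one>"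
    using phi X Dc[OF fD] x by (simp add: p_def minus_eq a_comm[of \<one>] a_assoc r_neg)
  then have "X \<otimes>\<^bsub>K[X]\<^esub> \<phi> = poly_of_const (k \<ominus> \<one>)"
    using const[OF kc(2)] k phi X by (intro inj_onD[OF inj]) simp_all
  then have "degree (X \<otimes>\<^bsub>K[X]\<^esub> \<phi>) = 0" using kc poly_of_const_over_subfield[OF K] by auto
  moreover have "polynomial K \<phi>" "polynomial K X" using phi X by (auto simp: univ_poly_carrier)
  moreover have "\<phi> \<noteq> []" using f phi by auto
  ultimately show False
    using poly_mult_degree_eq[OF KR, of X \<phi>] by (simp add: univ_poly_mult var_def)
qed

text \<open>
  The induction is over the number of generators and adjoins \<open>x\<close> first: the other generators are
  algebraic over \<open>K(x)\<close>, so finitely many elements span everything over \<open>K[x, 1/f]\<close> for some \<open>f\<close>, and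
  Nakayama's argument makes that ring a field.
\<close>

theorem zariski:
  assumes "subfield K R" "set xs \<subseteq> carrier R" "finite_extension K xs = carrier R"
  shows "\<forall>x\<in>set xs. (algebraic over K) x"
  using assms
proof (induction xs arbitrary: K)
  case (Cons x xs)
  note K = Cons.prems(1)
  have KR: "subring K R" by (rule subfieldE(1)[OF K])
  have x: "x \<in> carrier R" and xs: "set xs \<subseteq> carrier R" using Cons.prems by auto
  define D where "D = simple_extension K x"
  have D: "subring D R" unfolding D_def by (rule simple_extension_is_subring[OF KR x])
  note DE = subringE[OF D]
  have KD: "K \<subseteq> D" unfolding D_def using simple_extension_incl subringE(1)[OF KR] x by auto
  have xD: "x \<in> D" unfolding D_def by (rule simple_extension_mem[OF KR x])
  have gen: "E = carrier R" if E: "subring E R" "D \<subseteq> E" "set xs \<subseteq> E" for E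
  proof -
    have "finite_extension K (x # xs) \<subseteq> E"
      using finite_extension_subring_incl[OF E(1), of K "x # xs"] E KD xD by auto
    then show ?thesis using Cons.prems(3) subringE(1)[OF E(1)] by auto
  qed
  have ext: "finite_extension F xs = carrier R" if F: "subfield F R" "D \<subseteq> F" for F
    using finite_extension_is_subring[OF _ xs] finite_extension_mem[OF _ xs]
      subfieldE(1)[OF F(1)] order_trans[OF F(2) finite_extension_incl[OF subfieldE(3)[OF F(1)] xs]]
    by (intro gen) blast+
  define F where "F = fractions D"
  have F: "subfield F R" "D \<subseteq> F"
    unfolding F_def using subfield_fractions[OF D] fractions_incl[OF D] by auto
  have "\<forall>y\<in>set xs. (algebraic over F) y" using Cons.IH[OF F(1) xs ext[OF F]] .
  then have "finite_dimension F (carrier R)"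
    using finite_extension_finite_dimension(1)[OF F(1) xs] ext[OF F] by auto
  then obtain us where us: "set us \<subseteq> carrier R" "Span F us = carrier R"
    unfolding finite_dimension_def using exists_base[OF F(1)] by blast
  let ?Q = "insert \<one> ((\<lambda>(y, u). y \<otimes> u) ` (set xs \<times> set us))"
  have "?Q \<subseteq> Span F us" using us xs by auto
  then obtain f where f: "f \<in> D - {\<zero>}"
    "?Q \<subseteq> module_span (R\<lparr>carrier := localization D f\<rparr>) (regular_module R) (set us)"
    using common_denominator_finite[OF D us(1), of ?Q] unfolding F_def by blast
  define S where "S = localization D f"
  have S: "subring S R" unfolding S_def using subring_localization[OF D] f by auto
  interpret L: left_module "R\<lparr>carrier := S\<rparr>" "regular_module R" by (rule regular_module_over_subring[OF S])
  define E where "E = module_span (R\<lparr>carrier := S\<rparr>) (regular_module R) (set us)"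
  have Ec: "e \<in> carrier R" if "e \<in> E" for e
    using that L.span_in_carrier[of "set us" e] us unfolding E_def by simp
  have Eadd: "a \<oplus> b \<in> E" if "a \<in> E" "b \<in> E" for a b
    using that L.span_add[of "set us" a b] us unfolding E_def by simp
  have Esm: "s \<otimes> b \<in> E" if "s \<in> S" "b \<in> E" for s b
    using that L.span_smult[of "set us" s b] us unfolding E_def by simp
  have Eone: "\<one> \<in> E" and Egen: "\<And>y u. y \<in> set xs \<Longrightarrow> u \<in> set us \<Longrightarrow> y \<otimes> u \<in> E"
    using f unfolding E_def S_def by auto
  have Sc: "s \<in> carrier R" if "s \<in> S" for s using subringE(1)[OF S] that by auto
  have Exs: "y \<otimes> b \<in> E" if y: "y \<in> set xs" and b: "b \<in> E" for y b
    using b[unfolded E_def]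
  proof induction
    case zero
    then show ?case using y xs module_span.zero[of "regular_module R" "R\<lparr>carrier := S\<rparr>" "set us"]
      by (auto simp: E_def)
  next
    case (step a w v)
    have "y \<otimes> (a \<otimes> w \<oplus> v) = a \<otimes> (y \<otimes> w) \<oplus> y \<otimes> v"
      using step(1,2) Ec[unfolded E_def, OF step(3)] y xs us(1) Sc[of a] by (auto simp: r_distr m_lcomm subset_iff)
    then show ?case using Eadd[OF Esm[OF _ Egen[OF y step(2)]] step(4)] step(1) by simp
  qed
  \<comment> \<open>the span \<open>E\<close> is stable under all generators, so it is an ideal; it contains \<open>1\<close>\<close>
  have "{l \<in> carrier R. \<forall>b\<in>E. l \<otimes> b \<in> E} = carrier R" (is "?T = _")
  proof (rule gen)
    show "subring ?T R"
    proof (rule subringI)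
      show "\<ominus> h \<in> ?T" if "h \<in> ?T" for h
      proof -
        have "\<ominus> h \<otimes> b \<in> E" if b: "b \<in> E" for b
        proof -
          have "\<ominus> h \<otimes> b = (\<ominus> \<one>) \<otimes> (h \<otimes> b)" using \<open>h \<in> ?T\<close> Ec[OF b] by (simp add: l_minus)
          then show ?thesis using Esm[of "\<ominus> \<one>"] subringE(3,5)[OF S] \<open>h \<in> ?T\<close> b by auto
        qed
        then show ?thesis using that by auto
      qed
    qed (use Ec Eadd in \<open>auto simp: m_assoc l_distr\<close>)
    show "D \<subseteq> ?T" using Esm DE(1) localization_incl[OF D, of f] f by (auto simp: S_def)
    show "set xs \<subseteq> ?T" using Exs xs by auto
  qed
  then have "l \<in> E" if "l \<in> carrier R" for l
    using that Eone r_one[OF that] by (metis (mono_tags, lifting) mem_Collect_eq)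
  then have E: "module_span (R\<lparr>carrier := S\<rparr>) (regular_module R) (set us) = carrier (regular_module R)"
    using Ec unfolding E_def by auto
  have alg: "(algebraic over K) x"
  proof (rule localization_field_imp_algebraic[OF K x, of f, folded D_def S_def])
    fix z assume z: "z \<in> S" "z \<noteq> \<zero>"
    have "\<exists>c\<in>carrier (R\<lparr>carrier := S\<rparr>). \<forall>v\<in>carrier (regular_module R).
        (z \<otimes>\<^bsub>R\<lparr>carrier := S\<rparr>\<^esub> c) \<odot>\<^bsub>regular_module R\<^esub> v = v"
    proof (rule L.nakayama_inverse[OF _ _ _ E])
      show "cring (R\<lparr>carrier := S\<rparr>)" using subcring_iff subringE(1)[OF S] subcringI'[OF S] by blast
      show "\<exists>v\<in>carrier (regular_module R). z \<odot>\<^bsub>regular_module R\<^esub> v \<noteq> \<zero>\<^bsub>regular_module R\<^esub>"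
        using z Sc by (intro bexI[of _ \<one>]) auto
      fix a assume a: "a \<in> carrier (R\<lparr>carrier := S\<rparr>)"
        "\<exists>v\<in>carrier (regular_module R). a \<odot>\<^bsub>regular_module R\<^esub> v \<noteq> \<zero>\<^bsub>regular_module R\<^esub>"
      then have "a \<in> Units R" using Sc by (auto simp: field_Units)
      then have "v = a \<otimes> (inv a \<otimes> v)" "inv a \<otimes> v \<in> carrier R" if "v \<in> carrier R" for v
        using that by (simp_all add: m_assoc[symmetric] Units_closed)
      then show "carrier (regular_module R) \<subseteq>
          (\<lambda>v. a \<odot>\<^bsub>regular_module R\<^esub> v) ` carrier (regular_module R)" by auto
    qed (use us z in auto)
    then obtain c where c: "c \<in> S" "\<forall>v\<in>carrier R. (z \<otimes> c) \<otimes> v = v" by auto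
    then have "z \<otimes> c = \<one>" using Sc[OF z(1)] Sc[OF c(1)] by (metis m_closed one_closed r_one)
    then show "\<exists>c\<in>S. z \<otimes> c = \<one>" using c by auto
  qed (use f in auto)
  \<comment> \<open>now \<open>D\<close> itself is a field, of finite degree over \<open>K\<close>\<close>
  have DF: "subfield D R" unfolding D_def using simple_extension_is_subfield[OF K x] alg by simp
  have "\<forall>y\<in>set xs. (algebraic over D) y" using Cons.IH[OF DF xs ext[OF DF]] by simp
  then have "finite_dimension D (carrier R)"
    using finite_extension_finite_dimension(1)[OF DF xs] ext[OF DF] by auto
  moreover have "finite_dimension K D" using finite_dimension_simple_extension[OF K x] alg D_def by simp
  ultimately have "finite_dimension K (carrier R)"
    using telescopic_base[OF K DF] unfolding finite_dimension_def by blast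
  then show ?case
    using finite_dimension_imp_algebraic[OF K carrier_is_subring] xs x by auto
qed simp

end

section \<open>Eigenvectors over an algebraically closed field\<close>

lemma class_ring_sel [simp]:
  "carrier class_ring = UNIV" "monoid.mult class_ring = (*)" "add class_ring = (+)"
  "one class_ring = 1" "ring.zero class_ring = 0"
  by (simp_all add: class_ring_simps)

lemma ring_class_ring: "ring (class_ring :: 'k::field ring)"
  using class_field.field_axioms fieldE(1) cring.axioms(1) by blast

text \<open>\<open>P(T) v\<close>, evaluated by Horner's scheme.\<close>

definition poly_act :: "('k::field, 'v, 's) module_scheme \<Rightarrow> ('v \<Rightarrow> 'v) \<Rightarrow> 'k poly \<Rightarrow> 'v \<Rightarrow> 'v"
  where "poly_act V T P v = fold_coeffs (\<lambda>a w. a \<odot>\<^bsub>V\<^esub> v \<oplus>\<^bsub>V\<^esub> T w) P \<zero>\<^bsub>V\<^esub>"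

locale linear_operator = left_module "class_ring :: 'k::field ring" V
  for V :: "('k::field, 'v, 's) module_scheme" (structure) +
  fixes T :: "'v \<Rightarrow> 'v"
  assumes T_closed: "v \<in> carrier V \<Longrightarrow> T v \<in> carrier V"
    and T_add: "\<lbrakk>v \<in> carrier V; w \<in> carrier V\<rbrakk> \<Longrightarrow> T (v \<oplus> w) = T v \<oplus> T w"
    and T_smult: "v \<in> carrier V \<Longrightarrow> T (a \<odot>\<^bsub>V\<^esub> v) = a \<odot>\<^bsub>V\<^esub> T v"
begin

lemma T_zero: "T \<zero> = \<zero>"
  using T_smult[of \<zero> 0] T_closed[of \<zero>] zero_smult by simp

lemma poly_act_pCons:
  "v \<in> carrier V \<Longrightarrow> poly_act V T (pCons a P) v = a \<odot>\<^bsub>V\<^esub> v \<oplus> T (poly_act V T P v)"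
  using T_zero zero_smult[of v] by (cases "P = 0 \<and> a = 0") (auto simp: poly_act_def)

lemma poly_act_0: "poly_act V T 0 v = \<zero>"
  by (simp add: poly_act_def)

lemma poly_act_closed:
  assumes "v \<in> carrier V"
  shows "poly_act V T P v \<in> carrier V"
proof (induction P)
  case (pCons a P)
  then show ?case using assms T_closed smult_closed[of a v] by (simp add: poly_act_pCons)
qed (simp add: poly_act_0)

lemma poly_act_add:
  assumes "v \<in> carrier V"
  shows "poly_act V T (P + Q) v = poly_act V T P v \<oplus> poly_act V T Q v"
proof (induction P Q rule: poly_induct2)
  case (pCons a P b Q)
  then show ?case
    using assms T_closed T_add smult_closed[of _ v] smult_l_distr[of a b v]
    by (simp add: poly_act_pCons poly_act_closed M.a_ac)
qed (simp add: poly_act_0)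

lemma poly_act_smult:
  assumes "v \<in> carrier V"
  shows "poly_act V T (Polynomial.smult c P) v = c \<odot>\<^bsub>V\<^esub> poly_act V T P v"
proof (induction P)
  case 0
  then show ?case using smult_zero[of c] by (simp add: poly_act_0)
next
  case (pCons a P)
  then show ?case
    using assms T_closed T_smult smult_closed[of _ v] smult_r_distr[of c] smult_assoc1[of c a v]
    by (simp add: poly_act_pCons poly_act_closed)
qed

lemma poly_act_linear_mult:
  assumes "v \<in> carrier V"
  shows "poly_act V T ([:-c, 1:] * Q) v = (- c) \<odot>\<^bsub>V\<^esub> poly_act V T Q v \<oplus> T (poly_act V T Q v)"
  using assms zero_smult[of v] T_closed[OF poly_act_closed, of v Q]
  by (simp add: poly_act_add poly_act_smult[of v "-c"] poly_act_pCons flip: Polynomial.smult_minus_left)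

end

text \<open>
  Linear factors are split off from \<open>P\<close> one at a time. When the rest of \<open>P\<close> no longer kills \<open>v\<close>, it turns
  \<open>v\<close> into an eigenvector for the factor split off last.
\<close>

lemma (in linear_operator) eigenvector_exists:
  assumes alg_closed: "\<And>P :: 'k poly. Polynomial.degree P > 0 \<Longrightarrow> \<exists>c. poly P c = 0"
    and v: "v \<in> carrier V" "v \<noteq> \<zero>" and P: "P \<noteq> 0" "poly_act V T P v = \<zero>"
  shows "\<exists>c. \<exists>w\<in>carrier V. w \<noteq> \<zero> \<and> T w = c \<odot>\<^bsub>V\<^esub> w"
  using P
proof (induction "Polynomial.degree P" arbitrary: P)
  case 0
  then obtain a where a: "P = [:a:]" "a \<noteq> 0" by (metis degree_eq_zeroE pCons_0_0)
  then have "a \<odot>\<^bsub>V\<^esub> v = \<zero>"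
    using 0 v T_zero smult_closed[of a v] by (simp add: poly_act_pCons poly_act_0)
  then have "(inverse a * a) \<odot>\<^bsub>V\<^esub> v = \<zero>"
    using v smult_assoc1[of "inverse a" a v] smult_zero[of "inverse a"] by simp
  then show ?case using a v smult_one[of v] by simp
next
  case (Suc d)
  then obtain c where "poly P c = 0" using alg_closed[of P] by auto
  then obtain Q where Q: "P = [:-c, 1:] * Q" by (metis poly_eq_0_iff_dvd dvdE)
  let ?w = "poly_act V T Q v"
  have w: "?w \<in> carrier V" using poly_act_closed v by auto
  show ?case
  proof (cases "?w = \<zero>")
    case True
    have "Q \<noteq> 0" using Suc Q by auto
    moreover from this have "Polynomial.degree Q = d" using Suc(2) Q by (simp add: degree_mult_eq del: mult_pCons_left)
    ultimately show ?thesis using Suc(1)[of Q] True by simp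
  next
    case False
    have "(- c) \<odot>\<^bsub>V\<^esub> ?w \<oplus> T ?w = \<zero>" 
      using Suc.prems(2) Q poly_act_linear_mult[OF v(1), of c Q] by metis
    moreover have "(- c) \<odot>\<^bsub>V\<^esub> ?w \<oplus> c \<odot>\<^bsub>V\<^esub> ?w = \<zero>"
      using smult_l_distr[of "-c" c ?w] zero_smult[of ?w] w by simp
    ultimately have "T ?w = c \<odot>\<^bsub>V\<^esub> ?w"
      using w T_closed smult_closed[of _ ?w]
      by (metis M.add.l_cancel UNIV_I class_ring_sel(1))
    then show ?thesis using False w by blast
  qed
qed

text \<open>
  Multiplication by \<open>x\<close> is a linear operator on \<open>L\<close>, and a polynomial in it kills \<open>1\<close>. An eigenvector \<open>w\<close> for
  \<open>\<sigma> c\<close> satisfies \<open>x w = \<sigma> c w\<close>, and \<open>w\<close> can be cancelled.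
\<close>

lemma algebraic_over_alg_closed:
  fixes \<sigma> :: "'k::alg_closed_field \<Rightarrow> 'a"
  assumes L: "field L" and \<sigma>: "\<sigma> \<in> Ring.ring_hom class_ring L"
    and x: "x \<in> carrier L" "(ring.algebraic L over range \<sigma>) x"
  shows "x \<in> range \<sigma>"
proof -
  interpret L: field L by fact
  note hom = ring_hom_memE[OF \<sigma>, simplified]
  define V where "V = \<lparr>carrier = carrier L, monoid.mult = monoid.mult L, one = one L, ring.zero = ring.zero L,
    add = add L, smult = (\<lambda>a v. \<sigma> a \<otimes>\<^bsub>L\<^esub> v)\<rparr>"
  have V: "carrier V = carrier L" "ring.zero V = ring.zero L" "add V = add L"
    "smult V = (\<lambda>a v. \<sigma> a \<otimes>\<^bsub>L\<^esub> v)" by (simp_all add: V_def)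
  have "abelian_group V"
    by (rule abelian_groupI) (use L.l_neg in \<open>auto simp: V L.a_ac\<close>)
  moreover have "ring (class_ring :: 'k ring)" by (rule ring_class_ring)
  ultimately interpret linear_operator V "\<lambda>v. x \<otimes>\<^bsub>L\<^esub> v"
    by (intro linear_operator.intro left_module.intro left_module_axioms.intro linear_operator_axioms.intro)
      (use hom x(1) in \<open>auto simp: V L.l_distr L.r_distr L.m_assoc L.m_lcomm\<close>)
  have sub: "subring (range \<sigma>) L"
    using ring_hom_ring.img_is_subring[OF ring_hom_ringI2[OF ring_class_ring L.ring_axioms \<sigma>]
        ring.carrier_is_subring[OF ring_class_ring]] by simp
  obtain p where p: "p \<in> carrier (univ_poly L (range \<sigma>))" "p \<noteq> []" "L.eval p x = \<zero>\<^bsub>L\<^esub>"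
    using L.algebraicE[OF sub x] by blast
  have "set p \<subseteq> range \<sigma>" "lead_coeff p \<noteq> \<zero>\<^bsub>L\<^esub>"
    using p by (auto simp: univ_poly_carrier[symmetric] polynomial_def)
  then obtain cs where cs: "p = map \<sigma> cs" by (metis ex_map_conv image_iff subset_iff)
  have s0: "\<sigma> 0 = \<zero>\<^bsub>L\<^esub>" using hom(1,3) by (metis L.add.r_cancel_one' add_0)
  have ev: "poly_act V (\<lambda>v. x \<otimes>\<^bsub>L\<^esub> v) (Poly (rev cs)) \<one>\<^bsub>L\<^esub> = L.eval (map \<sigma> cs) x" for cs
  proof (induction cs rule: rev_induct)
    case Nil
    then show ?case using poly_act_0 V by simp
  next
    case (snoc a cs)
    have "L.eval (map \<sigma> cs) x \<in> carrier L" "\<sigma> ` set cs \<subseteq> carrier L"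
      using hom x by (auto intro!: L.eval_in_carrier)
    then show ?case using snoc poly_act_pCons[of "\<one>\<^bsub>L\<^esub>"] hom x L.eval_append_aux[of "map \<sigma> cs" "\<sigma> a" x]
      by (auto simp: V L.m_comm L.a_comm)
  qed
  have "coeff (Poly (rev cs)) (length cs - 1) = hd cs"
    using cs p by (simp add: coeff_Poly_eq nth_default_def rev_nth hd_conv_nth)
  moreover have "hd cs \<noteq> 0" using \<open>lead_coeff p \<noteq> _\<close> cs p s0 by (auto simp: hd_map)
  ultimately have "Poly (rev cs) \<noteq> 0" by (metis coeff_0)
  then obtain c w where "w \<in> carrier L" "w \<noteq> \<zero>\<^bsub>L\<^esub>" "x \<otimes>\<^bsub>L\<^esub> w = \<sigma> c \<otimes>\<^bsub>L\<^esub> w"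
    using eigenvector_exists[of "\<one>\<^bsub>L\<^esub>" "Poly (rev cs)"] alg_closed_imp_poly_has_root ev[of cs] p cs
    by (auto simp: V)
  then have "x = \<sigma> c" using L.m_rcancel x hom(1) by auto
  then show ?thesis by auto
qed

section \<open>Commutative rings acting by scalars\<close>

text \<open>
  Negation is multiplication by the scalar \<open>-1\<close>. Without a clause for it, the set depends only on addition and
  multiplication and is the same in a ring and in a subring.
\<close>

inductive_set generated_algebra :: "('h, 'r) ring_scheme \<Rightarrow> ('k \<Rightarrow> 'h) \<Rightarrow> 'h set \<Rightarrow> 'h set"
  for R \<sigma> B where
    scalar: "\<sigma> s \<in> generated_algebra R \<sigma> B"
  | gen: "b \<in> B \<Longrightarrow> b \<in> generated_algebra R \<sigma> B"
  | add: "\<lbrakk>a \<in> generated_algebra R \<sigma> B; b \<in> generated_algebra R \<sigma> B\<rbrakk> \<Longrightarrow> a \<oplus>\<^bsub>R\<^esub> b \<in> generated_algebra R \<sigma> B"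
  | mult: "\<lbrakk>a \<in> generated_algebra R \<sigma> B; b \<in> generated_algebra R \<sigma> B\<rbrakk> \<Longrightarrow> a \<otimes>\<^bsub>R\<^esub> b \<in> generated_algebra R \<sigma> B"

lemma generated_algebra_closed:
  assumes "ring R" "range \<sigma> \<subseteq> carrier R" "B \<subseteq> carrier R" "a \<in> generated_algebra R \<sigma> B"
  shows "a \<in> carrier R"
  using assms(4)
proof induction
  case (add a b)
  then show ?case using ring.ring_simprules(1)[OF assms(1)] by simp
next
  case (mult a b)
  then show ?case using ring.ring_simprules(5)[OF assms(1)] by simp
qed (use assms in auto)

text \<open>
  Divided by its annihilator, the ring becomes a field by Nakayama's argument, and that field is \<open>K\<close> by
  Zariski's lemma.
\<close>

theorem acts_by_scalars:
  fixes \<sigma> :: "'k::alg_closed_field \<Rightarrow> 'h"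
  assumes "left_module A V" "cring A" and \<sigma>: "\<sigma> \<in> Ring.ring_hom class_ring A"
    and xs: "set xs \<subseteq> carrier A" "carrier A = generated_algebra A \<sigma> (set xs)"
    and W: "finite W" "W \<subseteq> carrier V" "module_span A V W = carrier V"
    and nz: "carrier V \<noteq> {\<zero>\<^bsub>V\<^esub>}"
    and surj: "\<And>a. a \<in> carrier A \<Longrightarrow> \<exists>v\<in>carrier V. a \<odot>\<^bsub>V\<^esub> v \<noteq> \<zero>\<^bsub>V\<^esub> \<Longrightarrow>
      carrier V \<subseteq> (\<lambda>v. a \<odot>\<^bsub>V\<^esub> v) ` carrier V"
    and a: "a \<in> carrier A"
  shows "\<exists>s. \<forall>v\<in>carrier V. a \<odot>\<^bsub>V\<^esub> v = \<sigma> s \<odot>\<^bsub>V\<^esub> v"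
proof -
  interpret A: cring A by fact
  interpret left_module A V by fact
  note hom = ring_hom_memE[OF \<sigma>, simplified]
  define I where "I = {a \<in> carrier A. \<forall>v\<in>carrier V. a \<odot>\<^bsub>V\<^esub> v = \<zero>\<^bsub>V\<^esub>}"
  have I: "ideal I A"
  proof (rule idealI[OF A.ring_axioms A.add.subgroupI])
    show "I \<noteq> {}" unfolding I_def using zero_smult by blast
  qed (auto simp: I_def smult_l_distr smult_assoc1 smult_minus_left smult_closed)
  interpret I: ideal I A by (rule I)
  define L where "L = A Quot I"
  have Lc: "cring L" unfolding L_def by (rule I.quotient_is_cring[OF A.is_cring])
  interpret L: cring L by (rule Lc)
  define \<pi> where "\<pi> = (\<lambda>a. I +>\<^bsub>A\<^esub> a)"
  interpret pi: ring_hom_ring A L \<pi> unfolding L_def \<pi>_def by (rule I.rcos_ring_hom_ring)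
  have Lcar: "carrier L = \<pi> ` carrier A"
    unfolding L_def \<pi>_def by (auto simp: FactRing_def A_RCOSETS_def')
  have pi_eq: "\<pi> a = \<pi> b \<longleftrightarrow> (\<forall>v\<in>carrier V. a \<odot>\<^bsub>V\<^esub> v = b \<odot>\<^bsub>V\<^esub> v)" if "a \<in> carrier A" "b \<in> carrier A" for a b
  proof -
    have "\<pi> a = \<pi> b \<longleftrightarrow> a \<ominus>\<^bsub>A\<^esub> b \<in> I"
      unfolding \<pi>_def using that A.quotient_eq_iff_same_a_r_cos[OF I] by simp
    also have "\<dots> \<longleftrightarrow> (\<forall>v\<in>carrier V. (a \<ominus>\<^bsub>A\<^esub> b) \<odot>\<^bsub>V\<^esub> v = \<zero>\<^bsub>V\<^esub>)"
      unfolding I_def using A.minus_closed[OF that] by blast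
    also have "\<dots> \<longleftrightarrow> (\<forall>v\<in>carrier V. a \<odot>\<^bsub>V\<^esub> v = b \<odot>\<^bsub>V\<^esub> v)"
    proof (rule ball_cong[OF refl])
      fix v assume v: "v \<in> carrier V"
      have "(a \<ominus>\<^bsub>A\<^esub> b) \<odot>\<^bsub>V\<^esub> v = a \<odot>\<^bsub>V\<^esub> v \<oplus>\<^bsub>V\<^esub> \<ominus>\<^bsub>V\<^esub> (b \<odot>\<^bsub>V\<^esub> v)"
        unfolding A.minus_eq
        using that v smult_l_distr[of a "\<ominus>\<^bsub>A\<^esub> b" v] smult_minus_left[of b v] by simp
      moreover have "p \<oplus>\<^bsub>V\<^esub> \<ominus>\<^bsub>V\<^esub> r = \<zero>\<^bsub>V\<^esub> \<longleftrightarrow> p = r" if "p \<in> carrier V" "r \<in> carrier V" for p r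
        using that M.minus_equality[of p "\<ominus>\<^bsub>V\<^esub> r"] by (auto simp: M.r_neg)
      ultimately show "(a \<ominus>\<^bsub>A\<^esub> b) \<odot>\<^bsub>V\<^esub> v = \<zero>\<^bsub>V\<^esub> \<longleftrightarrow> a \<odot>\<^bsub>V\<^esub> v = b \<odot>\<^bsub>V\<^esub> v"
        using that v smult_closed by metis
    qed
    finally show ?thesis .
  qed
  have Lf: "field L"
  proof (rule cring.cring_fieldI2[OF Lc])
    obtain v where "v \<in> carrier V" "v \<noteq> \<zero>\<^bsub>V\<^esub>" using nz M.zero_closed by blast
    then have "\<pi> \<zero>\<^bsub>A\<^esub> \<noteq> \<pi> \<one>\<^bsub>A\<^esub>" using pi_eq[of "\<zero>\<^bsub>A\<^esub>" "\<one>\<^bsub>A\<^esub>"] by (auto simp: smult_one)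
    then show "\<zero>\<^bsub>L\<^esub> \<noteq> \<one>\<^bsub>L\<^esub>" by simp
    fix l assume l: "l \<in> carrier L" "l \<noteq> \<zero>\<^bsub>L\<^esub>"
    then obtain z where z: "z \<in> carrier A" "l = \<pi> z" using Lcar by auto
    then have "\<exists>v\<in>carrier V. z \<odot>\<^bsub>V\<^esub> v \<noteq> \<zero>\<^bsub>V\<^esub>"
      using l pi_eq[of z "\<zero>\<^bsub>A\<^esub>"] by auto
    then obtain c where c: "c \<in> carrier A" "\<forall>v\<in>carrier V. (z \<otimes>\<^bsub>A\<^esub> c) \<odot>\<^bsub>V\<^esub> v = v"
      using nakayama_inverse[OF A.is_cring W surj] z by blast
    then have "\<pi> (z \<otimes>\<^bsub>A\<^esub> c) = \<pi> \<one>\<^bsub>A\<^esub>" using z by (subst pi_eq) (auto simp: smult_one)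
    then show "\<exists>b\<in>carrier L. l \<otimes>\<^bsub>L\<^esub> b = \<one>\<^bsub>L\<^esub>" using c z by (intro bexI[of _ "\<pi> c"]) auto
  qed
  interpret L: field L by (rule Lf)
  have ps: "\<pi> \<circ> \<sigma> \<in> Ring.ring_hom class_ring L"
    by (rule ring_hom_trans[OF \<sigma> pi.homh])
  interpret ps: ring_hom_ring class_ring L "\<pi> \<circ> \<sigma>"
    by (rule ring_hom_ringI2[OF ring_class_ring cring.axioms(1)[OF Lc] ps])
  define K where "K = range (\<pi> \<circ> \<sigma>)"
  have K: "subfield K L"
    using ps.img_is_subfield(2)[OF field.carrier_is_subfield[OF class_field.field_axioms]] L.one_not_zero by (simp add: K_def)
  have xs': "set (map \<pi> xs) \<subseteq> carrier L" using xs(1) by auto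
  let ?F = "L.finite_extension K (map \<pi> xs)"
  have F: "subring ?F L" by (rule L.finite_extension_is_subring[OF subfieldE(1)[OF K] xs'])
  have "b \<in> carrier A \<and> \<pi> b \<in> ?F" if "b \<in> generated_algebra A \<sigma> (set xs)" for b
    using that
  proof induction
    case (scalar s)
    then show ?case using hom(1) L.finite_extension_incl[OF subfieldE(3)[OF K] xs'] by (auto simp: K_def)
  next
    case (gen x)
    then show ?case using xs(1) L.finite_extension_mem[OF subfieldE(1)[OF K] xs'] by auto
  qed (use subringE(6,7)[OF F] in auto)
  then have "carrier L \<subseteq> ?F" using Lcar xs(2) by auto
  then have Feq: "?F = carrier L" using subringE(1)[OF F] by auto
  have "set (map \<pi> xs) \<subseteq> K"
    using L.zariski[OF K xs' Feq] algebraic_over_alg_closed[OF Lf ps] xs' unfolding K_def by blast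
  then have "carrier L \<subseteq> K"
    using L.finite_extension_subring_incl[OF subfieldE(1)[OF K] order_refl] Feq by blast
  then obtain s where "\<pi> a = \<pi> (\<sigma> s)" using a Lcar by (auto simp: K_def)
  then show ?thesis using pi_eq[OF a hom(1)] by blast
qed

section \<open>Bases as indexed families\<close>

context vectorspace
begin

lemma basis_of_family:
  assumes w: "\<And>j. j < n \<Longrightarrow> w j \<in> carrier V" and inj: "inj_on w {..<n}"
    and span: "\<And>v. v \<in> carrier V \<Longrightarrow> \<exists>a. (\<forall>j. a j \<in> carrier K) \<and> v = finsum V (\<lambda>j. a j \<odot>\<^bsub>V\<^esub> w j) {..<n::nat}"
    and indep: "\<And>a j. (\<And>j. a j \<in> carrier K) \<Longrightarrow> finsum V (\<lambda>j. a j \<odot>\<^bsub>V\<^esub> w j) {..<n} = \<zero>\<^bsub>V\<^esub> \<Longrightarrow> j < n \<Longrightarrow> a j = \<zero>\<^bsub>K\<^esub>"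
  shows "basis (w ` {..<n})" "fin_dim" "dim = n"
proof -
  let ?B = "w ` {..<n}"
  have B: "finite ?B" "?B \<subseteq> carrier V" using w by auto
  have lc: "lincomb a ?B = finsum V (\<lambda>j. a (w j) \<odot>\<^bsub>V\<^esub> w j) {..<n}" if "a \<in> ?B \<rightarrow> carrier K" for a
    unfolding lincomb_def using that w inj by (subst finsum_reindex) auto
  have "lin_indpt ?B"
  proof (rule finite_lin_indpt2[OF B])
    fix a assume a: "a \<in> ?B \<rightarrow> carrier K" "lincomb a ?B = \<zero>\<^bsub>V\<^esub>"
    let ?a = "\<lambda>j. if j < n then a (w j) else \<zero>\<^bsub>K\<^esub>"
    have "finsum V (\<lambda>j. ?a j \<odot>\<^bsub>V\<^esub> w j) {..<n} = \<zero>\<^bsub>V\<^esub>"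
      using a(2) lc[OF a(1)] w a(1) by (subst finsum_cong'[of _ "{..<n}" "\<lambda>j. a (w j) \<odot>\<^bsub>V\<^esub> w j"]) auto
    then have "?a j = \<zero>\<^bsub>K\<^esub>" if "j < n" for j
      using that a(1) by (intro indep[of ?a]) auto
    then show "\<forall>v\<in>?B. a v = \<zero>\<^bsub>K\<^esub>" by fastforce
  qed
  moreover have gen: "gen_set ?B"
  proof (rule equalityI[OF span_is_subset2[OF B(2)]], rule subsetI)
    fix v assume "v \<in> carrier V"
    then obtain a where a: "\<And>j. a j \<in> carrier K" "v = finsum V (\<lambda>j. a j \<odot>\<^bsub>V\<^esub> w j) {..<n}" using span by blast
    let ?a = "\<lambda>b. a (the_inv_into {..<n} w b)"
    have "lincomb ?a ?B = v"
      using a w inj by (subst lc) (auto intro!: finsum_cong' simp: the_inv_into_f_f)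
    then show "v \<in> span ?B" using a(1) B(1) unfolding span_def by (auto intro!: exI[of _ ?a] exI[of _ ?B])
  qed
  ultimately show b: "basis ?B" using B by (simp add: basis_def)
  show "fin_dim" using gen B by (auto simp: fin_dim_def)
  show "dim = n" using dim_basis[OF B(1) b] card_image[OF inj] by simp
qed

lemma basis_expansion:
  assumes inj: "inj_on w {..<n::nat}" and b: "basis (w ` {..<n})" and v: "v \<in> carrier V"
  shows "\<exists>a. (\<forall>j<n. a j \<in> carrier K) \<and> v = finsum V (\<lambda>j. a j \<odot>\<^bsub>V\<^esub> w j) {..<n}"
proof -
  let ?B = "w ` {..<n}"
  have B: "finite ?B" "?B \<subseteq> carrier V" "v \<in> span ?B" using b v by (auto simp: basis_def)
  obtain a where a: "a \<in> ?B \<rightarrow> carrier K" "lincomb a ?B = v" using finite_in_span[OF B] by blast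
  have "lincomb a ?B = finsum V (\<lambda>j. a (w j) \<odot>\<^bsub>V\<^esub> w j) {..<n}"
    unfolding lincomb_def using a(1) B(2) inj by (subst finsum_reindex) auto
  then show ?thesis using a by (intro exI[of _ "\<lambda>j. a (w j)"]) auto
qed

end

section \<open>Powers in finitely generated abelian groups\<close>

text \<open>
  A new generator \<open>s\<close> replaces \<open>T\<close> by the products \<open>s^k r\<close> with \<open>k < n\<close> and \<open>r\<close> in \<open>T\<close>, since \<open>s^n\<close> lies in
  \<open>P\<close>. The induction carries along that \<open>T P\<close> is a subgroup.
\<close>

lemma (in comm_group) finite_transversal:
  assumes P: "subgroup P G" and S: "finite S" "S \<subseteq> carrier G" and pow: "\<And>s. s \<in> S \<Longrightarrow> s [^] n \<in> P"
    and n: "n > (0::nat)"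
  shows "\<exists>T. finite T \<and> T \<subseteq> carrier G \<and> generate G S \<subseteq> T <#> P"
proof -
  have "\<exists>T. finite T \<and> T \<subseteq> carrier G \<and> subgroup (T <#> P) G \<and> P \<subseteq> T <#> P \<and> S \<subseteq> T <#> P"
    using S pow
  proof (induction S rule: finite_induct)
    case empty
    have "{\<one>} <#> P = P" using subgroup.subset[OF P] by (force simp: set_mult_def)
    then show ?case using P by (intro exI[of _ "{\<one>}"]) auto
  next
    case (insert s S)
    then obtain T where T: "finite T" "T \<subseteq> carrier G" "subgroup (T <#> P) G" "P \<subseteq> T <#> P" "S \<subseteq> T <#> P" by auto
    define U where "U = T <#> P"
    interpret U: subgroup U G using T by (simp add: U_def)
    have s: "s \<in> carrier G" "s [^] n \<in> U" using insert.prems T by (auto simp: U_def)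
    have pw: "(s [^] n) [^] (m::nat) \<in> U" for m using s(2) by (induction m) auto
    define T' where "T' = (\<lambda>(k, r). s [^] (k::nat) \<otimes> r) ` ({..<n} \<times> T)"
    have mem: "T' <#> P = {s [^] (k::nat) \<otimes> u | k u. u \<in> U}"
    proof (intro equalityI subsetI)
      fix x assume "x \<in> T' <#> P"
      then obtain k r p where "x = s [^] (k::nat) \<otimes> r \<otimes> p" "r \<in> T" "p \<in> P" by (auto simp: T'_def set_mult_def)
      then have "x = s [^] k \<otimes> (r \<otimes> p)" "r \<otimes> p \<in> U"
        using s T(2) subgroup.subset[OF P] by (auto simp: m_assoc U_def set_mult_def subset_iff)
      then show "x \<in> {s [^] (k::nat) \<otimes> u | k u. u \<in> U}" by blast
    next
      fix x assume "x \<in> {s [^] (k::nat) \<otimes> u | k u. u \<in> U}"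
      then obtain k u where ku: "x = s [^] (k::nat) \<otimes> u" "u \<in> U" by auto
      have "s [^] k = s [^] (k mod n) \<otimes> (s [^] n) [^] (k div n)"
        using s by (simp add: nat_pow_pow nat_pow_mult)
      moreover have pw: "(s [^] n) [^] (k div n) \<in> U" using pw by blast
      ultimately have "x = s [^] (k mod n) \<otimes> ((s [^] n) [^] (k div n) \<otimes> u)"
        using ku s by (simp add: m_assoc)
      moreover obtain r p where rp: "(s [^] n) [^] (k div n) \<otimes> u = r \<otimes> p" "r \<in> T" "p \<in> P"
        using U.m_closed[OF pw ku(2)] by (auto simp: U_def set_mult_def)
      ultimately have "x = (s [^] (k mod n) \<otimes> r) \<otimes> p"
        using s T(2) subgroup.subset[OF P] by (auto simp: m_assoc subset_iff)
      moreover have "s [^] (k mod n) \<otimes> r \<in> T'" using rp n by (auto simp: T'_def intro!: image_eqI[of _ _ "(k mod n, r)"])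
      ultimately show "x \<in> T' <#> P" using rp by (auto simp: set_mult_def)
    qed
    have sub: "subgroup (T' <#> P) G"
    proof (rule subgroupI)
      show "T' <#> P \<subseteq> carrier G" using s by (auto simp: mem)
      show "T' <#> P \<noteq> {}" unfolding mem using U.one_closed by blast
      fix x assume "x \<in> T' <#> P"
      then obtain k u where ku: "x = s [^] (k::nat) \<otimes> u" "u \<in> U" by (auto simp: mem)
      have "(s [^] n) [^] k \<in> U" using s(2) by (induction k) auto
      then have v: "inv ((s [^] n) [^] k) \<otimes> inv u \<in> U" using ku by auto
      have "x \<otimes> (s [^] (k * (n - 1)) \<otimes> (inv ((s [^] n) [^] k) \<otimes> inv u))
          = (s [^] k \<otimes> s [^] (k * (n - 1))) \<otimes> inv ((s [^] n) [^] k) \<otimes> (u \<otimes> inv u)"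
      proof -
        have "(a \<otimes> b) \<otimes> (d \<otimes> (e \<otimes> f)) = (a \<otimes> d) \<otimes> e \<otimes> (b \<otimes> f)"
          if "a \<in> carrier G" "b \<in> carrier G" "d \<in> carrier G" "e \<in> carrier G" "f \<in> carrier G" for a b d e f
          using that by (simp add: m_ac)
        then show ?thesis using ku s by simp
      qed
      also have "s [^] k \<otimes> s [^] (k * (n - 1)) = (s [^] n) [^] k"
        using s n by (simp add: nat_pow_pow nat_pow_mult) (metis Suc_pred mult.commute mult_Suc)
      finally have "inv x = s [^] (k * (n - 1)) \<otimes> (inv ((s [^] n) [^] k) \<otimes> inv u)"
        using ku s by (intro comm_inv_char) auto
      then show "inv x \<in> T' <#> P" using v by (auto simp: mem)
      fix y assume "y \<in> T' <#> P"
      then obtain l v where lv: "y = s [^] (l::nat) \<otimes> v" "v \<in> U" by (auto simp: mem)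
      have "(a \<otimes> b) \<otimes> (d \<otimes> e) = (a \<otimes> d) \<otimes> (b \<otimes> e)"
        if "a \<in> carrier G" "b \<in> carrier G" "d \<in> carrier G" "e \<in> carrier G" for a b d e
        using that by (simp add: m_ac)
      then have "x \<otimes> y = (s [^] k \<otimes> s [^] l) \<otimes> (u \<otimes> v)" using ku lv s by simp
      then show "x \<otimes> y \<in> T' <#> P" using ku lv s by (auto simp: mem nat_pow_mult)
    qed
    have U: "U \<subseteq> T' <#> P" unfolding mem by (force intro!: exI[of _ "0::nat"])
    have "s = s [^] (1::nat) \<otimes> \<one>" using s by simp
    then have "s \<in> T' <#> P" unfolding mem using U.one_closed by blast
    then show ?case using sub U T s by (intro exI[of _ T']) (auto simp: T'_def U_def)
  qed
  then show ?thesis using generate_subgroup_incl by blast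
qed

section \<open>The algebra and its modules\<close>

locale hopf_setting =
  fixes G :: "('g, 'r) monoid_scheme" and \<chi> :: "'g \<Rightarrow> 'k::field" and t :: int
    and n :: nat and q :: 'k and c :: 'g
  assumes G: "comm_group G" and chi: "\<chi> \<in> hom G field_units" and c: "c \<in> carrier G"
    and q: "q = inverse (\<chi> c)" and primitive: "primitive_root_of_unity n q"
    and image: "generate field_units {q} = \<chi> ` carrier G"
begin

sublocale G: comm_group G by (rule G)

abbreviation "\<eta> \<equiv> \<lambda>g. \<chi> g powi t"
abbreviation "H \<equiv> hopf_algebra G \<chi> \<eta>"
abbreviation "N \<equiv> kernel G field_units \<chi>"
abbreviation "RN \<equiv> poly_group_ring G \<chi> \<eta> N"

lemma chi_nonzero: "g \<in> carrier G \<Longrightarrow> \<chi> g \<noteq> 0"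
  using chi by (auto simp: hom_def)

lemma chi_mult: "g \<in> carrier G \<Longrightarrow> h \<in> carrier G \<Longrightarrow> \<chi> (g \<otimes>\<^bsub>G\<^esub> h) = \<chi> g * \<chi> h"
  using chi by (auto simp: hom_def)

lemma eta: "\<eta> \<in> hom G field_units"
  using chi_nonzero chi_mult by (auto simp: hom_def power_int_mult_distrib)

lemmas mult_single = hopf_mult_single[OF G chi eta]
lemmas chi_one = char_one(1)[OF G chi eta]

sublocale H: ring H by (rule ring_hopf_algebra[OF G chi eta])

lemma H_sel:
  "carrier H = {a. Poly_Mapping.keys a \<subseteq> UNIV \<times> UNIV \<times> carrier G}"
  "monoid.mult H = hopf_mult G \<chi> \<eta>" "add H = (+)" "ring.zero H = 0"
  "one H = Poly_Mapping.single (0, 0, \<one>\<^bsub>G\<^esub>) 1"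
  by (simp_all add: hopf_algebra_def)

lemma N_iff: "h \<in> N \<longleftrightarrow> h \<in> carrier G \<and> \<chi> h = 1"
  by (auto simp: kernel_def)

lemma chi_pow: "g \<in> carrier G \<Longrightarrow> \<chi> (g [^]\<^bsub>G\<^esub> (k::nat)) = \<chi> g ^ k"
  by (induction k) (auto simp: chi_one chi_mult)

lemma chi_inv: "g \<in> carrier G \<Longrightarrow> \<chi> (inv\<^bsub>G\<^esub> g) = inverse (\<chi> g)"
  using chi_mult[of g "inv\<^bsub>G\<^esub> g"] chi_one by (metis G.inv_closed G.r_inv inverse_unique)

lemma subgroup_N: "subgroup N G"
proof (rule G.subgroupI)
  show "N \<noteq> {}" using N_iff[of "\<one>\<^bsub>G\<^esub>"] chi_one by auto
qed (auto simp: N_iff chi_mult chi_inv)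

lemma n_pos: "n > 0" and q_pow_n: "q ^ n = 1" and q_nonzero: "q \<noteq> 0"
  using primitive c chi_nonzero q by (auto simp: primitive_root_of_unity_def)

lemma chi_c: "\<chi> c = inverse q"
  by (simp add: q)

lemma q_pow_mod: "q ^ (k mod n) = q ^ k"
proof -
  have "q ^ k = q ^ (n * (k div n) + k mod n)" by simp
  also have "\<dots> = q ^ (k mod n)" unfolding power_add power_mult q_pow_n by simp
  finally show ?thesis by simp
qed

lemma q_pow_inj:
  assumes "i < n" "j < n" "q ^ i = q ^ j"
  shows "i = j"
proof -
  have "a = b" if "a \<le> b" "b < n" "q ^ a = q ^ b" for a b
  proof (rule ccontr)
    assume "a \<noteq> b"
    then have "0 < b - a" "b - a < n" using that by auto
    moreover have "q ^ a * q ^ (b - a) = q ^ a * 1"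
      using that power_add[of q a "b - a"] by simp
    then have "q ^ (b - a) = 1" using q_nonzero by simp
    ultimately show False using primitive by (auto simp: primitive_root_of_unity_def)
  qed
  then show ?thesis using assms by (metis nle_le)
qed

lemma chi_image:
  assumes "g \<in> carrier G"
  shows "\<exists>k. \<chi> g = q ^ k"
proof -
  have "\<chi> g \<in> generate field_units {q}" using assms image by blast
  then have "\<exists>k. \<chi> g = q ^ k"
  proof induction
    case one
    show ?case by (auto intro: exI[of _ 0])
  next
    case (incl h)
    then show ?case by (auto intro: exI[of _ 1])
  next
    case (inv h)
    have "q * q ^ (n - 1) = 1" using q_pow_n n_pos by (simp flip: power_Suc)
    moreover have "inv\<^bsub>field_units\<^esub> q = inverse q"
      using field.field_mult_group[OF class_field.field_axioms] q_nonzero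
      by (intro group.inv_equality) auto
    ultimately show ?case using inv by (auto intro!: exI[of _ "n - 1"] simp: inverse_unique)
  next
    case (eng h1 h2)
    then show ?case by (auto simp flip: power_add)
  qed
  then show ?thesis .
qed

lemma chi_pow_n: "g \<in> carrier G \<Longrightarrow> \<chi> g ^ n = 1"
  using chi_image[of g] q_pow_n by (metis power_mult power_one mult.commute)

text \<open>
  Every value of \<open>\<chi>\<close> is a power of \<open>q\<close>, hence taken at a power of \<open>c\<close>.
\<close>

lemma coset_decomposition:
  assumes "g \<in> carrier G"
  shows "\<exists>k<n. \<exists>h\<in>N. g = c [^]\<^bsub>G\<^esub> k \<otimes>\<^bsub>G\<^esub> h"
proof -
  obtain m where m: "\<chi> g = q ^ m" using chi_image assms by blast
  \<comment> \<open>\<open>k\<close> is \<open>-m\<close> modulo \<open>n\<close>, because \<open>\<chi> (c^k) = q^(-k)\<close>\<close>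
  define k where "k = (n - m mod n) mod n"
  have "q ^ (k + m) = q ^ ((k + m) mod n)" by (rule q_pow_mod[symmetric])
  also have "(k + m) mod n = ((n - m mod n) + m mod n) mod n"
    unfolding k_def by (simp add: mod_simps)
  also have "\<dots> = 0" using n_pos by simp
  finally have km: "q ^ k * q ^ m = 1" by (simp add: power_add)
  define h where "h = inv\<^bsub>G\<^esub> (c [^]\<^bsub>G\<^esub> k) \<otimes>\<^bsub>G\<^esub> g"
  have "\<chi> h = q ^ k * q ^ m"
    unfolding h_def using assms c m by (simp add: chi_mult chi_inv chi_pow chi_c power_inverse)
  then have "h \<in> N" using km assms c by (simp add: N_iff h_def)
  moreover have "g = c [^]\<^bsub>G\<^esub> k \<otimes>\<^bsub>G\<^esub> h" using assms c by (simp add: h_def G.m_assoc[symmetric])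
  ultimately show ?thesis using n_pos by (intro exI[of _ k]) (auto simp: k_def)
qed

lemma scalar_hom: "scalar G \<in> Ring.ring_hom class_ring H"
  by (rule ring_hom_memI) (auto simp: H_sel scalar_def mult_single chi_one single_add split: if_splits)

lemma hopf_induct_H [consumes 1, case_names zero single add]:
  assumes "a \<in> carrier H" "P 0"
    "\<And>i j g p. g \<in> carrier G \<Longrightarrow> P (Poly_Mapping.single (i,j,g) p)"
    "\<And>a b. a \<in> carrier H \<Longrightarrow> b \<in> carrier H \<Longrightarrow> P a \<Longrightarrow> P b \<Longrightarrow> P (a + b)"
  shows "P a"
proof -
  have "a \<in> carrier H \<and> P a"
    using assms(1)[unfolded H_sel mem_Collect_eq]
  proof (induction rule: hopf_induct[OF G chi eta, consumes 1, case_names zero single add])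
    case (add a b)
    then show ?case using assms(4) H.add.m_closed[of a b] by (simp add: H_sel)
  qed (use assms in \<open>auto simp: H_sel\<close>)
  then show ?thesis ..
qed

lemma single_carrier [simp]: "g \<in> carrier G \<Longrightarrow> Poly_Mapping.single (i, j, g) p \<in> carrier H"
  by (auto simp: H_sel split: if_splits)

lemma generator_carrier [simp]:
  "scalar G s \<in> carrier H" "gen_x G \<in> carrier H" "gen_y G \<in> carrier H" "g \<in> carrier G \<Longrightarrow> grp g \<in> carrier H"
  unfolding scalar_def gen_x_def gen_y_def grp_def by simp_all

lemma scalar_central:
  assumes "a \<in> carrier H"
  shows "scalar G s \<otimes>\<^bsub>H\<^esub> a = a \<otimes>\<^bsub>H\<^esub> scalar G s"
  using assms
proof (induction rule: hopf_induct_H)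
  case zero
  then show ?case by (simp add: H_sel hopf_mult_zero[OF G chi eta])
next
  case (single i j g p)
  then show ?case by (simp add: H_sel scalar_def mult_single chi_one mult_ac)
next
  case (add a b)
  then show ?case by (simp add: H_sel hopf_mult_add_left[OF G chi eta] hopf_mult_add_right[OF G chi eta])
qed

end

text \<open>
  Scalars act through their images in the algebra, so that linearity over the field is part of the module
  axioms.
\<close>

locale hopf_module = hopf_setting G \<chi> t n q c + left_module "hopf_algebra G \<chi> (\<lambda>g. \<chi> g powi t)" V
  for G :: "('g, 'r) monoid_scheme" and \<chi> :: "'g \<Rightarrow> 'k::field" and t n q c
    and V :: "(nat \<times> nat \<times> 'g \<Rightarrow>\<^sub>0 'k, 'v, 's) module_scheme" (structure)
begin

abbreviation scale :: "'k \<Rightarrow> 'v \<Rightarrow> 'v" (infixr \<open>\<cdot>\<close> 75) where "s \<cdot> v \<equiv> scalar G s \<odot>\<^bsub>V\<^esub> v"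

lemmas smult_carrier [simp] = smult_closed[OF single_carrier] smult_closed[OF generator_carrier(1)]
  smult_closed[OF generator_carrier(2)] smult_closed[OF generator_carrier(3)] smult_closed[OF generator_carrier(4)]

lemma K_space_sel [simp]:
  "carrier (K_space G V) = carrier V" "add (K_space G V) = add V" "ring.zero (K_space G V) = \<zero>"
  "smult (K_space G V) = (\<lambda>s v. s \<cdot> v)"
  by (simp_all add: K_space_def)

lemma scale_simps:
  "v \<in> carrier V \<Longrightarrow> s \<cdot> s' \<cdot> v = (s * s') \<cdot> v"
  "v \<in> carrier V \<Longrightarrow> (s + s') \<cdot> v = s \<cdot> v \<oplus> s' \<cdot> v"
  "v \<in> carrier V \<Longrightarrow> w \<in> carrier V \<Longrightarrow> s \<cdot> (v \<oplus> w) = s \<cdot> v \<oplus> s \<cdot> w"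
  "v \<in> carrier V \<Longrightarrow> 1 \<cdot> v = v" "v \<in> carrier V \<Longrightarrow> 0 \<cdot> v = \<zero>" "s \<cdot> \<zero> = \<zero>"
proof -
  note hom = ring_hom_memE[OF scalar_hom]
  show "v \<in> carrier V \<Longrightarrow> s \<cdot> s' \<cdot> v = (s * s') \<cdot> v"
    using smult_assoc1[of "scalar G s" "scalar G s'" v] hom(2)[of s s'] by simp
  show "v \<in> carrier V \<Longrightarrow> (s + s') \<cdot> v = s \<cdot> v \<oplus> s' \<cdot> v"
    using smult_l_distr[of "scalar G s" "scalar G s'" v] hom(3)[of s s'] by (simp add: H_sel(3))
  show "v \<in> carrier V \<Longrightarrow> w \<in> carrier V \<Longrightarrow> s \<cdot> (v \<oplus> w) = s \<cdot> v \<oplus> s \<cdot> w"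
    using smult_r_distr[of "scalar G s" v w] by simp
  show "v \<in> carrier V \<Longrightarrow> 1 \<cdot> v = v"
    using smult_one[of v] hom(4) by (simp add: H_sel)
  show "v \<in> carrier V \<Longrightarrow> 0 \<cdot> v = \<zero>"
    using zero_smult[of v] by (simp add: H_sel scalar_def)
  show "s \<cdot> \<zero> = \<zero>" using smult_zero[of "scalar G s"] by simp
qed

lemma scale_commute:
  "a \<in> carrier H \<Longrightarrow> v \<in> carrier V \<Longrightarrow> a \<odot>\<^bsub>V\<^esub> (s \<cdot> v) = s \<cdot> (a \<odot>\<^bsub>V\<^esub> v)"
  using smult_assoc1[of a "scalar G s" v] smult_assoc1[of "scalar G s" a v] scalar_central[of a s]
  by simp

text \<open>
  A scalar can be read off from its action on a nonzero vector. Multiplicativity of weights rests on this.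
\<close>

lemma scale_cancel:
  assumes "v \<in> carrier V" "v \<noteq> \<zero>" "s \<cdot> v = s' \<cdot> v"
  shows "s = s'"
proof (rule ccontr)
  assume "s \<noteq> s'"
  have "(s - s') \<cdot> v = s \<cdot> v \<oplus> (- s') \<cdot> v" using scale_simps(2)[of v s "- s'"] assms(1) by simp
  also have "\<dots> = (s' + - s') \<cdot> v" using assms scale_simps(2)[of v s' "- s'"] by simp
  also have "\<dots> = \<zero>" using assms scale_simps(5) by simp
  finally have "inverse (s - s') \<cdot> (s - s') \<cdot> v = \<zero>" using scale_simps(6) by simp
  then show False using assms \<open>s \<noteq> s'\<close> by (simp add: scale_simps)
qed

lemma scale_eq_zero_iff: "v \<in> carrier V \<Longrightarrow> s \<cdot> v = \<zero> \<longleftrightarrow> s = 0 \<or> v = \<zero>"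
  using scale_cancel[of v s 0] scale_simps(5)[of v] scale_simps(6)[of s] by auto

lemma abelian_group_K_space: "abelian_group (K_space G V)"
  by (rule abelian_groupI) (use M.l_neg in \<open>auto simp: M.a_ac\<close>)

lemma vectorspace_K_space: "vectorspace class_ring (K_space G V)"
  by (intro vectorspace.intro module.intro module_axioms.intro abelian_group_K_space
      class_field.field_axioms fieldE(1)[OF class_field.field_axioms])
    (auto simp: scale_simps)

lemma finsum_K_space: "finsum (K_space G V) = finsum V"
  by (intro ext) (simp add: finsum_def finprod_def)

lemma x_grp:
  assumes "g \<in> carrier G" "v \<in> carrier V"
  shows "gen_x G \<odot>\<^bsub>V\<^esub> (grp g \<odot>\<^bsub>V\<^esub> v) = \<chi> g \<cdot> (grp g \<odot>\<^bsub>V\<^esub> (gen_x G \<odot>\<^bsub>V\<^esub> v))"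
  using hopf_relations(2)[OF G chi eta assms(1)] assms
  by (simp flip: smult_assoc1)

lemma y_grp:
  assumes "g \<in> carrier G" "v \<in> carrier V"
  shows "gen_y G \<odot>\<^bsub>V\<^esub> (grp g \<odot>\<^bsub>V\<^esub> v) = \<eta> g \<cdot> (grp g \<odot>\<^bsub>V\<^esub> (gen_y G \<odot>\<^bsub>V\<^esub> v))"
  using hopf_relations(3)[OF G chi eta assms(1)] assms
  by (simp flip: smult_assoc1)

lemma x_y:
  assumes "v \<in> carrier V"
  shows "gen_x G \<odot>\<^bsub>V\<^esub> (gen_y G \<odot>\<^bsub>V\<^esub> v) = gen_y G \<odot>\<^bsub>V\<^esub> (gen_x G \<odot>\<^bsub>V\<^esub> v)"
  using hopf_relations(1)[OF G chi eta] assms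
  by (simp flip: smult_assoc1)

lemma grp_grp:
  assumes "g \<in> carrier G" "h \<in> carrier G" "v \<in> carrier V"
  shows "grp g \<odot>\<^bsub>V\<^esub> (grp h \<odot>\<^bsub>V\<^esub> v) = grp (g \<otimes>\<^bsub>G\<^esub> h) \<odot>\<^bsub>V\<^esub> v"
  using hopf_relations(4)[OF G chi eta, of g h] assms by (simp flip: smult_assoc1)

lemma grp_one: "v \<in> carrier V \<Longrightarrow> grp \<one>\<^bsub>G\<^esub> \<odot>\<^bsub>V\<^esub> v = v"
  using smult_one[of v] by (simp add: H_sel grp_def)

lemma funpow_closed [simp]:
  "a \<in> carrier H \<Longrightarrow> v \<in> carrier V \<Longrightarrow> ((\<lambda>w. a \<odot>\<^bsub>V\<^esub> w) ^^ k) v \<in> carrier V"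
  by (induction k) (auto simp: smult_closed)

lemma pow_smult:
  assumes "a \<in> carrier H" "v \<in> carrier V"
  shows "(a [^]\<^bsub>H\<^esub> (k::nat)) \<odot>\<^bsub>V\<^esub> v = ((\<lambda>w. a \<odot>\<^bsub>V\<^esub> w) ^^ k) v"
proof (induction k)
  case 0
  then show ?case using assms smult_one[of v] by simp
next
  case (Suc k)
  have "(a [^]\<^bsub>H\<^esub> Suc k) = a \<otimes>\<^bsub>H\<^esub> a [^]\<^bsub>H\<^esub> k" using assms(1) by (rule H.nat_pow_Suc2)
  then show ?case using Suc assms smult_assoc1[of a "a [^]\<^bsub>H\<^esub> k" v] by simp
qed

lemma single_smult:
  assumes "g \<in> carrier G" "v \<in> carrier V"
  shows "Poly_Mapping.single (i, j, g) p \<odot>\<^bsub>V\<^esub> v =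
    p \<cdot> ((\<lambda>w. gen_x G \<odot>\<^bsub>V\<^esub> w) ^^ i) (((\<lambda>w. gen_y G \<odot>\<^bsub>V\<^esub> w) ^^ j) (grp g \<odot>\<^bsub>V\<^esub> v))"
  unfolding hopf_monomial[OF G chi eta assms(1)]
  using assms by (simp add: smult_assoc1 pow_smult smult_closed)

text \<open>
  Closure under negation comes from the scalar \<open>-1\<close>.
\<close>

lemma submodule_of_closed:
  assumes W: "W \<subseteq> carrier V" "\<zero> \<in> W" "\<And>v w. v \<in> W \<Longrightarrow> w \<in> W \<Longrightarrow> v \<oplus> w \<in> W"
    "\<And>a v. a \<in> carrier H \<Longrightarrow> v \<in> W \<Longrightarrow> a \<odot>\<^bsub>V\<^esub> v \<in> W"
  shows "Module.submodule W H V"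
proof -
  have "subgroup W (add_monoid V)"
  proof (rule M.add.subgroupI)
    fix v assume v: "v \<in> W"
    then have vc: "v \<in> carrier V" using W(1) by blast
    have "(-1) \<cdot> v \<oplus> 1 \<cdot> v = (-1 + 1) \<cdot> v" using scale_simps(2)[OF vc, of "-1" 1] by (rule sym)
    then have "(-1) \<cdot> v \<oplus> v = \<zero>" using vc by (simp add: scale_simps)
    then have "\<ominus> v = (-1) \<cdot> v"
      using vc M.minus_equality[of "(-1) \<cdot> v" v] by simp
    then show "\<ominus> v \<in> W" using W(4)[of "scalar G (-1)" v] v generator_carrier(1) by metis
  qed (use W in auto)
  then show ?thesis using W(4) by (simp add: Module.submodule_def Module.submodule_axioms_def)
qed

end

section \<open>Modules generated by a weight vector\<close>

context hopf_module
begin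

lemma smult_finsum:
  assumes "finite A" "a \<in> carrier H" "f \<in> A \<rightarrow> carrier V"
  shows "a \<odot>\<^bsub>V\<^esub> finsum V f A = finsum V (\<lambda>i. a \<odot>\<^bsub>V\<^esub> f i) A"
  using assms(1,3)
proof (induction A rule: finite_induct)
  case (insert i A)
  have "(\<lambda>i. a \<odot>\<^bsub>V\<^esub> f i) \<in> A \<rightarrow> carrier V" "a \<odot>\<^bsub>V\<^esub> f i \<in> carrier V"
    using insert.prems assms(2) by (auto intro!: smult_closed)
  then show ?case using insert assms(2) by (simp add: M.finsum_insert smult_r_distr M.finsum_closed)
qed (use smult_zero[OF assms(2)] in simp)

text \<open>
  The operator \<open>a - \<mu>\<^sub>m\<close> removes the last term of a relation and multiplies each other term by the nonzero
  number \<open>\<mu>\<^sub>j - \<mu>\<^sub>m\<close>.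
\<close>

lemma eigenvectors_independent:
  assumes a: "a \<in> carrier H"
  shows "\<lbrakk>\<And>j. j < m \<Longrightarrow> w j \<in> carrier V; \<And>j. j < m \<Longrightarrow> a \<odot>\<^bsub>V\<^esub> w j = \<mu> j \<cdot> w j;
    inj_on \<mu> {..<m}; finsum V w {..<m::nat} = \<zero>; j < m\<rbrakk> \<Longrightarrow> w j = \<zero>"
proof (induction m arbitrary: w j)
  case (Suc m)
  note w = Suc.prems(1) and ev = Suc.prems(2)
  let ?S = "finsum V w {..<m}"
  have S: "?S \<in> carrier V" using w by (intro M.finsum_closed) auto
  have sum0: "w m \<oplus> ?S = \<zero>"
    using Suc.prems(4) w by (simp add: lessThan_Suc M.finsum_insert Pi_def)
  have aS: "a \<odot>\<^bsub>V\<^esub> ?S = finsum V (\<lambda>j. \<mu> j \<cdot> w j) {..<m}"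
    using w ev by (subst smult_finsum[OF _ a]) (auto intro!: M.finsum_cong')
  have aSc: "a \<odot>\<^bsub>V\<^esub> ?S \<in> carrier V" using S a smult_closed by blast
  have e1: "\<mu> m \<cdot> w m \<oplus> a \<odot>\<^bsub>V\<^esub> ?S = \<zero>"
    using arg_cong[OF sum0, of "\<lambda>v. a \<odot>\<^bsub>V\<^esub> v"] a w S ev smult_zero[OF a] by (simp add: smult_r_distr)
  have e2: "(- \<mu> m) \<cdot> w m \<oplus> (- \<mu> m) \<cdot> ?S = \<zero>"
    using arg_cong[OF sum0, of "\<lambda>v. (- \<mu> m) \<cdot> v"] w S by (simp add: scale_simps)
  have e3: "\<mu> m \<cdot> w m \<oplus> (- \<mu> m) \<cdot> w m = \<zero>"
    using scale_simps(2)[of "w m" "\<mu> m" "- \<mu> m"] w scale_simps(5)[of "w m"] by simp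
  have "finsum V (\<lambda>j. (\<mu> j - \<mu> m) \<cdot> w j) {..<m} = finsum V (\<lambda>j. \<mu> j \<cdot> w j \<oplus> (- \<mu> m) \<cdot> w j) {..<m}"
  proof (rule M.finsum_cong')
    show "(\<mu> j - \<mu> m) \<cdot> w j = \<mu> j \<cdot> w j \<oplus> (- \<mu> m) \<cdot> w j" if "j \<in> {..<m}" for j
      using scale_simps(2)[of "w j" "\<mu> j" "- \<mu> m"] w that by simp
  qed (use w in auto)
  also have "\<dots> = a \<odot>\<^bsub>V\<^esub> ?S \<oplus> (- \<mu> m) \<cdot> ?S"
    unfolding aS using w by (subst smult_finsum) (auto simp: M.finsum_addf Pi_def)
  also have "\<dots> = (\<mu> m \<cdot> w m \<oplus> a \<odot>\<^bsub>V\<^esub> ?S) \<oplus> ((- \<mu> m) \<cdot> w m \<oplus> (- \<mu> m) \<cdot> ?S)"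
  proof -
    have "A \<oplus> B = (C \<oplus> A) \<oplus> (D \<oplus> B)" if "A \<in> carrier V" "B \<in> carrier V" "C \<in> carrier V" "D \<in> carrier V" "C \<oplus> D = \<zero>" for A B C D
    proof -
      have "(C \<oplus> A) \<oplus> (D \<oplus> B) = (C \<oplus> D) \<oplus> (A \<oplus> B)" using that by (simp add: M.a_ac)
      then show ?thesis using that by simp
    qed
    from this[OF aSc _ _ _ e3] show ?thesis using S w by simp
  qed
  also have "\<dots> = \<zero>" by (simp only: e1 e2 M.l_zero M.zero_closed)
  finally have zero: "finsum V (\<lambda>j. (\<mu> j - \<mu> m) \<cdot> w j) {..<m} = \<zero>" .
  have diff: "(\<mu> j - \<mu> m) \<cdot> w j = \<zero>" if "j < m" for j
  proof (rule Suc.IH[of "\<lambda>j. (\<mu> j - \<mu> m) \<cdot> w j"])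
    show "a \<odot>\<^bsub>V\<^esub> ((\<mu> j - \<mu> m) \<cdot> w j) = \<mu> j \<cdot> ((\<mu> j - \<mu> m) \<cdot> w j)" if "j < m" for j
      using that w[of j] ev[of j] by (simp add: scale_commute[OF a] scale_simps mult.commute)
    show "inj_on \<mu> {..<m}" using Suc.prems(3) by (auto intro: inj_on_subset)
  qed (use w that zero in auto)
  then have wj: "w j = \<zero>" if "j < m" for j
  proof -
    have "\<mu> j \<noteq> \<mu> m" using that inj_onD[OF Suc.prems(3), of j m] by auto
    then show ?thesis using diff[OF that] w that by (auto simp: scale_eq_zero_iff)
  qed
  then have "?S = \<zero>" by (intro M.add.finprod_one_eqI) auto
  then have "w m = \<zero>" using sum0 w by simp
  then show ?case using wj Suc.prems(5) by (cases "j = m") auto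
qed simp

lemma funpow_eigenvector:
  assumes "a \<in> carrier H" "w \<in> carrier V" "a \<odot>\<^bsub>V\<^esub> w = \<mu> \<cdot> w"
  shows "((\<lambda>v. a \<odot>\<^bsub>V\<^esub> v) ^^ i) (s \<cdot> w) = (\<mu> ^ i * s) \<cdot> w"
  using assms by (induction i) (auto simp: scale_commute[of a] scale_simps mult_ac)

end

text \<open>
  The character of \<open>R[N]\<close> that takes \<open>x\<close>, \<open>y\<close> and \<open>h\<close> to \<open>\<alpha>x\<close>, \<open>\<alpha>y\<close> and \<open>\<Lambda> h\<close>.
\<close>

definition weight_value :: "'k::field \<Rightarrow> 'k \<Rightarrow> ('g \<Rightarrow> 'k) \<Rightarrow> (nat \<times> nat \<times> 'g \<Rightarrow>\<^sub>0 'k) \<Rightarrow> 'k"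
  where "weight_value \<alpha>x \<alpha>y \<Lambda> a =
    (\<Sum>(i, j, h)\<in>Poly_Mapping.keys a. Poly_Mapping.lookup a (i, j, h) * \<alpha>x ^ i * \<alpha>y ^ j * \<Lambda> h)"

text \<open>
  The vector \<open>u\<close> spans a line that \<open>R[N]\<close> preserves, and it generates the module. Both directions of the
  classification pass through such vectors: a torsion-free simple module contains one, and so does
  \<open>V\<^sub>x\<^sub>y\<close> in each of its lines \<open>K v\<^sub>i\<close>.
\<close>

locale weight_module = hopf_module G \<chi> t n q c V
  for G :: "('g, 'r) monoid_scheme" and \<chi> :: "'g \<Rightarrow> 'k::field" and t n q c
    and V :: "(nat \<times> nat \<times> 'g \<Rightarrow>\<^sub>0 'k, 'v, 's) module_scheme" (structure) +
  fixes u :: 'v and \<alpha>x \<alpha>y :: 'k and \<Lambda> :: "'g \<Rightarrow> 'k"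
  assumes u: "u \<in> carrier V" "u \<noteq> \<zero>"
    and x_u: "gen_x G \<odot>\<^bsub>V\<^esub> u = \<alpha>x \<cdot> u" and y_u: "gen_y G \<odot>\<^bsub>V\<^esub> u = \<alpha>y \<cdot> u"
    and N_u: "h \<in> kernel G field_units \<chi> \<Longrightarrow> grp h \<odot>\<^bsub>V\<^esub> u = \<Lambda> h \<cdot> u"
    and nonzero: "\<alpha>x \<noteq> 0" "\<alpha>y \<noteq> 0"
    and cyclic: "v \<in> carrier V \<Longrightarrow> \<exists>a\<in>carrier (hopf_algebra G \<chi> (\<lambda>g. \<chi> g powi t)). v = a \<odot>\<^bsub>V\<^esub> u"
begin

definition w :: "nat \<Rightarrow> 'v" where "w j = grp (c [^]\<^bsub>G\<^esub> j) \<odot>\<^bsub>V\<^esub> u"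

lemma c_pow [simp]: "c [^]\<^bsub>G\<^esub> (j::nat) \<in> carrier G"
  using c by simp

lemma N_carrier [simp]: "h \<in> N \<Longrightarrow> h \<in> carrier G"
  by (simp add: N_iff)

lemma w_carrier [simp]: "w j \<in> carrier V"
  using u by (simp add: w_def)

lemma grp_nonzero:
  assumes "g \<in> carrier G"
  shows "grp g \<odot>\<^bsub>V\<^esub> u \<noteq> \<zero>"
proof
  assume "grp g \<odot>\<^bsub>V\<^esub> u = \<zero>"
  then have "grp (inv\<^bsub>G\<^esub> g) \<odot>\<^bsub>V\<^esub> (grp g \<odot>\<^bsub>V\<^esub> u) = \<zero>"
    using smult_zero[of "grp (inv\<^bsub>G\<^esub> g)"] assms by simp
  then show False using assms u by (simp add: grp_grp grp_one)
qed

lemma x_w: "gen_x G \<odot>\<^bsub>V\<^esub> w j = (\<alpha>x * q powi (- int j)) \<cdot> w j"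
  using u c by (simp add: w_def x_grp x_u scale_commute[of "grp _"] scale_simps chi_pow chi_c power_int_minus power_inverse mult.commute)

lemma y_w: "gen_y G \<odot>\<^bsub>V\<^esub> w j = (\<alpha>y * q powi (- (int j * t))) \<cdot> w j"
proof -
  have "\<eta> (c [^]\<^bsub>G\<^esub> j) = (q powi (- int j)) powi t"
    using c by (simp add: chi_pow chi_c power_int_minus power_inverse)
  also have "\<dots> = q powi (- (int j * t))" by (simp add: power_int_mult[symmetric])
  finally show ?thesis
    using u by (simp add: w_def y_grp y_u scale_commute[of "grp _"] scale_simps mult.commute)
qed

lemma grp_w:
  assumes "h \<in> N"
  shows "grp (c [^]\<^bsub>G\<^esub> i \<otimes>\<^bsub>G\<^esub> h) \<odot>\<^bsub>V\<^esub> w j = \<Lambda> h \<cdot> w (i + j)"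
proof -
  have "c [^]\<^bsub>G\<^esub> i \<otimes>\<^bsub>G\<^esub> h \<otimes>\<^bsub>G\<^esub> c [^]\<^bsub>G\<^esub> j = c [^]\<^bsub>G\<^esub> (i + j) \<otimes>\<^bsub>G\<^esub> h"
    using assms c by (simp add: G.nat_pow_mult[symmetric] G.m_ac)
  then have "grp (c [^]\<^bsub>G\<^esub> i \<otimes>\<^bsub>G\<^esub> h) \<odot>\<^bsub>V\<^esub> w j = grp (c [^]\<^bsub>G\<^esub> (i + j)) \<odot>\<^bsub>V\<^esub> (grp h \<odot>\<^bsub>V\<^esub> u)"
    using assms u by (simp add: w_def grp_grp)
  then show ?thesis using assms u N_u by (simp add: w_def scale_commute[of "grp _"])
qed

lemma c_pow_n: "c [^]\<^bsub>G\<^esub> n \<in> N"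
  using c chi_pow_n by (simp add: N_iff chi_pow)

text \<open>
  The element \<open>c^n\<close> lies in \<open>N\<close> and acts on \<open>u\<close> by \<open>\<Lambda> (c^n)\<close>, once for every time the index passes \<open>n\<close>.
\<close>

lemma w_wrap: "w m = \<Lambda> (c [^]\<^bsub>G\<^esub> n) ^ (m div n) \<cdot> w (m mod n)"
proof -
  have one_step: "w (k + n) = \<Lambda> (c [^]\<^bsub>G\<^esub> n) \<cdot> w k" for k
    using u c c_pow_n N_u
    by (simp add: w_def G.nat_pow_mult[symmetric] scale_commute[of "grp _"] flip: grp_grp)
  have "w (k + d * n) = \<Lambda> (c [^]\<^bsub>G\<^esub> n) ^ d \<cdot> w k" for d k
  proof (induction d)
    case (Suc d)
    have "w (k + Suc d * n) = w ((k + d * n) + n)" by (simp add: algebra_simps)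
    then show ?case using Suc one_step by (simp add: scale_simps)
  qed (simp add: scale_simps)
  from this[of "m mod n" "m div n"] show ?thesis by simp
qed

lemma Lambda_nonzero: "h \<in> N \<Longrightarrow> \<Lambda> h \<noteq> 0"
  using grp_nonzero[of h] N_u[of h] u scale_simps(5)[of u] by auto

lemma Lambda_hom: "\<Lambda> \<in> hom (G\<lparr>carrier := N\<rparr>) field_units"
proof -
  have "\<Lambda> (g \<otimes>\<^bsub>G\<^esub> h) = \<Lambda> g * \<Lambda> h" if "g \<in> N" "h \<in> N" for g h
  proof (rule scale_cancel[OF u])
    have "\<Lambda> (g \<otimes>\<^bsub>G\<^esub> h) \<cdot> u = grp (g \<otimes>\<^bsub>G\<^esub> h) \<odot>\<^bsub>V\<^esub> u"
      using N_u subgroup.m_closed[OF subgroup_N that] by simp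
    also have "\<dots> = grp g \<odot>\<^bsub>V\<^esub> (grp h \<odot>\<^bsub>V\<^esub> u)" using that u by (simp add: grp_grp)
    finally show "\<Lambda> (g \<otimes>\<^bsub>G\<^esub> h) \<cdot> u = (\<Lambda> g * \<Lambda> h) \<cdot> u"
      using that u by (simp add: N_u scale_commute[of "grp _"] scale_simps mult.commute)
  qed
  then show ?thesis using Lambda_nonzero by (auto simp: hom_def)
qed

lemma single_u:
  assumes "h \<in> N"
  shows "Poly_Mapping.single (i, j, h) p \<odot>\<^bsub>V\<^esub> u = (p * \<alpha>x ^ i * \<alpha>y ^ j * \<Lambda> h) \<cdot> u"
  using assms u
  by (simp add: single_smult N_u funpow_eigenvector[OF _ _ x_u] funpow_eigenvector[OF _ _ y_u] scale_simps mult_ac)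

lemma weight_value_smult:
  assumes "a \<in> carrier RN"
  shows "a \<odot>\<^bsub>V\<^esub> u = weight_value \<alpha>x \<alpha>y \<Lambda> a \<cdot> u"
proof -
  have sum: "(\<Sum>z\<in>A. Poly_Mapping.single z (f z)) \<in> carrier H \<and>
      (\<Sum>z\<in>A. Poly_Mapping.single z (f z)) \<odot>\<^bsub>V\<^esub> u = (\<Sum>(i, j, h)\<in>A. f (i, j, h) * \<alpha>x ^ i * \<alpha>y ^ j * \<Lambda> h) \<cdot> u"
    if "finite A" "A \<subseteq> UNIV \<times> UNIV \<times> N" for A f
    using that
  proof (induction A rule: finite_induct)
    case empty
    then show ?case using zero_smult[OF u(1)] H.zero_closed by (simp add: H_sel(4) scale_simps u)
  next
    case (insert z A)
    obtain i j h where z: "z = (i, j, h)" by (cases z)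
    then have h: "h \<in> N" using insert.prems by auto
    show ?case
      using insert h z single_u[OF h, of i j "f z"] smult_l_distr[of "Poly_Mapping.single z (f z)" _ u]
        H.add.m_closed[of "Poly_Mapping.single z (f z)"] u
      by (simp add: H_sel(3) scale_simps)
  qed
  have "(\<Sum>z\<in>Poly_Mapping.keys a. Poly_Mapping.single z (Poly_Mapping.lookup a z)) = a"
    by (rule poly_mapping_eqI) (auto simp: lookup_sum lookup_single when_def in_keys_iff)
  moreover have "Poly_Mapping.keys a \<subseteq> UNIV \<times> UNIV \<times> N" using assms by (simp add: poly_group_ring_def)
  ultimately show ?thesis
    using sum[OF finite_keys[of a], of "Poly_Mapping.lookup a"] by (simp only: weight_value_def)
qed

definition comb :: "(nat \<Rightarrow> 'k) \<Rightarrow> 'v" where "comb a = finsum V (\<lambda>j. a j \<cdot> w j) {..<n}"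

lemma comb_add: "comb a \<oplus> comb b = comb (\<lambda>j. a j + b j)"
  by (simp add: comb_def scale_simps M.finsum_addf Pi_def)

lemma comb_single:
  assumes "k < n"
  shows "comb (\<lambda>j. if j = k then s else 0) = s \<cdot> w k"
proof -
  have "comb (\<lambda>j. if j = k then s else 0) = finsum V (\<lambda>j. if k = j then s \<cdot> w j else \<zero>) {..<n}"
    unfolding comb_def by (rule M.finsum_cong') (auto simp: scale_simps)
  also have "\<dots> = s \<cdot> w k" using assms by (intro M.add.finprod_singleton) auto
  finally show ?thesis .
qed

lemma single_comb:
  assumes "g \<in> carrier G"
  shows "\<exists>k<n. \<exists>s. Poly_Mapping.single (i, j, g) p \<odot>\<^bsub>V\<^esub> u = s \<cdot> w k"
proof -
  obtain k h where kh: "k < n" "h \<in> N" "g = c [^]\<^bsub>G\<^esub> k \<otimes>\<^bsub>G\<^esub> h" using coset_decomposition[OF assms] by blast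
  have "grp g \<odot>\<^bsub>V\<^esub> u = \<Lambda> h \<cdot> w k"
    using grp_w[OF kh(2), of k 0] kh(3) u by (simp add: w_def grp_one)
  then show ?thesis
    using assms u kh(1)
    by (auto simp: single_smult funpow_eigenvector[OF _ _ x_w] funpow_eigenvector[OF _ _ y_w] scale_simps)
qed

text \<open>
  A monomial \<open>x^i y^j g\<close> with \<open>g = c^k h\<close> turns \<open>u\<close> into a multiple of \<open>c^k u\<close>.
\<close>

lemma comb_surj:
  assumes "v \<in> carrier V"
  shows "\<exists>a. v = comb a"
proof -
  obtain b where b: "b \<in> carrier H" "v = b \<odot>\<^bsub>V\<^esub> u" using cyclic assms by blast
  have "\<exists>a. b \<odot>\<^bsub>V\<^esub> u = comb a"
    using b(1)
  proof (induction rule: hopf_induct_H)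
    case zero
    have "comb (\<lambda>j. 0) = \<zero>" unfolding comb_def by (intro M.add.finprod_one_eqI) (auto simp: scale_simps)
    then show ?case using zero_smult[OF u(1)] by (auto simp: H_sel(4) intro!: exI[of _ "\<lambda>j. 0"])
  next
    case (single i j g p)
    then show ?case using single_comb[of g i j p] comb_single by metis
  next
    case (add a b)
    then show ?case using smult_l_distr[of a b u] u comb_add by (auto simp: H_sel(3))
  qed
  then show ?thesis using b by simp
qed

lemma eigenvalue_inj: "inj_on (\<lambda>j. \<alpha>x * q powi (- int j)) {..<n}"
  using nonzero q_pow_inj q_nonzero by (auto simp: inj_on_def power_int_minus)

text \<open>
  The vectors \<open>c^j u\<close> are eigenvectors of \<open>x\<close> for the eigenvalues \<open>\<alpha>x q^(-j)\<close>, which differ for \<open>j < n\<close>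
  because \<open>q\<close> is a primitive root of unity and \<open>\<alpha>x\<close> is not zero.
\<close>

lemma comb_inj:
  assumes "comb a = \<zero>" "j < n"
  shows "a j = 0"
proof -
  have "a j \<cdot> w j = \<zero>"
  proof (rule eigenvectors_independent[of "gen_x G", OF _ _ _ eigenvalue_inj])
    show "gen_x G \<odot>\<^bsub>V\<^esub> (a j \<cdot> w j) = (\<alpha>x * q powi (- int j)) \<cdot> (a j \<cdot> w j)" for j
      by (simp add: scale_commute[of "gen_x G"] x_w scale_simps mult.commute)
  qed (use assms in \<open>auto simp: comb_def\<close>)
  then show ?thesis using grp_nonzero[of "c [^]\<^bsub>G\<^esub> j"] by (simp add: scale_eq_zero_iff) (simp add: w_def)
qed

lemma w_inj: "inj_on w {..<n}"
proof (rule inj_onI)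
  fix i j assume ij: "i \<in> {..<n}" "j \<in> {..<n}" "w i = w j"
  have "w j \<noteq> \<zero>" using grp_nonzero[of "c [^]\<^bsub>G\<^esub> j"] by (simp add: w_def)
  then have "\<alpha>x * q powi (- int i) = \<alpha>x * q powi (- int j)"
    using x_w[of i, unfolded ij(3)] x_w[of j] by (intro scale_cancel[OF w_carrier[of j]]) simp_all
  then show "i = j" using eigenvalue_inj ij by (auto dest: inj_onD)
qed

lemma weight_basis:
  "vectorspace.basis class_ring (K_space G V) (w ` {..<n})" "has_dim G V n"
proof -
  interpret K: vectorspace class_ring "K_space G V" by (rule vectorspace_K_space)
  have "K.basis (w ` {..<n})" "K.fin_dim" "K.dim = n"
    using w_inj comb_surj comb_inj
    by (intro K.basis_of_family[of n w]; force simp: finsum_K_space comb_def)+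
  then show "K.basis (w ` {..<n})" "has_dim G V n" by (auto simp: has_dim_def)
qed

end

lemma weight_module_is_Vxy:
  fixes V :: "(nat \<times> nat \<times> 'g \<Rightarrow>\<^sub>0 'k::field, 'v) module"
  assumes "weight_module G \<chi> t n q c V u \<alpha>x \<alpha>y \<Lambda>"
  shows "is_Vxy G \<chi> t n q c \<alpha>x \<alpha>y \<Lambda> V"
proof -
  interpret weight_module G \<chi> t n q c V u \<alpha>x \<alpha>y \<Lambda> by fact
  have "grp (c [^]\<^bsub>G\<^esub> j \<otimes>\<^bsub>G\<^esub> h) \<odot>\<^bsub>V\<^esub> w i =
      scalar G (\<Lambda> h * \<Lambda> (c [^]\<^bsub>G\<^esub> n) ^ ((i + j) div n)) \<odot>\<^bsub>V\<^esub> w ((i + j) mod n)" if "h \<in> N" for i j h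
    using grp_w[OF that, of j i] w_wrap[of "i + j"] by (simp add: scale_simps add.commute)
  then show ?thesis
    unfolding is_Vxy_def
    using left_module_axioms nonzero Lambda_hom w_inj weight_basis(1) x_w y_w by fastforce
qed

section \<open>Isomorphisms of modules\<close>

lemma isomorphic_modules_trans:
  assumes "isomorphic_modules R U V" "isomorphic_modules R V W"
  shows "isomorphic_modules R U W"
proof -
  obtain f g where f: "f \<in> module_iso R U V" and g: "g \<in> module_iso R V W"
    using assms unfolding isomorphic_modules_def by blast
  have "f v \<in> carrier V" if "v \<in> carrier U" for v
    using f that by (auto simp: module_iso_def iso_def hom_def)
  then have "g \<circ> f \<in> module_iso R U W"
    using f g iso_set_trans[of f "add_monoid U" "add_monoid V" g "add_monoid W"] by (auto simp: module_iso_def)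
  then show ?thesis by (auto simp: isomorphic_modules_def)
qed

lemma isomorphic_modules_sym:
  assumes "isomorphic_modules R U V"
    and add: "\<And>v w. v \<in> carrier U \<Longrightarrow> w \<in> carrier U \<Longrightarrow> v \<oplus>\<^bsub>U\<^esub> w \<in> carrier U"
    and smult: "\<And>a v. a \<in> carrier R \<Longrightarrow> v \<in> carrier U \<Longrightarrow> a \<odot>\<^bsub>U\<^esub> v \<in> carrier U"
  shows "isomorphic_modules R V U"
proof -
  obtain f where f: "f \<in> module_iso R U V"
    using assms unfolding isomorphic_modules_def by blast
  then have bij: "bij_betw f (carrier U) (carrier V)"
    and fadd: "\<And>v w. v \<in> carrier U \<Longrightarrow> w \<in> carrier U \<Longrightarrow> f (v \<oplus>\<^bsub>U\<^esub> w) = f v \<oplus>\<^bsub>V\<^esub> f w"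
    and fsm: "\<And>a v. a \<in> carrier R \<Longrightarrow> v \<in> carrier U \<Longrightarrow> f (a \<odot>\<^bsub>U\<^esub> v) = a \<odot>\<^bsub>V\<^esub> f v"
    by (auto simp: module_iso_def iso_def hom_def)
  define g where "g = inv_into (carrier U) f"
  have gf: "g (f v) = v" if "v \<in> carrier U" for v
    unfolding g_def using bij_betw_inv_into_left[OF bij that] .
  have fg: "f (g v) = v" if "v \<in> carrier V" for v
    unfolding g_def using bij_betw_inv_into_right[OF bij that] .
  have gbij: "bij_betw g (carrier V) (carrier U)" unfolding g_def by (rule bij_betw_inv_into[OF bij])
  then have gc: "g v \<in> carrier U" if "v \<in> carrier V" for v using that by (auto simp: bij_betw_def)
  have "g (v \<oplus>\<^bsub>V\<^esub> w) = g v \<oplus>\<^bsub>U\<^esub> g w" if "v \<in> carrier V" "w \<in> carrier V" for v w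
  proof -
    have "f (g v \<oplus>\<^bsub>U\<^esub> g w) = v \<oplus>\<^bsub>V\<^esub> w" using that by (simp add: fadd gc fg)
    then show ?thesis using gf[of "g v \<oplus>\<^bsub>U\<^esub> g w"] add gc that by metis
  qed
  moreover have "g (a \<odot>\<^bsub>V\<^esub> v) = a \<odot>\<^bsub>U\<^esub> g v" if "a \<in> carrier R" "v \<in> carrier V" for a v
  proof -
    have "f (a \<odot>\<^bsub>U\<^esub> g v) = a \<odot>\<^bsub>V\<^esub> v" using that by (simp add: fsm gc fg)
    then show ?thesis using gf[of "a \<odot>\<^bsub>U\<^esub> g v"] smult gc that by metis
  qed
  ultimately have "g \<in> module_iso R V U" using gbij gc by (auto simp: module_iso_def iso_def hom_def)
  then show ?thesis by (auto simp: isomorphic_modules_def)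
qed

section \<open>Induced modules\<close>

definition weight_line :: "'k::field \<Rightarrow> 'k \<Rightarrow> ('g \<Rightarrow> 'k) \<Rightarrow> (nat \<times> nat \<times> 'g \<Rightarrow>\<^sub>0 'k, 'k) module"
  where "weight_line \<alpha>x \<alpha>y \<Lambda> = \<lparr>carrier = UNIV, monoid.mult = (*), one = 1, ring.zero = 0, add = (+),
    smult = (\<lambda>a m. weight_value \<alpha>x \<alpha>y \<Lambda> a * m)\<rparr>"

lemma weight_line_sel [simp]:
  "carrier (weight_line \<alpha>x \<alpha>y \<Lambda>) = UNIV" "add (weight_line \<alpha>x \<alpha>y \<Lambda>) = (+)"
  "ring.zero (weight_line \<alpha>x \<alpha>y \<Lambda>) = 0"
  "smult (weight_line \<alpha>x \<alpha>y \<Lambda>) a m = weight_value \<alpha>x \<alpha>y \<Lambda> a * m"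
  by (simp_all add: weight_line_def)

context hopf_setting
begin

lemma subring_RN: "subring (carrier RN) H"
proof -
  have "range (scalar G) \<union> {gen_x G, gen_y G} \<union> grp ` N \<subseteq> carrier H"
    using subgroup.subset[OF subgroup_N] by auto
  then show ?thesis
    unfolding poly_group_ring_generated[OF G chi eta subgroup_N] by (rule H.generate_ring_is_subring)
qed

lemma RN_eq: "RN = H\<lparr>carrier := carrier RN\<rparr>"
  by (simp add: poly_group_ring_def)

lemma RN_sel: "monoid.mult RN = monoid.mult H" "add RN = add H" "one RN = one H" "ring.zero RN = ring.zero H"
  by (simp_all add: poly_group_ring_def)

lemma single_RN: "h \<in> N \<Longrightarrow> Poly_Mapping.single (i, j, h) p \<in> carrier RN"
  by (simp add: poly_group_ring_def)

end

context weight_module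
begin

abbreviation "M \<equiv> weight_line \<alpha>x \<alpha>y \<Lambda>"

lemma RN_H: "a \<in> carrier RN \<Longrightarrow> a \<in> carrier H"
  using subringE(1)[OF subring_RN] by blast

text \<open>
  Both sides are compared by their action on \<open>u\<close>.
\<close>

lemma weight_value_hom:
  assumes "a \<in> carrier RN" "b \<in> carrier RN"
  shows "weight_value \<alpha>x \<alpha>y \<Lambda> (a \<oplus>\<^bsub>H\<^esub> b) = weight_value \<alpha>x \<alpha>y \<Lambda> a + weight_value \<alpha>x \<alpha>y \<Lambda> b"
    "weight_value \<alpha>x \<alpha>y \<Lambda> (a \<otimes>\<^bsub>H\<^esub> b) = weight_value \<alpha>x \<alpha>y \<Lambda> a * weight_value \<alpha>x \<alpha>y \<Lambda> b"
proof -
  note sub = subringE[OF subring_RN]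
  show "weight_value \<alpha>x \<alpha>y \<Lambda> (a \<oplus>\<^bsub>H\<^esub> b) = weight_value \<alpha>x \<alpha>y \<Lambda> a + weight_value \<alpha>x \<alpha>y \<Lambda> b"
    using weight_value_smult[OF sub(7)[OF assms]] smult_l_distr[OF RN_H[OF assms(1)] RN_H[OF assms(2)] u(1)]
      weight_value_smult[OF assms(1)] weight_value_smult[OF assms(2)] u
    by (intro scale_cancel[OF u]) (simp add: scale_simps)
  show "weight_value \<alpha>x \<alpha>y \<Lambda> (a \<otimes>\<^bsub>H\<^esub> b) = weight_value \<alpha>x \<alpha>y \<Lambda> a * weight_value \<alpha>x \<alpha>y \<Lambda> b"
    using weight_value_smult[OF sub(6)[OF assms]] smult_assoc1[OF RN_H[OF assms(1)] RN_H[OF assms(2)] u(1)]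
      weight_value_smult[OF assms(1)] weight_value_smult[OF assms(2)] u scale_commute[OF RN_H[OF assms(1)] u(1)]
    by (intro scale_cancel[OF u]) (simp add: scale_simps mult.commute)
qed

lemma weight_value_scalar: "weight_value \<alpha>x \<alpha>y \<Lambda> (scalar G s) = s"
proof -
  have "scalar G s \<in> carrier RN"
    unfolding scalar_def using subgroup.one_closed[OF subgroup_N] by (rule single_RN)
  from weight_value_smult[OF this] show ?thesis using scale_cancel[OF u] by simp
qed

lemma abelian_group_M: "abelian_group M"
proof (rule abelian_groupI)
  fix x :: 'k
  show "\<exists>y\<in>carrier M. y \<oplus>\<^bsub>M\<^esub> x = \<zero>\<^bsub>M\<^esub>" by (intro bexI[of _ "- x"]) auto
qed auto

lemma left_module_M: "left_module RN M"
proof (intro left_module.intro left_module_axioms.intro abelian_group_M)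
  show "ring RN" using H.subring_is_ring[OF subring_RN] RN_eq by simp
  have "weight_value \<alpha>x \<alpha>y \<Lambda> \<one>\<^bsub>H\<^esub> = 1"
    using weight_value_scalar[of 1] by (simp add: scalar_def H_sel(5))
  then show "\<one>\<^bsub>RN\<^esub> \<odot>\<^bsub>M\<^esub> v = v" for v by (simp add: RN_sel)
qed (auto simp: RN_sel weight_value_hom algebra_simps)

lemma has_dim_M: "has_dim G M 1"
proof -
  have sel: "carrier (K_space G M) = UNIV" "add (K_space G M) = (+)" "ring.zero (K_space G M) = 0"
    "smult (K_space G M) s m = s * m" for s m
    by (simp_all add: K_space_def weight_value_scalar)
  have ab: "abelian_group (K_space G M)"
  proof (rule abelian_groupI)
    fix x :: 'k
    show "\<exists>y\<in>carrier (K_space G M). y \<oplus>\<^bsub>K_space G M\<^esub> x = \<zero>\<^bsub>K_space G M\<^esub>"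
      by (intro bexI[of _ "- x"]) (auto simp: sel)
  qed (auto simp: sel)
  interpret K: vectorspace class_ring "K_space G M"
    by (intro vectorspace.intro module.intro module_axioms.intro ab
        class_field.field_axioms fieldE(1)[OF class_field.field_axioms])
      (auto simp: sel algebra_simps)
  have fs: "finsum (K_space G M) a {..<Suc 0} = a 0" for a
    by (simp add: lessThan_Suc K.M.finsum_insert sel)
  have ex: "\<exists>a :: nat \<Rightarrow> 'k. v = a 0" for v
    by (rule exI[of _ "\<lambda>_. v"]) simp
  have "K.fin_dim" "K.dim = 1"
    by (rule K.basis_of_family[of 1 "\<lambda>_. 1"]; auto simp: fs sel intro: ex inj_onI)+
  then show ?thesis by (simp add: has_dim_def)
qed

text \<open>
  The induced module is the quotient of \<open>F\<close> by \<open>T\<close>, and \<open>pure j m\<close> represents the tensor \<open>c^j \<otimes> m\<close>.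
\<close>

definition F where "F = free_Abelian_group (carrier H \<times> carrier M)"
definition T where "T = generate F (tensor_relations H RN M)"
definition pure where "pure j m = frag_of (grp (c [^]\<^bsub>G\<^esub> j) :: nat \<times> nat \<times> 'g \<Rightarrow>\<^sub>0 'k, m :: 'k)" for j :: nat

lemma F_group: "group F" "comm_group F"
  by (simp_all add: F_def abelian_free_Abelian_group)

lemma F_sel: "z \<in> carrier F \<longleftrightarrow> Poly_Mapping.keys z \<subseteq> carrier H \<times> UNIV" "z \<otimes>\<^bsub>F\<^esub> z' = z + z'" "\<one>\<^bsub>F\<^esub> = 0"
  by (simp_all add: F_def)

lemma F_inv: "z \<in> carrier F \<Longrightarrow> inv\<^bsub>F\<^esub> z = - z"
  by (simp add: F_def)

lemma F_closed: "z \<in> carrier F \<Longrightarrow> z' \<in> carrier F \<Longrightarrow> z + z' \<in> carrier F"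
  "z \<in> carrier F \<Longrightarrow> z' \<in> carrier F \<Longrightarrow> z - z' \<in> carrier F" "0 \<in> carrier F"
  "a \<in> carrier H \<Longrightarrow> frag_of (a, m) \<in> carrier F"
proof -
  show "z \<in> carrier F \<Longrightarrow> z' \<in> carrier F \<Longrightarrow> z + z' \<in> carrier F"
    using Poly_Mapping.keys_add[of z z'] unfolding F_sel by blast
  show "z \<in> carrier F \<Longrightarrow> z' \<in> carrier F \<Longrightarrow> z - z' \<in> carrier F"
    using keys_diff[of z z'] unfolding F_sel by blast
qed (auto simp: F_sel)

lemma relations_in_F: "tensor_relations H RN M \<subseteq> carrier F"
  unfolding tensor_relations_def
  by (auto simp: RN_H H.ring_simprules intro!: F_closed)

lemma T_subgroup: "subgroup T F"
  unfolding T_def by (rule group.generate_is_subgroup[OF F_group(1) relations_in_F])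

lemma T_F: "z \<in> T \<Longrightarrow> z \<in> carrier F"
  using subgroup.subset[OF T_subgroup] by blast

lemma T_closed: "0 \<in> T" "z \<in> T \<Longrightarrow> z' \<in> T \<Longrightarrow> z + z' \<in> T" "z \<in> T \<Longrightarrow> - z \<in> T" "z \<in> T \<Longrightarrow> z' \<in> T \<Longrightarrow> z - z' \<in> T"
proof -
  show "0 \<in> T" using subgroup.one_closed[OF T_subgroup] by (simp add: F_sel)
  show a: "z \<in> T \<Longrightarrow> z' \<in> T \<Longrightarrow> z + z' \<in> T" for z z' using subgroup.m_closed[OF T_subgroup, of z z'] by (simp add: F_sel)
  show b: "z \<in> T \<Longrightarrow> - z \<in> T" for z using subgroup.m_inv_closed[OF T_subgroup, of z] F_inv[OF T_F] by simp
  show "z \<in> T \<Longrightarrow> z' \<in> T \<Longrightarrow> z - z' \<in> T" using a[of z "- z'"] b[of z'] by simp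
qed

lemma T_sum: "(\<And>j. j \<in> A \<Longrightarrow> f j \<in> T) \<Longrightarrow> sum f A \<in> T"
  by (induction A rule: infinite_finite_induct) (auto intro: T_closed)

lemma T_add_left:
  "\<lbrakk>a \<in> carrier H; b \<in> carrier H\<rbrakk> \<Longrightarrow> frag_of (a \<oplus>\<^bsub>H\<^esub> b, m) - frag_of (a, m) - frag_of (b, m) \<in> T"
  unfolding T_def by (rule generate.incl) (auto simp: tensor_relations_def)

lemma T_add_right:
  "a \<in> carrier H \<Longrightarrow> frag_of (a, m + m') - frag_of (a, m) - frag_of (a, m') \<in> T"
  unfolding T_def by (rule generate.incl) (force simp: tensor_relations_def)

lemma T_balanced:
  "\<lbrakk>a \<in> carrier H; s \<in> carrier RN\<rbrakk> \<Longrightarrow>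
    frag_of (a \<otimes>\<^bsub>H\<^esub> s, m) - frag_of (a, weight_value \<alpha>x \<alpha>y \<Lambda> s * m) \<in> T"
  unfolding T_def by (rule generate.incl) (force simp: tensor_relations_def)

lemma pure_F: "pure j m \<in> carrier F"
  unfolding pure_def by (intro F_closed generator_carrier) simp

lemma pure_add: "pure j (m + m') - pure j m - pure j m' \<in> T"
  unfolding pure_def by (intro T_add_right generator_carrier) simp

lemma pure_zero: "pure j 0 \<in> T"
  using T_closed(3)[OF pure_add[of j 0 0]] by simp

lemma sum_pure_F: "(\<Sum>j<k. pure j (m j)) \<in> carrier F"
  by (induction k) (auto intro: F_closed pure_F)

text \<open>
  As a right module over \<open>R[N]\<close>, the algebra has the basis \<open>1, c, \<dots>, c^(n-1)\<close>. Hence every tensor is a sum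
  of tensors \<open>c^j \<otimes> m_j\<close>.
\<close>

definition normalizable where "normalizable z \<longleftrightarrow> (\<exists>m. z - (\<Sum>j<n. pure j (m j)) \<in> T)"

lemma normalizable_diff:
  assumes "normalizable z" "normalizable z'"
  shows "normalizable (z - z')"
proof -
  obtain m m' where m: "z - (\<Sum>j<n. pure j (m j)) \<in> T" "z' - (\<Sum>j<n. pure j (m' j)) \<in> T"
    using assms by (auto simp: normalizable_def)
  have "pure j (m j) - pure j (m j - m' j) - pure j (m' j) \<in> T" for j
    using pure_add[of j "m j - m' j" "m' j"] by simp
  then have "(\<Sum>j<n. pure j (m j) - pure j (m j - m' j) - pure j (m' j)) \<in> T" by (rule T_sum)
  then have "(z - (\<Sum>j<n. pure j (m j))) - (z' - (\<Sum>j<n. pure j (m' j))) +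
      (\<Sum>j<n. pure j (m j) - pure j (m j - m' j) - pure j (m' j)) \<in> T"
    by (rule T_closed(2)[OF T_closed(4)[OF m]])
  also have "(z - (\<Sum>j<n. pure j (m j))) - (z' - (\<Sum>j<n. pure j (m' j))) +
      (\<Sum>j<n. pure j (m j) - pure j (m j - m' j) - pure j (m' j)) = (z - z') - (\<Sum>j<n. pure j (m j - m' j))"
    by (simp add: sum_subtractf)
  finally show ?thesis by (auto simp: normalizable_def)
qed

lemma normalizable_T: "z \<in> T \<Longrightarrow> normalizable z"
  unfolding normalizable_def by (intro exI[of _ "\<lambda>j. 0"] T_closed T_sum pure_zero)

lemma normalizable_add: "normalizable z \<Longrightarrow> normalizable z' \<Longrightarrow> normalizable (z + z')"
  using normalizable_diff[of z "0 - z'"] normalizable_diff[of 0 z'] normalizable_T[OF T_closed(1)] by simp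

lemma normalizable_cong: "z - z' \<in> T \<Longrightarrow> normalizable z' \<Longrightarrow> normalizable z"
  using normalizable_add[OF normalizable_T[of "z - z'"], of z'] by simp

lemma normalizable_pure:
  assumes "k < n"
  shows "normalizable (pure k m)"
  unfolding normalizable_def
proof (rule exI[of _ "\<lambda>j. if j = k then m else 0"])
  have "(\<Sum>j<n. pure j (if j = k then m else 0)) = pure k m + (\<Sum>j\<in>{..<n} - {k}. pure j (if j = k then m else 0))"
    using assms by (subst sum.remove[of _ k]) auto
  also have "(\<Sum>j\<in>{..<n} - {k}. pure j (if j = k then m else 0)) = (\<Sum>j\<in>{..<n} - {k}. pure j 0)"
    by (rule sum.cong) auto
  finally have "pure k m - (\<Sum>j<n. pure j (if j = k then m else 0)) = - (\<Sum>j\<in>{..<n} - {k}. pure j 0)"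
    by simp
  also have "\<dots> \<in> T" by (intro T_closed T_sum pure_zero)
  finally show "pure k m - (\<Sum>j<n. pure j (if j = k then m else 0)) \<in> T" .
qed

text \<open>
  Let \<open>g = c^k h\<close>. Moving \<open>c^k\<close> to the front of \<open>x^i y^j g\<close> costs the factor \<open>\<chi>(c^k)^i \<eta>(c^k)^j\<close>, and the
  remaining element of \<open>R[N]\<close> passes through the tensor sign.
\<close>

lemma normalizable_frag_of:
  assumes "a \<in> carrier H"
  shows "normalizable (frag_of (a, m))"
  using assms
proof (induction rule: hopf_induct_H)
  case zero
  have "- (frag_of (0, m)) \<in> T"
    using T_add_left[of 0 0 m] H.zero_closed by (simp add: H_sel(3,4))
  then have "frag_of (0, m) \<in> T" using T_closed(3) by fastforce
  then show ?case by (rule normalizable_T)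
next
  case (single i j g p)
  then obtain k h where kh: "k < n" "h \<in> N" "g = c [^]\<^bsub>G\<^esub> k \<otimes>\<^bsub>G\<^esub> h" using coset_decomposition by blast
  let ?g = "c [^]\<^bsub>G\<^esub> k"
  let ?s = "Poly_Mapping.single (i, j, h) (p * \<chi> ?g ^ i * \<eta> ?g ^ j)"
  have "grp ?g \<otimes>\<^bsub>H\<^esub> ?s = Poly_Mapping.single (i, j, g) p"
    using chi_nonzero[of ?g] kh(3) by (simp add: grp_def H_sel(2) mult_single power_inverse field_simps)
  then have "frag_of (Poly_Mapping.single (i, j, g) p, m) - pure k (weight_value \<alpha>x \<alpha>y \<Lambda> ?s * m) \<in> T"
    using T_balanced[of "grp ?g" ?s m] single_RN[OF kh(2)] by (simp add: pure_def)
  then show ?case using normalizable_pure[OF kh(1)] normalizable_cong by blast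
next
  case (add a b)
  have "frag_of (a + b, m) - (frag_of (a, m) + frag_of (b, m)) \<in> T"
    using T_add_left[OF add.hyps, of m] by (simp add: H_sel(3) diff_diff_eq)
  then show ?case using normalizable_add[OF add.IH] normalizable_cong by blast
qed

lemma normalizable_all:
  assumes "z \<in> carrier F"
  shows "normalizable z"
  using assms[unfolded F_sel]
proof (induction z rule: free_Abelian_group_induct[consumes 1, case_names zero diff one])
  case (one a)
  then show ?case using normalizable_frag_of by (cases a) auto
qed (auto intro: normalizable_T T_closed normalizable_diff)

text \<open>The homomorphism \<open>a \<otimes> m \<mapsto> a m u\<close>, which exists by the universal property of free abelian groups.\<close>

definition ev where "ev = (SOME h. h \<in> hom F (add_monoid V) \<and> (\<forall>a\<in>carrier H. \<forall>m. h (frag_of (a, m)) = a \<odot>\<^bsub>V\<^esub> (m \<cdot> u)))"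

lemma ev_hom: "ev \<in> hom F (add_monoid V)"
  and ev_frag_of: "a \<in> carrier H \<Longrightarrow> ev (frag_of (a, m)) = a \<odot>\<^bsub>V\<^esub> (m \<cdot> u)"
proof -
  have "(\<lambda>(a, m). a \<odot>\<^bsub>V\<^esub> (m \<cdot> u)) ` (carrier H \<times> carrier M) \<subseteq> carrier (add_monoid V)"
    using u by (auto intro: smult_closed)
  then obtain h where h: "h \<in> hom F (add_monoid V)"
    "\<And>x. x \<in> carrier H \<times> carrier M \<Longrightarrow> h (frag_of x) = (\<lambda>(a, m). a \<odot>\<^bsub>V\<^esub> (m \<cdot> u)) x"
    unfolding F_def by (rule comm_group.free_Abelian_group_universal[OF M.a_comm_group]) blast
  then have "h \<in> hom F (add_monoid V) \<and> (\<forall>a\<in>carrier H. \<forall>m. h (frag_of (a, m)) = a \<odot>\<^bsub>V\<^esub> (m \<cdot> u))" by auto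
  from someI[of "\<lambda>h. h \<in> hom F (add_monoid V) \<and> (\<forall>a\<in>carrier H. \<forall>m. h (frag_of (a, m)) = a \<odot>\<^bsub>V\<^esub> (m \<cdot> u))", OF this]
  show "ev \<in> hom F (add_monoid V)" "a \<in> carrier H \<Longrightarrow> ev (frag_of (a, m)) = a \<odot>\<^bsub>V\<^esub> (m \<cdot> u)"
    unfolding ev_def by blast+
qed

lemma group_hom_ev: "group_hom F (add_monoid V) ev"
  using F_group(1) M.a_group ev_hom by (simp add: group_hom_def group_hom_axioms_def)

lemma ev_closed: "z \<in> carrier F \<Longrightarrow> ev z \<in> carrier V"
  using ev_hom by (auto simp: hom_def)

lemma ev_add: "z \<in> carrier F \<Longrightarrow> z' \<in> carrier F \<Longrightarrow> ev (z + z') = ev z \<oplus> ev z'"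
  using ev_hom by (auto simp: hom_def F_sel(2))

lemma ev_zero: "ev 0 = \<zero>"
  using group_hom.hom_one[OF group_hom_ev] by (simp add: F_sel)

lemma ev_diff: "z \<in> carrier F \<Longrightarrow> z' \<in> carrier F \<Longrightarrow> ev (z - z') = ev z \<ominus> ev z'"
proof -
  assume z: "z \<in> carrier F" "z' \<in> carrier F"
  have "ev (z - z') \<oplus> ev z' = ev z" using ev_add[of "z - z'" z'] z F_closed by simp
  then show ?thesis
    using ev_closed[OF z(1)] ev_closed[OF z(2)] ev_closed[OF F_closed(2)[OF z]]
    by (metis M.add.inv_closed M.a_assoc M.minus_eq M.r_neg M.r_zero)
qed

lemma ev_T:
  assumes "z \<in> T"
  shows "ev z = \<zero>"
proof -
  interpret ev: group_hom F "add_monoid V" ev by (rule group_hom_ev)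
  have "tensor_relations H RN M \<subseteq> kernel F (add_monoid V) ev"
  proof
    fix r assume r: "r \<in> tensor_relations H RN M"
    have cancel: "p \<oplus> p' \<ominus> p \<ominus> p' = \<zero>" if "p \<in> carrier V" "p' \<in> carrier V" for p p'
      using that by (simp add: M.minus_eq M.a_assoc M.a_lcomm[of p' "\<ominus> p"] M.r_neg)
    have "ev r = \<zero>"
      using r unfolding tensor_relations_def
    proof (elim UnE CollectE exE conjE)
      fix a b m assume "r = frag_of (a \<oplus>\<^bsub>H\<^esub> b, m) - frag_of (a, m) - frag_of (b, m)"
        "a \<in> carrier H" "b \<in> carrier H"
      then show ?thesis
        using cancel u by (simp add: ev_diff ev_frag_of F_closed smult_l_distr smult_closed)
    next
      fix a m m' assume "r = frag_of (a, m \<oplus>\<^bsub>M\<^esub> m') - frag_of (a, m) - frag_of (a, m')" "a \<in> carrier H"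
      then show ?thesis
        using cancel u by (simp add: ev_diff ev_frag_of F_closed smult_r_distr smult_closed scale_simps)
    next
      fix a s m assume *: "r = frag_of (a \<otimes>\<^bsub>H\<^esub> s, m) - frag_of (a, s \<odot>\<^bsub>M\<^esub> m)" "a \<in> carrier H" "s \<in> carrier RN"
      have "(a \<otimes>\<^bsub>H\<^esub> s) \<odot>\<^bsub>V\<^esub> (m \<cdot> u) = a \<odot>\<^bsub>V\<^esub> ((weight_value \<alpha>x \<alpha>y \<Lambda> s * m) \<cdot> u)"
        using * u RN_H[of s] scale_commute[of s u m] weight_value_smult[of s]
        by (simp add: smult_assoc1 scale_simps mult.commute)
      then show ?thesis
        using * u RN_H[of s] by (simp add: ev_diff ev_frag_of F_closed smult_closed M.minus_eq M.r_neg)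
    qed
    then show "r \<in> kernel F (add_monoid V) ev"
      using subsetD[OF relations_in_F r] by (simp add: kernel_def del: carrier_free_Abelian_group_iff)
  qed
  then have "T \<subseteq> kernel F (add_monoid V) ev"
    unfolding T_def by (rule ev.G.generate_subgroup_incl[OF _ ev.subgroup_kernel])
  then show ?thesis using assms by (auto simp: kernel_def)
qed

lemma ev_pure: "ev (pure j m) = m \<cdot> w j"
  using u by (simp add: pure_def ev_frag_of scale_commute[of "grp _"] w_def)

lemma ev_sum_pure: "ev (\<Sum>j<n. pure j (m j)) = comb m"
proof -
  have "ev (\<Sum>j<k. pure j (m j)) = finsum V (\<lambda>j. m j \<cdot> w j) {..<k}" for k
  proof (induction k)
    case (Suc k)
    then show ?case
      using ev_add[OF sum_pure_F[of m k] pure_F[of k "m k"]]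
      by (simp add: lessThan_Suc M.finsum_insert Pi_def ev_pure add.commute M.a_comm M.finsum_closed)
  qed (simp add: ev_zero)
  then show ?thesis by (simp add: comb_def)
qed

text \<open>
  A normalized tensor \<open>\<Sum> c^j \<otimes> m_j\<close> evaluates to \<open>\<Sum> m_j c^j u\<close>, which vanishes only if every \<open>m_j\<close> does.
\<close>

lemma ev_kernel: "kernel F (add_monoid V) ev = T"
proof (intro equalityI subsetI)
  fix z assume "z \<in> kernel F (add_monoid V) ev"
  then have z: "z \<in> carrier F" "ev z = \<zero>" by (auto simp: kernel_def)
  obtain m where m: "z - (\<Sum>j<n. pure j (m j)) \<in> T"
    using normalizable_all[OF z(1)] by (auto simp: normalizable_def)
  have "ev (z - (z - (\<Sum>j<n. pure j (m j)))) = \<zero>"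
    using ev_diff[OF z(1) T_F[OF m]] z(2) ev_T[OF m] by (simp add: M.minus_eq)
  then have "comb m = \<zero>" by (simp add: ev_sum_pure)
  then have "pure j (m j) \<in> T" if "j \<in> {..<n}" for j using comb_inj[of m j] that pure_zero by simp
  then have "(\<Sum>j<n. pure j (m j)) \<in> T" by (rule T_sum)
  from T_closed(2)[OF m this] show "z \<in> T" by simp
next
  fix z assume "z \<in> T"
  then show "z \<in> kernel F (add_monoid V) ev" using T_F ev_T by (auto simp: kernel_def)
qed

lemma ev_surj: "ev ` carrier F = carrier V"
proof (intro equalityI subsetI)
  fix v assume "v \<in> carrier V"
  then obtain m where "v = comb m" using comb_surj by blast
  then have "v = ev (\<Sum>j<n. pure j (m j))" by (simp only: ev_sum_pure)
  then show "v \<in> ev ` carrier F" by (rule image_eqI[OF _ sum_pure_F])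
qed (auto intro: ev_closed)

definition left_mult :: "(nat \<times> nat \<times> 'g \<Rightarrow>\<^sub>0 'k) \<Rightarrow> ((nat \<times> nat \<times> 'g \<Rightarrow>\<^sub>0 'k) \<times> 'k \<Rightarrow>\<^sub>0 int) \<Rightarrow> _"
  where "left_mult a = frag_extend (\<lambda>(b, m). frag_of (a \<otimes>\<^bsub>H\<^esub> b, m))"

lemma left_mult:
  assumes a: "a \<in> carrier H" and z: "z \<in> carrier F"
  shows "left_mult a z \<in> carrier F \<and> ev (left_mult a z) = a \<odot>\<^bsub>V\<^esub> ev z"
proof -
  have "z \<in> carrier F \<and> left_mult a z \<in> carrier F \<and> ev (left_mult a z) = a \<odot>\<^bsub>V\<^esub> ev z"
    using z[unfolded F_sel]
  proof (induction z rule: free_Abelian_group_induct[consumes 1, case_names zero diff one])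
    case zero
    then show ?case using a smult_zero[OF a] by (simp add: left_mult_def ev_zero F_closed)
  next
    case (diff x y)
    have "left_mult a (x - y) = left_mult a x - left_mult a y" by (simp add: left_mult_def frag_extend_diff)
    moreover have "a \<odot>\<^bsub>V\<^esub> (ev x \<ominus> ev y) = a \<odot>\<^bsub>V\<^esub> ev x \<ominus> a \<odot>\<^bsub>V\<^esub> ev y"
      using diff a ev_closed by (simp add: M.minus_eq smult_r_distr smult_minus_right)
    ultimately show ?case using diff by (simp add: ev_diff F_closed)
  next
    case (one x)
    obtain b m where x: "x = (b, m)" by (cases x)
    then have b: "b \<in> carrier H" using one by auto
    then show ?case using a u x by (simp add: left_mult_def F_closed ev_frag_of smult_assoc1)
  qed
  then show ?thesis by blast
qed

abbreviation "I \<equiv> induced_module H RN M"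

lemma I_sel:
  "carrier I = carrier (F Mod T)" "ring.zero I = one (F Mod T)" "add I = monoid.mult (F Mod T)"
  "smult I a Z = (\<Union>z\<in>Z. T #>\<^bsub>F\<^esub> left_mult a z)"
  by (simp_all add: induced_module_def Let_def F_def T_def left_mult_def)

lemma coset_ev:
  assumes "z \<in> carrier F"
  shows "T #>\<^bsub>F\<^esub> z = {z' \<in> carrier F. ev z' = ev z}"
proof (intro equalityI subsetI)
  fix z' assume "z' \<in> T #>\<^bsub>F\<^esub> z"
  then obtain s where s: "s \<in> T" "z' = s + z" by (auto simp: r_coset_def F_sel)
  then show "z' \<in> {z' \<in> carrier F. ev z' = ev z}"
    using assms T_F[OF s(1)] ev_T[OF s(1)] ev_closed by (auto simp: F_closed ev_add)
next
  fix z' assume z': "z' \<in> {z' \<in> carrier F. ev z' = ev z}"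
  then have "z' - z \<in> kernel F (add_monoid V) ev"
    using assms ev_closed by (auto simp: kernel_def F_closed ev_diff M.minus_eq M.r_neg)
  then show "z' \<in> T #>\<^bsub>F\<^esub> z" unfolding ev_kernel by (force simp: r_coset_def F_sel)
qed

text \<open>
  The union over all representatives in the definition of the action is a single coset, because evaluation
  does not distinguish the representatives.
\<close>

lemma smult_coset:
  assumes a: "a \<in> carrier H" and z: "z \<in> carrier F"
  shows "a \<odot>\<^bsub>I\<^esub> (T #>\<^bsub>F\<^esub> z) = T #>\<^bsub>F\<^esub> left_mult a z"
proof -
  have "T #>\<^bsub>F\<^esub> left_mult a z' = T #>\<^bsub>F\<^esub> left_mult a z" if "z' \<in> T #>\<^bsub>F\<^esub> z" for z'
  proof -
    have "z' \<in> carrier F" "ev z' = ev z" using that coset_ev[OF z] by auto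
    then show ?thesis using left_mult[OF a] z by (simp add: coset_ev)
  qed
  moreover have "z \<in> T #>\<^bsub>F\<^esub> z" using z by (simp add: coset_ev)
  ultimately show ?thesis unfolding I_sel by blast
qed

theorem isomorphic_induced: "isomorphic_modules H V I" "isomorphic_modules H I V"
proof -
  interpret ev: group_hom F "add_monoid V" ev by (rule group_hom_ev)
  interpret N: normal T F using ev.normal_kernel by (simp add: ev_kernel)
  define \<theta> where "\<theta> = (\<lambda>Z. the_elem (ev ` Z))"
  have car: "carrier I = {T #>\<^bsub>F\<^esub> z | z. z \<in> carrier F}"
    unfolding I_sel by (auto simp: FactGroup_def RCOSETS_def)
  have th: "\<theta> (T #>\<^bsub>F\<^esub> z) = ev z" if "z \<in> carrier F" for z
  proof -
    have "ev ` (T #>\<^bsub>F\<^esub> z) = {ev z}" using that by (auto simp: coset_ev)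
    then show ?thesis by (simp add: \<theta>_def)
  qed
  have "\<theta> \<in> Group.iso (F Mod T) (add_monoid V)"
    using ev.FactGroup_iso_set ev_surj unfolding \<theta>_def ev_kernel by simp
  then have "\<theta> \<in> Group.iso (add_monoid I) (add_monoid V)" by (simp add: iso_def hom_def I_sel)
  moreover have "\<theta> (a \<odot>\<^bsub>I\<^esub> Z) = a \<odot>\<^bsub>V\<^esub> \<theta> Z" if "a \<in> carrier H" "Z \<in> carrier I" for a Z
    using that left_mult by (auto simp: car smult_coset th)
  ultimately have "\<theta> \<in> module_iso H I V" by (simp add: module_iso_def)
  then show iso: "isomorphic_modules H I V" by (auto simp: isomorphic_modules_def)
  show "isomorphic_modules H V I"
  proof (rule isomorphic_modules_sym[OF iso])
    show "Z \<oplus>\<^bsub>I\<^esub> Y \<in> carrier I" if "Z \<in> carrier I" "Y \<in> carrier I" for Z Y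
      using that monoid.m_closed[OF group.is_monoid[OF N.factorgroup_is_group]] by (simp add: I_sel)
    show "a \<odot>\<^bsub>I\<^esub> Z \<in> carrier I" if "a \<in> carrier H" "Z \<in> carrier I" for a Z
      using that left_mult by (auto simp: car smult_coset)
  qed
qed

end

section \<open>Simple modules\<close>

lemma (in linear_operator) eigenvector_of_power:
  assumes alg_closed: "\<And>P :: 'k poly. Polynomial.degree P > 0 \<Longrightarrow> \<exists>c. poly P c = 0"
    and v: "v \<in> carrier V" "v \<noteq> \<zero>" and pow: "(T ^^ n) v = s \<odot>\<^bsub>V\<^esub> v" and n: "n > 0"
  shows "\<exists>c. \<exists>w\<in>carrier V. w \<noteq> \<zero> \<and> T w = c \<odot>\<^bsub>V\<^esub> w"
proof -
  let ?P = "Polynomial.monom 1 n + Polynomial.smult (- s) 1"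
  have one: "poly_act V T 1 v = v"
    using poly_act_pCons[OF v(1), of 1 0] v T_zero smult_one[of v] by (simp add: poly_act_0 one_pCons)
  have mon: "poly_act V T (Polynomial.monom 1 k) v = (T ^^ k) v" for k
  proof (induction k)
    case 0
    then show ?case using one by (simp add: monom_0 one_pCons)
  next
    case (Suc k)
    have "poly_act V T (Polynomial.monom 1 (Suc k)) v = T (poly_act V T (Polynomial.monom 1 k) v)"
      using poly_act_pCons[OF v(1), of 0 "Polynomial.monom 1 k"] zero_smult[OF v(1)] T_closed[OF poly_act_closed[OF v(1)]]
      by (simp add: monom_Suc)
    then show ?case using Suc by simp
  qed
  have "poly_act V T ?P v = s \<odot>\<^bsub>V\<^esub> v \<oplus> (- s) \<odot>\<^bsub>V\<^esub> v"
    using v(1) poly_act_smult[OF v(1), of "- s" 1] one mon[of n] pow by (simp only: poly_act_add)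
  also have "\<dots> = \<zero>" using smult_l_distr[of s "- s" v] zero_smult[OF v(1)] v(1) by simp
  finally have "poly_act V T ?P v = \<zero>" .
  moreover have "Polynomial.coeff ?P n = 1" using n by (simp add: coeff_pCons split: nat.split)
  then have "?P \<noteq> 0" by (metis coeff_0 zero_neq_one)
  ultimately show ?thesis using eigenvector_exists[OF alg_closed v] by blast
qed

lemma (in hopf_setting) eta_pow_n: "g \<in> carrier G \<Longrightarrow> \<eta> g ^ n = 1"
  using chi_pow_n[of g] by (metis power_int_mult power_int_of_nat mult.commute power_int_1_left)

text \<open>
  The values of \<open>\<chi>\<close> and \<open>\<eta>\<close> are \<open>n\<close>-th roots of unity, so \<open>x^n\<close> and \<open>y^n\<close> commute with \<open>G\<close>; and \<open>\<eta>\<close> is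
  trivial on the kernel of \<open>\<chi>\<close>, so \<open>N\<close> commutes with \<open>x\<close> and \<open>y\<close>.
\<close>

lemma (in hopf_setting) single_central:
  assumes g: "g \<in> N" and a: "a \<in> carrier H"
  shows "Poly_Mapping.single (n * i, n * j, g) s \<otimes>\<^bsub>H\<^esub> a = a \<otimes>\<^bsub>H\<^esub> Poly_Mapping.single (n * i, n * j, g) s"
  using a
proof (induction rule: hopf_induct_H)
  case zero
  then show ?case by (simp add: H_sel hopf_mult_zero[OF G chi eta])
next
  case (single k l h p)
  have "inverse (\<chi> h) ^ (n * i) = 1" "inverse (\<eta> h) ^ (n * j) = 1"
    using chi_pow_n[OF single] eta_pow_n[OF single] by (simp_all add: power_mult power_inverse)
  moreover have "g \<in> carrier G" "\<chi> g = 1" using g by (auto simp: N_iff)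
  ultimately show ?case using single by (simp add: H_sel(2) mult_single G.m_comm add.commute mult_ac)
next
  case (add a b)
  then show ?case by (simp add: H_sel hopf_mult_add_left[OF G chi eta] hopf_mult_add_right[OF G chi eta])
qed

locale simple_hopf_module = hopf_module G \<chi> t n q c V
  for G :: "('g, 'r) monoid_scheme" and \<chi> :: "'g \<Rightarrow> 'k::alg_closed_field" and t n q c
    and V :: "(nat \<times> nat \<times> 'g \<Rightarrow>\<^sub>0 'k, 'v, 's) module_scheme" (structure) +
  assumes simple: "simple_module (hopf_algebra G \<chi> (\<lambda>g. \<chi> g powi t)) V"
    and fin_gen: "finitely_generated_group G"
begin

lemma nontrivial: "\<exists>v\<in>carrier V. v \<noteq> \<zero>"
  using simple M.zero_closed unfolding simple_module_def by blast

lemma submodule_full: "Module.submodule W H V \<Longrightarrow> v \<in> W \<Longrightarrow> v \<noteq> \<zero> \<Longrightarrow> W = carrier V"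
  using simple unfolding simple_module_def by blast

lemma generated_by:
  assumes v: "v \<in> carrier V" "v \<noteq> \<zero>" and w: "w \<in> carrier V"
  shows "\<exists>a\<in>carrier H. w = a \<odot>\<^bsub>V\<^esub> v"
proof -
  let ?W = "(\<lambda>a. a \<odot>\<^bsub>V\<^esub> v) ` carrier H"
  have "Module.submodule ?W H V"
  proof (rule submodule_of_closed)
    show "?W \<subseteq> carrier V" using v by (auto simp: smult_closed)
    show "\<zero> \<in> ?W" using zero_smult[OF v(1)] H.zero_closed by (metis image_eqI)
    show "x \<oplus> y \<in> ?W" if mem: "x \<in> ?W" "y \<in> ?W" for x y
    proof -
      obtain a b where ab: "a \<in> carrier H" "b \<in> carrier H" and xy: "x = a \<odot>\<^bsub>V\<^esub> v" "y = b \<odot>\<^bsub>V\<^esub> v"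
        using mem by (elim imageE)
      show ?thesis unfolding xy
        by (rule image_eqI[of _ _ "a \<oplus>\<^bsub>H\<^esub> b"], rule smult_l_distr[OF ab v(1), symmetric], rule H.add.m_closed[OF ab])
    qed
    show "a \<odot>\<^bsub>V\<^esub> x \<in> ?W" if mem: "a \<in> carrier H" "x \<in> ?W" for a x
    proof -
      obtain b where b: "b \<in> carrier H" and x: "x = b \<odot>\<^bsub>V\<^esub> v" using mem(2) by (elim imageE)
      show ?thesis unfolding x
        by (rule image_eqI[of _ _ "a \<otimes>\<^bsub>H\<^esub> b"], rule smult_assoc1[OF mem(1) b v(1), symmetric], rule H.m_closed[OF mem(1) b])
    qed
  qed
  moreover have "v \<in> ?W" using smult_one[OF v(1)] H.one_closed by (metis image_eqI)
  ultimately show ?thesis using submodule_full v w by blast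
qed

text \<open>The image of a central element is a submodule; this is Schur's lemma for its action.\<close>

lemma central_surjective:
  assumes a: "a \<in> carrier H" "\<And>b. b \<in> carrier H \<Longrightarrow> a \<otimes>\<^bsub>H\<^esub> b = b \<otimes>\<^bsub>H\<^esub> a"
    and v: "v \<in> carrier V" "a \<odot>\<^bsub>V\<^esub> v \<noteq> \<zero>"
  shows "(\<lambda>v. a \<odot>\<^bsub>V\<^esub> v) ` carrier V = carrier V"
proof (rule submodule_full[OF submodule_of_closed])
  let ?W = "(\<lambda>v. a \<odot>\<^bsub>V\<^esub> v) ` carrier V"
  show "?W \<subseteq> carrier V" using a by (auto simp: smult_closed)
  show "\<zero> \<in> ?W" using smult_zero[OF a(1)] M.zero_closed by (metis image_eqI)
  show "x \<oplus> y \<in> ?W" if mem: "x \<in> ?W" "y \<in> ?W" for x y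
  proof -
    obtain x' y' where c: "x' \<in> carrier V" "y' \<in> carrier V" and xy: "x = a \<odot>\<^bsub>V\<^esub> x'" "y = a \<odot>\<^bsub>V\<^esub> y'"
      using mem by (elim imageE)
    show ?thesis unfolding xy
      by (rule image_eqI[of _ _ "x' \<oplus> y'"], rule smult_r_distr[OF a(1) c, symmetric], rule M.add.m_closed[OF c])
  qed
  show "b \<odot>\<^bsub>V\<^esub> x \<in> ?W" if mem: "b \<in> carrier H" "x \<in> ?W" for b x
  proof -
    obtain x' where x': "x' \<in> carrier V" and x: "x = a \<odot>\<^bsub>V\<^esub> x'" using mem(2) by (elim imageE)
    have "b \<odot>\<^bsub>V\<^esub> x = a \<odot>\<^bsub>V\<^esub> (b \<odot>\<^bsub>V\<^esub> x')"
      unfolding x using a(2)[OF mem(1)] smult_assoc1[OF a(1) mem(1) x'] smult_assoc1[OF mem(1) a(1) x'] by simp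
    then show ?thesis using smult_closed[OF mem(1) x'] by blast
  qed
  show "a \<odot>\<^bsub>V\<^esub> v \<in> ?W" using v by blast
qed (use v in auto)

text \<open>
  The vector \<open>v\<close> generates the module, and a central element commutes past whatever carries \<open>v\<close> to \<open>w\<close>.
\<close>

lemma central_eigenvector:
  assumes a: "a \<in> carrier H" "\<And>b. b \<in> carrier H \<Longrightarrow> a \<otimes>\<^bsub>H\<^esub> b = b \<otimes>\<^bsub>H\<^esub> a"
    and v: "v \<in> carrier V" "v \<noteq> \<zero>" "a \<odot>\<^bsub>V\<^esub> v = s \<cdot> v" and w: "w \<in> carrier V"
  shows "a \<odot>\<^bsub>V\<^esub> w = s \<cdot> w"
proof -
  obtain b where b: "b \<in> carrier H" "w = b \<odot>\<^bsub>V\<^esub> v" using generated_by[OF v(1,2) w] by blast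
  have "a \<odot>\<^bsub>V\<^esub> w = b \<odot>\<^bsub>V\<^esub> (a \<odot>\<^bsub>V\<^esub> v)"
    using a(1) a(2)[OF b(1)] b v(1) smult_assoc1[of a b v] smult_assoc1[of b a v] by simp
  then show ?thesis using b v scale_commute[OF b(1) v(1)] by simp
qed

text \<open>
  Taking for \<open>U\<close> an eigenspace of a commuting operator gives common eigenvectors.
\<close>

lemma eigenvector_in_subspace:
  assumes U: "U \<subseteq> carrier V" "\<zero> \<in> U" "\<And>v w. v \<in> U \<Longrightarrow> w \<in> U \<Longrightarrow> v \<oplus> w \<in> U" "\<And>s v. v \<in> U \<Longrightarrow> s \<cdot> v \<in> U"
    and a: "a \<in> carrier H" "\<And>v. v \<in> U \<Longrightarrow> a \<odot>\<^bsub>V\<^esub> v \<in> U"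
    and v: "v \<in> U" "v \<noteq> \<zero>" "((\<lambda>w. a \<odot>\<^bsub>V\<^esub> w) ^^ n) v = s \<cdot> v"
  shows "\<exists>c. \<exists>w\<in>U. w \<noteq> \<zero> \<and> a \<odot>\<^bsub>V\<^esub> w = c \<cdot> w"
proof -
  let ?K = "(K_space G V)\<lparr>carrier := U\<rparr>"
  have "abelian_group ?K"
  proof (rule abelian_groupI)
    fix x assume x: "x \<in> carrier ?K"
    then have xc: "x \<in> carrier V" using U(1) by auto
    have "(-1) \<cdot> x \<oplus> 1 \<cdot> x = (-1 + 1) \<cdot> x" using scale_simps(2)[OF xc, of "-1" 1] by (rule sym)
    then have "(-1) \<cdot> x \<oplus> x = \<zero>" using xc by (simp add: scale_simps)
    then show "\<exists>y\<in>carrier ?K. y \<oplus>\<^bsub>?K\<^esub> x = \<zero>\<^bsub>?K\<^esub>" using U(4) x by auto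
  qed (use U in \<open>auto simp: M.a_ac subset_iff\<close>)
  then interpret T: linear_operator ?K "\<lambda>w. a \<odot>\<^bsub>V\<^esub> w"
    using U a
    by (intro linear_operator.intro left_module.intro left_module_axioms.intro linear_operator_axioms.intro ring_class_ring)
      (auto simp: scale_simps smult_r_distr scale_commute[OF a(1)] subset_iff)
  show ?thesis
    using T.eigenvector_of_power[OF alg_closed_imp_poly_has_root, of v n s] v n_pos by simp
qed

text \<open>
  The subalgebra \<open>A\<close> generated by \<open>x^n\<close>, \<open>y^n\<close> and the group \<open>P\<close> of \<open>n\<close>-th powers of elements of \<open>G\<close> is
  central, and the whole algebra is a finitely generated module over it. So it acts on a simple module by
  scalars. The group \<open>P\<close> takes the place of the larger group \<open>N\<close> because generators of \<open>G\<close> yield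
  generators of \<open>P\<close> at once.
\<close>

lemma power_subalgebra:
  obtains A P where "subring A H" "\<And>a b. a \<in> A \<Longrightarrow> b \<in> carrier H \<Longrightarrow> a \<otimes>\<^bsub>H\<^esub> b = b \<otimes>\<^bsub>H\<^esub> a"
    "\<And>a. a \<in> A \<Longrightarrow> \<exists>s. \<forall>v\<in>carrier V. a \<odot>\<^bsub>V\<^esub> v = s \<cdot> v"
    "\<And>i j p s. p \<in> P \<Longrightarrow> Poly_Mapping.single (n * i, n * j, p) s \<in> A"
    "subgroup P G" "\<And>g. g \<in> carrier G \<Longrightarrow> g [^]\<^bsub>G\<^esub> n \<in> P"
proof -
  obtain S where S: "finite S" "S \<subseteq> carrier G" "generate G S = carrier G"
    using fin_gen by (auto simp: finitely_generated_group_def)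
  define Q where "Q = (\<lambda>s. s [^]\<^bsub>G\<^esub> n) ` S \<union> (\<lambda>s. inv\<^bsub>G\<^esub> (s [^]\<^bsub>G\<^esub> n)) ` S"
  define P where "P = generate G ((\<lambda>s. s [^]\<^bsub>G\<^esub> n) ` S)"
  have Q: "finite Q" "Q \<subseteq> N"
    using S chi_pow_n by (auto simp: Q_def N_iff chi_pow chi_inv subset_iff)
  have P: "subgroup P G" unfolding P_def using S by (intro G.generate_is_subgroup) auto
  have PN: "P \<subseteq> N" unfolding P_def
    using Q by (intro G.generate_subgroup_incl[OF _ subgroup_N]) (auto simp: Q_def)
  have pow: "g [^]\<^bsub>G\<^esub> n \<in> P" if "g \<in> carrier G" for g
    using that[folded S(3)]
  proof (induction)
    case one
    then show ?case using subgroup.one_closed[OF P] by simp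
  next
    case (incl h)
    then show ?case unfolding P_def by (auto intro: generate.incl)
  next
    case (inv h)
    then have "h [^]\<^bsub>G\<^esub> n \<in> P" unfolding P_def by (auto intro: generate.incl)
    then show ?case using inv S subgroup.m_inv_closed[OF P] by (auto simp: G.nat_pow_inv subset_iff)
  next
    case (eng h1 h2)
    then have "h1 \<in> carrier G" "h2 \<in> carrier G" using S(3) by auto
    then show ?case using eng subgroup.m_closed[OF P] by (simp add: G.nat_pow_distrib)
  qed
  define B where "B = insert (Poly_Mapping.single (n, 0, \<one>\<^bsub>G\<^esub>) 1) (insert (Poly_Mapping.single (0, n, \<one>\<^bsub>G\<^esub>) (1::'k)) (grp ` Q))"
  obtain xs where xs: "set xs = B" using finite_list[of B] Q by (auto simp: B_def)
  define A where "A = generated_algebra H (scalar G) B"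
  have oneN: "\<one>\<^bsub>G\<^esub> \<in> N" using subgroup.one_closed[OF subgroup_N] .
  have BH: "B \<subseteq> carrier H" using Q by (auto simp: B_def N_iff)
  have AH: "A \<subseteq> carrier H"
    using generated_algebra_closed[OF H.ring_axioms _ BH, of "scalar G"] by (auto simp: A_def image_subset_iff)
  have cen: "a \<otimes>\<^bsub>H\<^esub> b = b \<otimes>\<^bsub>H\<^esub> a" if "a \<in> A" "b \<in> carrier H" for a b
    using that(1)[unfolded A_def]
  proof induction
    case (scalar s)
    then show ?case using scalar_central that by blast
  next
    case (gen x)
    then consider "x = Poly_Mapping.single (n * 1, n * 0, \<one>\<^bsub>G\<^esub>) 1" | "x = Poly_Mapping.single (n * 0, n * 1, \<one>\<^bsub>G\<^esub>) 1"
      | g where "g \<in> N" "x = Poly_Mapping.single (n * 0, n * 0, g) 1" using Q by (auto simp: B_def grp_def)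
    then obtain i j g where g: "g \<in> N" and x: "x = Poly_Mapping.single (n * i, n * j, g) 1" using oneN by metis
    show ?case unfolding x by (rule single_central[OF g that(2)])
  next
    case (add a a')
    then have "a \<in> carrier H" "a' \<in> carrier H" using AH by (auto simp: A_def)
    then show ?case using add that by (simp add: H.l_distr H.r_distr)
  next
    case (mult a a')
    then have c: "a \<in> carrier H" "a' \<in> carrier H" using AH by (auto simp: A_def)
    have "(a \<otimes>\<^bsub>H\<^esub> a') \<otimes>\<^bsub>H\<^esub> b = a \<otimes>\<^bsub>H\<^esub> (b \<otimes>\<^bsub>H\<^esub> a')" using c that mult by (simp add: H.m_assoc)
    also have "\<dots> = b \<otimes>\<^bsub>H\<^esub> (a \<otimes>\<^bsub>H\<^esub> a')" using c that mult H.m_assoc by metis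
    finally show ?case .
  qed
  have sub: "subring A H"
  proof (rule H.subringI[OF AH])
    have one: "\<one>\<^bsub>H\<^esub> = scalar G 1" by (simp add: H_sel(5) scalar_def)
    show "\<one>\<^bsub>H\<^esub> \<in> A" unfolding one A_def by (rule generated_algebra.scalar)
    fix a assume a: "a \<in> A"
    have "scalar G (-1) \<oplus>\<^bsub>H\<^esub> scalar G 1 = \<zero>\<^bsub>H\<^esub>"
      using ring_hom_memE(3)[OF scalar_hom, of "-1" 1] by (simp add: scalar_def H_sel(4))
    then have "\<ominus>\<^bsub>H\<^esub> \<one>\<^bsub>H\<^esub> = scalar G (-1)" unfolding one by (intro H.minus_equality) auto
    then have "\<ominus>\<^bsub>H\<^esub> a = scalar G (-1) \<otimes>\<^bsub>H\<^esub> a"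
      using a AH H.l_minus[of "\<one>\<^bsub>H\<^esub>" a] by auto
    then show "\<ominus>\<^bsub>H\<^esub> a \<in> A" using a generated_algebra.mult[OF generated_algebra.scalar] by (simp add: A_def)
  qed (auto simp: A_def intro: generated_algebra.add generated_algebra.mult)
  have grpA: "grp p \<in> A" if "p \<in> P" for p
    using that[unfolded P_def]
  proof induction
    case one
    have "grp \<one>\<^bsub>G\<^esub> = \<one>\<^bsub>H\<^esub>" by (simp add: H_sel(5) grp_def)
    then show ?case using subringE(3)[OF sub] by simp
  next
    case (eng h1 h2)
    then show ?case using hopf_relations(4)[OF G chi eta, of h1 h2] subringE(6)[OF sub] by simp
  qed (auto simp: A_def B_def Q_def intro!: generated_algebra.gen)
  have singleA: "Poly_Mapping.single (n * i, n * j, p) s \<in> A" if "p \<in> P" for i j p s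
  proof -
    have pc: "p \<in> carrier G" "\<chi> p = 1" using that PN by (auto simp: N_iff)
    have "Poly_Mapping.single (0, 0, p) s = scalar G s \<otimes>\<^bsub>H\<^esub> grp p"
      using pc by (simp add: scalar_def grp_def H_sel(2) mult_single chi_one)
    then have base: "Poly_Mapping.single (0, 0, p) s \<in> A"
      using grpA[OF that] subringE(6)[OF sub] generated_algebra.scalar[of "scalar G" s H B] by (simp add: A_def)
    have gens: "Poly_Mapping.single (n, 0, \<one>\<^bsub>G\<^esub>) 1 \<in> A" "Poly_Mapping.single (0, n, \<one>\<^bsub>G\<^esub>) 1 \<in> A"
      unfolding A_def by (auto simp: B_def intro: generated_algebra.gen)
    have y: "Poly_Mapping.single (0, n * j, p) s \<in> A" for j
    proof (induction j)
      case (Suc j)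
      have "Poly_Mapping.single (0, n * Suc j, p) s =
          Poly_Mapping.single (0, n, \<one>\<^bsub>G\<^esub>) 1 \<otimes>\<^bsub>H\<^esub> Poly_Mapping.single (0, n * j, p) s"
        using pc by (simp add: H_sel(2) mult_single chi_one)
      then show ?case using subringE(6)[OF sub gens(2) Suc] by simp
    qed (use base in simp)
    show ?thesis
    proof (induction i)
      case (Suc i)
      have "Poly_Mapping.single (n * Suc i, n * j, p) s =
          Poly_Mapping.single (n, 0, \<one>\<^bsub>G\<^esub>) 1 \<otimes>\<^bsub>H\<^esub> Poly_Mapping.single (n * i, n * j, p) s"
        using pc by (simp add: H_sel(2) mult_single chi_one)
      then show ?case using subringE(6)[OF sub gens(1) Suc] by simp
    qed (use y in simp)
  qed
  let ?A = "H\<lparr>carrier := A\<rparr>"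
  have lm: "left_module ?A V"
    using AH
    by (intro left_module.intro left_module_axioms.intro H.subring_is_ring[OF sub] M.abelian_group_axioms)
      (auto simp: smult_closed smult_l_distr smult_r_distr smult_assoc1 smult_one subset_iff)
  interpret AV: left_module ?A V by (rule lm)
  obtain v0 where v0: "v0 \<in> carrier V" "v0 \<noteq> \<zero>" using nontrivial by blast
  obtain R where R: "finite R" "R \<subseteq> carrier G" "generate G S \<subseteq> R <#>\<^bsub>G\<^esub> P"
    using G.finite_transversal[OF P S(1,2) _ n_pos] pow S(2) by blast
  \<comment> \<open>the monomials that remain after division of the exponents by \<open>n\<close> and of \<open>G\<close> by \<open>P\<close>\<close>
  define W where "W = (\<lambda>(i, j, r). Poly_Mapping.single (i, j, r) 1 \<odot>\<^bsub>V\<^esub> v0) ` ({..<n} \<times> {..<n} \<times> R)"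
  have W: "finite W" "W \<subseteq> carrier V" using R v0 by (auto simp: W_def)
  have span: "a \<odot>\<^bsub>V\<^esub> v0 \<in> module_span ?A V W" if "a \<in> carrier H" for a
    using that
  proof (induction rule: hopf_induct_H)
    case zero
    then show ?case using zero_smult[OF v0(1)] by (auto simp: H_sel(4) intro: module_span.zero)
  next
    case (single i j g s)
    then obtain r p where rp: "r \<in> R" "p \<in> P" "g = r \<otimes>\<^bsub>G\<^esub> p" using R(3) S(3) by (auto simp: set_mult_def)
    have pc: "p \<in> carrier G" "\<chi> p = 1" "r \<in> carrier G" using rp PN R(2) by (auto simp: N_iff)
    let ?a = "Poly_Mapping.single (n * (i div n), n * (j div n), p) s"
    let ?b = "Poly_Mapping.single (i mod n, j mod n, r) (1::'k)"
    have "Poly_Mapping.single (i, j, g) s = ?a \<otimes>\<^bsub>H\<^esub> ?b"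
      using pc rp(3) by (simp add: H_sel(2) mult_single G.m_comm)
    then have "Poly_Mapping.single (i, j, g) s \<odot>\<^bsub>V\<^esub> v0 = ?a \<odot>\<^bsub>V\<^esub> (?b \<odot>\<^bsub>V\<^esub> v0)"
      using pc v0 by (simp add: smult_assoc1)
    moreover have "?b \<odot>\<^bsub>V\<^esub> v0 \<in> W" using rp n_pos by (auto simp: W_def)
    ultimately show ?case
      using AV.span_smult[OF W(2) _ AV.span_incl[OF W(2)]] singleA[OF rp(2)] by simp
  next
    case (add a b)
    then show ?case using AV.span_add[OF W(2)] smult_l_distr[of a b v0] v0 by (simp add: H_sel(3))
  qed
  have Wspan: "module_span ?A V W = carrier V"
    using AV.span_in_carrier[OF W(2)] span generated_by[OF v0] by blast
  have gen: "carrier ?A = generated_algebra ?A (scalar G) (set xs)"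
  proof (intro equalityI subsetI)
    fix a assume "a \<in> carrier ?A"
    then have "a \<in> generated_algebra H (scalar G) B" by (simp add: A_def)
    then show "a \<in> generated_algebra ?A (scalar G) (set xs)"
    proof induction
      case (add a b)
      from generated_algebra.add[OF add.IH] show ?case by simp
    next
      case (mult a b)
      from generated_algebra.mult[OF mult.IH] show ?case by simp
    qed (auto simp: xs intro: generated_algebra.intros)
  next
    fix a assume "a \<in> generated_algebra ?A (scalar G) (set xs)"
    then show "a \<in> carrier ?A"
      using generated_algebra_closed[OF AV.R.ring_axioms, of "scalar G" "set xs" a]
        generated_algebra.scalar[of "scalar G" _ H B] generated_algebra.gen[of _ B H "scalar G"]
      by (auto simp: xs A_def)
  qed
  have act: "\<exists>s. \<forall>v\<in>carrier V. a \<odot>\<^bsub>V\<^esub> v = s \<cdot> v" if a: "a \<in> A" for a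
  proof (rule acts_by_scalars[OF lm _ _ _ gen W Wspan])
    show "cring ?A"
      using H.subcring_iff[OF AH] H.subcringI[OF sub] cen AH by (auto simp: subset_iff)
    show "scalar G \<in> Ring.ring_hom class_ring ?A"
      using ring_hom_memE[OF scalar_hom]
      by (intro ring_hom_memI) (auto simp: A_def intro: generated_algebra.scalar)
    show "set xs \<subseteq> carrier ?A" by (auto simp: xs A_def intro: generated_algebra.gen)
    show "carrier V \<noteq> {\<zero>}" using nontrivial by auto
    show "carrier V \<subseteq> (\<lambda>v. a \<odot>\<^bsub>V\<^esub> v) ` carrier V" if "a \<in> carrier ?A" "\<exists>v\<in>carrier V. a \<odot>\<^bsub>V\<^esub> v \<noteq> \<zero>" for a
      using that central_surjective[of a] cen AH by auto
    show "a \<in> carrier ?A" using a by simp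
  qed
  show ?thesis by (rule that[OF sub cen act singleA P pow])
qed

text \<open>
  Since \<open>h^n\<close> acts by a scalar, \<open>h\<close> has an eigenvector; and \<open>h\<close> is central.
\<close>

lemma N_acts_by_scalars: "\<exists>\<Lambda>. \<forall>h\<in>N. \<forall>v\<in>carrier V. grp h \<odot>\<^bsub>V\<^esub> v = \<Lambda> h \<cdot> v"
proof -
  obtain A P where AP: "subring A H" "\<And>a b. a \<in> A \<Longrightarrow> b \<in> carrier H \<Longrightarrow> a \<otimes>\<^bsub>H\<^esub> b = b \<otimes>\<^bsub>H\<^esub> a"
    "\<And>a. a \<in> A \<Longrightarrow> \<exists>s. \<forall>v\<in>carrier V. a \<odot>\<^bsub>V\<^esub> v = s \<cdot> v"
    "\<And>i j p s. p \<in> P \<Longrightarrow> Poly_Mapping.single (n * i, n * j, p) s \<in> A"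
    "subgroup P G" "\<And>g. g \<in> carrier G \<Longrightarrow> g [^]\<^bsub>G\<^esub> n \<in> P" by (rule power_subalgebra) blast
  have "\<exists>s. \<forall>v\<in>carrier V. grp h \<odot>\<^bsub>V\<^esub> v = s \<cdot> v" if h: "h \<in> N" for h
  proof -
    have hc: "h \<in> carrier G" using h by (simp add: N_iff)
    obtain v where v: "v \<in> carrier V" "v \<noteq> \<zero>" using nontrivial by blast
    have "grp (h [^]\<^bsub>G\<^esub> n) \<in> A" using AP(4)[OF AP(6)[OF hc], of 0 0 1] by (simp add: grp_def)
    then obtain s where s: "grp (h [^]\<^bsub>G\<^esub> n) \<odot>\<^bsub>V\<^esub> v = s \<cdot> v" using AP(3) v by blast
    have "((\<lambda>w. grp h \<odot>\<^bsub>V\<^esub> w) ^^ k) v = grp (h [^]\<^bsub>G\<^esub> k) \<odot>\<^bsub>V\<^esub> v" for k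
    proof (induction k)
      case (Suc k)
      then show ?case using hc v by (simp add: grp_grp G.nat_pow_Suc2[symmetric] del: G.nat_pow_Suc)
    qed (use v in \<open>simp add: grp_one\<close>)
    then have "\<exists>c. \<exists>w\<in>carrier V. w \<noteq> \<zero> \<and> grp h \<odot>\<^bsub>V\<^esub> w = c \<cdot> w"
      using s v hc by (intro eigenvector_in_subspace[of "carrier V" "grp h" v s]) auto
    then obtain r w where w: "w \<in> carrier V" "w \<noteq> \<zero>" "grp h \<odot>\<^bsub>V\<^esub> w = r \<cdot> w" by blast
    have "grp h \<otimes>\<^bsub>H\<^esub> b = b \<otimes>\<^bsub>H\<^esub> grp h" if "b \<in> carrier H" for b
      using single_central[OF h that, of 0 0 1] by (simp add: grp_def)
    then show ?thesis using central_eigenvector[OF _ _ w] hc by auto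
  qed
  then show ?thesis by metis
qed

text \<open>
  On a simple module \<open>x^n\<close> and \<open>y^n\<close> act by scalars, so the commuting operators \<open>x\<close> and \<open>y\<close> have a common
  eigenvector. Its eigenvalues are not zero because there is no torsion.
\<close>

lemma weight_vector_exists:
  assumes tx: "torsion_free H V (gen_x G)" and ty: "torsion_free H V (gen_y G)"
  shows "\<exists>u \<alpha>x \<alpha>y \<Lambda>. weight_module G \<chi> t n q c V u \<alpha>x \<alpha>y \<Lambda>"
proof -
  obtain A P where AP: "subring A H" "\<And>a b. a \<in> A \<Longrightarrow> b \<in> carrier H \<Longrightarrow> a \<otimes>\<^bsub>H\<^esub> b = b \<otimes>\<^bsub>H\<^esub> a"
    "\<And>a. a \<in> A \<Longrightarrow> \<exists>s. \<forall>v\<in>carrier V. a \<odot>\<^bsub>V\<^esub> v = s \<cdot> v"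
    "\<And>i j p s. p \<in> P \<Longrightarrow> Poly_Mapping.single (n * i, n * j, p) s \<in> A"
    "subgroup P G" "\<And>g. g \<in> carrier G \<Longrightarrow> g [^]\<^bsub>G\<^esub> n \<in> P" by (rule power_subalgebra) blast
  have pow: "\<exists>s. \<forall>v\<in>carrier V. ((\<lambda>w. a \<odot>\<^bsub>V\<^esub> w) ^^ n) v = s \<cdot> v" if "a \<in> {gen_x G, gen_y G}" for a
  proof -
    have "gen_x G [^]\<^bsub>H\<^esub> n \<in> A" "gen_y G [^]\<^bsub>H\<^esub> n \<in> A"
      using AP(4)[OF subgroup.one_closed[OF AP(5)], of 1 0 1] AP(4)[OF subgroup.one_closed[OF AP(5)], of 0 1 1]
      by (simp_all add: gen_pow[OF G chi eta])
    moreover have "a \<in> carrier H" using that by auto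
    ultimately show ?thesis using AP(3)[of "a [^]\<^bsub>H\<^esub> n"] that by (auto simp: pow_smult)
  qed
  obtain sx where sx: "\<forall>v\<in>carrier V. ((\<lambda>w. gen_x G \<odot>\<^bsub>V\<^esub> w) ^^ n) v = sx \<cdot> v"
    using pow[of "gen_x G"] by auto
  obtain sy where sy: "\<forall>v\<in>carrier V. ((\<lambda>w. gen_y G \<odot>\<^bsub>V\<^esub> w) ^^ n) v = sy \<cdot> v"
    using pow[of "gen_y G"] by auto
  obtain v where v: "v \<in> carrier V" "v \<noteq> \<zero>" using nontrivial by blast
  have "\<exists>c. \<exists>w\<in>carrier V. w \<noteq> \<zero> \<and> gen_x G \<odot>\<^bsub>V\<^esub> w = c \<cdot> w"
    using sx v by (intro eigenvector_in_subspace[of "carrier V" "gen_x G" v sx]) auto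
  then obtain \<alpha>x v' where v': "v' \<in> carrier V" "v' \<noteq> \<zero>" "gen_x G \<odot>\<^bsub>V\<^esub> v' = \<alpha>x \<cdot> v'" by blast
  let ?U = "{v \<in> carrier V. gen_x G \<odot>\<^bsub>V\<^esub> v = \<alpha>x \<cdot> v}"
  have "\<exists>c. \<exists>w\<in>?U. w \<noteq> \<zero> \<and> gen_y G \<odot>\<^bsub>V\<^esub> w = c \<cdot> w"
  proof (rule eigenvector_in_subspace[of ?U "gen_y G" v' sy])
    show "\<zero> \<in> ?U" using smult_zero[of "gen_x G"] scale_simps(6) by simp
    show "s \<cdot> v \<in> ?U" if "v \<in> ?U" for s v
      using that scale_commute[of "gen_x G" v s] by (simp add: scale_simps mult.commute)
    show "gen_y G \<odot>\<^bsub>V\<^esub> v \<in> ?U" if "v \<in> ?U" for v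
      using that scale_commute[of "gen_y G" v \<alpha>x] by (simp add: x_y)
    show "v \<oplus> w \<in> ?U" if "v \<in> ?U" "w \<in> ?U" for v w
      using that smult_r_distr[of "gen_x G" v w] by (simp add: scale_simps)
  qed (use v' sy in auto)
  then obtain \<alpha>y u where u: "u \<in> carrier V" "u \<noteq> \<zero>" "gen_x G \<odot>\<^bsub>V\<^esub> u = \<alpha>x \<cdot> u" "gen_y G \<odot>\<^bsub>V\<^esub> u = \<alpha>y \<cdot> u"
    by blast
  have "gen_x G \<odot>\<^bsub>V\<^esub> u \<noteq> \<zero>" "gen_y G \<odot>\<^bsub>V\<^esub> u \<noteq> \<zero>"
    using tx ty u(1,2) unfolding torsion_free_def
    by (metis H.nat_pow_eone generator_carrier(2) order_refl, metis H.nat_pow_eone generator_carrier(3) order_refl)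
  then have "\<alpha>x \<noteq> 0" "\<alpha>y \<noteq> 0" using u by (auto simp: scale_eq_zero_iff)
  moreover obtain \<Lambda> where "\<forall>h\<in>N. \<forall>v\<in>carrier V. grp h \<odot>\<^bsub>V\<^esub> v = \<Lambda> h \<cdot> v" using N_acts_by_scalars by blast
  ultimately have "weight_module G \<chi> t n q c V u \<alpha>x \<alpha>y \<Lambda>"
    using u generated_by[OF u(1,2)]
    by (intro weight_module.intro hopf_module_axioms weight_module_axioms.intro) auto
  then show ?thesis by blast
qed

end

section \<open>The classification\<close>

lemma (in hopf_setting) q_powi_mod: "q powi (i mod int n) = q powi i"
proof -
  have "q powi i = q powi (int n * (i div int n) + i mod int n)" by simp
  also have "\<dots> = (q powi int n) powi (i div int n) * q powi (i mod int n)"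
    using q_nonzero by (subst power_int_add) (auto simp: power_int_mult)
  finally show ?thesis by (simp add: q_pow_n)
qed

text \<open>
  The eigenspaces of \<open>x\<close> are the lines spanned by the vectors \<open>c^j u\<close> with \<open>j < n\<close>, so every weight vector is a
  multiple of one of them.
\<close>

lemma (in weight_module) weight_unique:
  assumes v: "v \<in> carrier V" "v \<noteq> \<zero>"
    and x: "gen_x G \<odot>\<^bsub>V\<^esub> v = \<beta>x \<cdot> v" and y: "gen_y G \<odot>\<^bsub>V\<^esub> v = \<beta>y \<cdot> v"
    and h: "\<And>h. h \<in> N \<Longrightarrow> grp h \<odot>\<^bsub>V\<^esub> v = \<Lambda>' h \<cdot> v"
  shows "(\<forall>h\<in>N. \<Lambda>' h = \<Lambda> h) \<and>
    (\<exists>j. \<beta>x = \<alpha>x * q powi (- int j) \<and> \<beta>y = \<alpha>y * q powi (- (int j * t)))"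
proof -
  define \<mu> where "\<mu> = (\<lambda>j. \<alpha>x * q powi (- int j))"
  obtain a where a: "v = comb a" using comb_surj v by blast
  have aw: "a j \<cdot> w j \<in> carrier V" for j by simp
  have xw: "gen_x G \<odot>\<^bsub>V\<^esub> (a j \<cdot> w j) = \<mu> j \<cdot> a j \<cdot> w j" for j
    by (simp add: scale_commute[of "gen_x G"] x_w scale_simps mult.commute \<mu>_def)
  \<comment> \<open>the component of \<open>v\<close> along \<open>c^j u\<close> vanishes unless its eigenvalue is \<open>\<beta>x\<close>\<close>
  have zero: "(\<mu> j - \<beta>x) \<cdot> a j \<cdot> w j = \<zero>" if j: "j < n" for j
  proof (rule eigenvectors_independent[of "gen_x G" n "\<lambda>j. (\<mu> j - \<beta>x) \<cdot> a j \<cdot> w j" \<mu>])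
    show "gen_x G \<odot>\<^bsub>V\<^esub> ((\<mu> j - \<beta>x) \<cdot> a j \<cdot> w j) = \<mu> j \<cdot> (\<mu> j - \<beta>x) \<cdot> a j \<cdot> w j" for j
      using scale_commute[OF generator_carrier(2) aw[of j], of "\<mu> j - \<beta>x"] scale_simps(1)[OF aw[of j]] xw[of j]
      by (metis mult.commute)
    show "inj_on \<mu> {..<n}" using eigenvalue_inj by (simp add: \<mu>_def)
    have "finsum V (\<lambda>j. (\<mu> j - \<beta>x) \<cdot> a j \<cdot> w j) {..<n} =
        finsum V (\<lambda>j. gen_x G \<odot>\<^bsub>V\<^esub> (a j \<cdot> w j) \<oplus> (- \<beta>x) \<cdot> a j \<cdot> w j) {..<n}"
    proof (rule M.finsum_cong')
      show "(\<mu> j - \<beta>x) \<cdot> a j \<cdot> w j = gen_x G \<odot>\<^bsub>V\<^esub> (a j \<cdot> w j) \<oplus> (- \<beta>x) \<cdot> a j \<cdot> w j" for j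
        using scale_simps(2)[OF aw, of "\<mu> j" "- \<beta>x" j] xw by simp
    qed auto
    also have "\<dots> = finsum V (\<lambda>j. gen_x G \<odot>\<^bsub>V\<^esub> (a j \<cdot> w j)) {..<n} \<oplus> finsum V (\<lambda>j. (- \<beta>x) \<cdot> a j \<cdot> w j) {..<n}"
      by (rule M.finsum_addf) auto
    also have "\<dots> = gen_x G \<odot>\<^bsub>V\<^esub> v \<oplus> (- \<beta>x) \<cdot> v"
      unfolding a comb_def by (subst (1 2) smult_finsum) auto
    also have "\<dots> = (\<beta>x + - \<beta>x) \<cdot> v" using scale_simps(2)[OF v(1), of \<beta>x "- \<beta>x"] x by simp
    finally show "finsum V (\<lambda>j. (\<mu> j - \<beta>x) \<cdot> a j \<cdot> w j) {..<n} = \<zero>" using v by (simp add: scale_simps)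
  qed (use j in auto)
  have "\<exists>k<n. a k \<cdot> w k \<noteq> \<zero>"
  proof (rule ccontr)
    assume "\<not> (\<exists>k<n. a k \<cdot> w k \<noteq> \<zero>)"
    then have "comb a = \<zero>" unfolding comb_def by (intro M.add.finprod_one_eqI) auto
    then show False using a v by simp
  qed
  then obtain k where k: "k < n" "a k \<cdot> w k \<noteq> \<zero>" by blast
  then have bx: "\<beta>x = \<mu> k" using zero[OF k(1)] scale_eq_zero_iff[OF aw[of k], of "\<mu> k - \<beta>x"] by auto
  have other: "a j \<cdot> w j = \<zero>" if "j < n" "j \<noteq> k" for j
  proof -
    have "\<mu> j \<noteq> \<beta>x" using eigenvalue_inj that k(1) unfolding bx \<mu>_def by (auto dest: inj_onD)
    then show ?thesis using zero[OF that(1)] scale_eq_zero_iff[OF aw[of j], of "\<mu> j - \<beta>x"] by auto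
  qed
  have "comb a = comb (\<lambda>j. if j = k then a k else 0)"
    unfolding comb_def using other by (intro M.finsum_cong') (auto simp: scale_simps)
  then have vk: "v = a k \<cdot> w k" using a comb_single[OF k(1)] by simp
  have "gen_y G \<odot>\<^bsub>V\<^esub> v = (\<alpha>y * q powi (- (int k * t))) \<cdot> v"
    unfolding vk by (simp add: scale_commute[of "gen_y G"] y_w scale_simps mult.commute)
  then have by_eq: "\<beta>y = \<alpha>y * q powi (- (int k * t))" using scale_cancel[OF v] y by simp
  have "\<Lambda>' g = \<Lambda> g" if g: "g \<in> N" for g
  proof -
    have "grp g \<odot>\<^bsub>V\<^esub> w k = \<Lambda> g \<cdot> w k" using grp_w[OF g, of 0 k] g by simp
    then have "grp g \<odot>\<^bsub>V\<^esub> v = \<Lambda> g \<cdot> v"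
      unfolding vk using g by (simp add: scale_commute[of "grp g"] scale_simps mult.commute)
    then show ?thesis using scale_cancel[OF v] h[OF g] by simp
  qed
  then show ?thesis using bx by_eq by (auto simp: \<mu>_def)
qed

text \<open>
  Some power of \<open>c\<close> carries \<open>v_i\<close> to a nonzero multiple of any given \<open>v_j\<close>, so \<open>v_i\<close> generates the module.
\<close>

lemma (in hopf_setting) is_Vxy_weight_module:
  assumes Vxy: "is_Vxy G \<chi> t n q c \<alpha>x \<alpha>y \<Lambda> V" and i: "i < n"
  shows "\<exists>u. weight_module G \<chi> t n q c V u (\<alpha>x * q powi (- int i)) (\<alpha>y * q powi (- (int i * t))) \<Lambda>"
proof -
  have lm: "left_module H V" and nz: "\<alpha>x \<noteq> 0" "\<alpha>y \<noteq> 0"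
    and Lam: "\<Lambda> \<in> hom (G\<lparr>carrier := N\<rparr>) field_units"
    using Vxy by (auto simp: is_Vxy_def)
  obtain v where inj: "inj_on v {..<n}" and basis: "vectorspace.basis class_ring (K_space G V) (v ` {..<n})"
    and x: "\<forall>i<n. gen_x G \<odot>\<^bsub>V\<^esub> v i = scalar G (\<alpha>x * q powi (- int i)) \<odot>\<^bsub>V\<^esub> v i"
    and y: "\<forall>i<n. gen_y G \<odot>\<^bsub>V\<^esub> v i = scalar G (\<alpha>y * q powi (- (int i * t))) \<odot>\<^bsub>V\<^esub> v i"
    and g: "\<forall>i<n. \<forall>j<n. \<forall>h\<in>N. grp (c [^]\<^bsub>G\<^esub> j \<otimes>\<^bsub>G\<^esub> h) \<odot>\<^bsub>V\<^esub> v i =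
          scalar G (\<Lambda> h * \<Lambda> (c [^]\<^bsub>G\<^esub> n) ^ ((i + j) div n)) \<odot>\<^bsub>V\<^esub> v ((i + j) mod n)"
    using Vxy unfolding is_Vxy_def by blast
  interpret hopf_module G \<chi> t n q c V
    by (intro hopf_module.intro hopf_setting_axioms lm)
  interpret K: vectorspace class_ring "K_space G V" by (rule vectorspace_K_space)
  have vc: "v j \<in> carrier V" if "j < n" for j using basis that by (auto simp: K.basis_def)
  have "(UNIV :: 'k set) \<noteq> {0}" by (metis UNIV_I singletonD zero_neq_one)
  then have "\<zero>\<^bsub>K_space G V\<^esub> \<notin> v ` {..<n}"
    using K.zero_nin_lin_indpt[of "v ` {..<n}"] basis unfolding K.basis_def by simp
  then have u: "v i \<in> carrier V" "v i \<noteq> \<zero>\<^bsub>V\<^esub>" using vc i by force+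
  have Lnz: "\<Lambda> h \<noteq> 0" if "h \<in> N" for h using Lam that by (auto simp: hom_def)
  have N: "\<one>\<^bsub>G\<^esub> \<in> N" "c [^]\<^bsub>G\<^esub> n \<in> N"
    using subgroup.one_closed[OF subgroup_N] c chi_pow_n by (auto simp: N_iff chi_pow)
  define W where "W = (\<lambda>a. a \<odot>\<^bsub>V\<^esub> v i) ` carrier H"
  have W_add: "p \<oplus>\<^bsub>V\<^esub> r \<in> W" if mem: "p \<in> W" "r \<in> W" for p r
  proof -
    obtain a b where ab: "a \<in> carrier H" "b \<in> carrier H" and pr: "p = a \<odot>\<^bsub>V\<^esub> v i" "r = b \<odot>\<^bsub>V\<^esub> v i"
      using mem unfolding W_def by (elim imageE)
    show ?thesis unfolding pr W_def
      by (rule image_eqI[of _ _ "a \<oplus>\<^bsub>H\<^esub> b"], rule smult_l_distr[OF ab u(1), symmetric], rule H.add.m_closed[OF ab])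
  qed
  have W_scale: "a \<odot>\<^bsub>V\<^esub> p \<in> W" if mem: "a \<in> carrier H" "p \<in> W" for a p
  proof -
    obtain b where b: "b \<in> carrier H" and p: "p = b \<odot>\<^bsub>V\<^esub> v i" using mem(2) unfolding W_def by (elim imageE)
    show ?thesis unfolding p W_def
      by (rule image_eqI[of _ _ "a \<otimes>\<^bsub>H\<^esub> b"], rule smult_assoc1[OF mem(1) b u(1), symmetric], rule H.m_closed[OF mem(1) b])
  qed
  have W_one: "v i \<in> W" unfolding W_def using smult_one[OF u(1)] H.one_closed by (metis image_eqI)
  have Wv: "v j \<in> W" if j: "j < n" for j
  proof -
    \<comment> \<open>the exponent \<open>j - i\<close>, shifted by \<open>n\<close> to stay within the natural numbers\<close>
    define k where "k = (j + (n - i)) mod n"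
    have k: "k < n" using n_pos by (simp add: k_def)
    have "(i + k) mod n = (i + (j + (n - i))) mod n" by (simp add: k_def mod_simps)
    also have "\<dots> = j" using i j by simp
    finally have ik: "(i + k) mod n = j" .
    define s where "s = \<Lambda> \<one>\<^bsub>G\<^esub> * \<Lambda> (c [^]\<^bsub>G\<^esub> n) ^ ((i + k) div n)"
    have s: "s \<noteq> 0" using Lnz N by (simp add: s_def)
    have "grp (c [^]\<^bsub>G\<^esub> k) \<odot>\<^bsub>V\<^esub> v i = s \<cdot> v j"
      using g i k N(1) c ik by (metis G.nat_pow_closed G.r_one s_def)
    then have "v j = inverse s \<cdot> (grp (c [^]\<^bsub>G\<^esub> k) \<odot>\<^bsub>V\<^esub> v i)" using s vc[OF j] by (simp add: scale_simps)
    then show ?thesis using W_scale W_one c by simp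
  qed
  have "p \<in> W" if p: "p \<in> carrier V" for p
  proof -
    obtain a where a: "p = finsum V (\<lambda>j. a j \<cdot> v j) {..<n}"
      using K.basis_expansion[OF inj basis, of p] p by (auto simp: finsum_K_space)
    have "finsum V (\<lambda>j. a j \<cdot> v j) {..<m} \<in> W" if "m \<le> n" for m
      using that
    proof (induction m)
      case 0
      then show ?case using W_scale[OF generator_carrier(1) W_one, of 0] u by (simp add: scale_simps)
    next
      case (Suc m)
      then have "finsum V (\<lambda>j. a j \<cdot> v j) {..<Suc m} = a m \<cdot> v m \<oplus>\<^bsub>V\<^esub> finsum V (\<lambda>j. a j \<cdot> v j) {..<m}"
        using vc by (simp add: lessThan_Suc M.finsum_insert Pi_def)
      then show ?case using Suc W_add W_scale Wv by simp
    qed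
    then show ?thesis using a by simp
  qed
  then have cyc: "\<exists>a\<in>carrier H. p = a \<odot>\<^bsub>V\<^esub> v i" if "p \<in> carrier V" for p
    using that unfolding W_def by blast
  have Nu: "grp h \<odot>\<^bsub>V\<^esub> v i = \<Lambda> h \<cdot> v i" if h: "h \<in> N" for h
    using g[rule_format, OF i n_pos h] i h by (simp add: N_iff)
  have "weight_module G \<chi> t n q c V (v i) (\<alpha>x * q powi (- int i)) (\<alpha>y * q powi (- (int i * t))) \<Lambda>"
    using u x y i nz q_nonzero Nu cyc
    by (intro weight_module.intro hopf_module_axioms weight_module_axioms.intro) auto
  then show ?thesis by blast
qed

text \<open>
  An isomorphism carries \<open>u\<close> to a weight vector, which must lie on one of the lines \<open>K c^j u'\<close>. Conversely
  \<open>v'_i\<close> has the same weight as \<open>u\<close>, and both modules are induced from the module of that weight.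
\<close>

lemma (in hopf_setting) is_Vxy_isomorphic_iff:
  assumes V: "is_Vxy G \<chi> t n q c \<alpha>x \<alpha>y \<Lambda> V" and V': "is_Vxy G \<chi> t n q c \<alpha>x' \<alpha>y' \<Lambda>' V'"
  shows "isomorphic_modules H V V' \<longleftrightarrow> (\<forall>h\<in>N. \<Lambda> h = \<Lambda>' h) \<and>
    (\<exists>i::int. \<alpha>x = q powi (- i) * \<alpha>x' \<and> \<alpha>y = q powi (- (i * t)) * \<alpha>y')"
proof -
  obtain u where "weight_module G \<chi> t n q c V u \<alpha>x \<alpha>y \<Lambda>"
    using is_Vxy_weight_module[OF V n_pos] by auto
  then interpret V: weight_module G \<chi> t n q c V u \<alpha>x \<alpha>y \<Lambda> .
  show ?thesis
  proof (intro iffI conjI)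
    assume "isomorphic_modules H V V'"
    then obtain f where f: "f \<in> module_iso H V V'" by (auto simp: isomorphic_modules_def)
    obtain u' where "weight_module G \<chi> t n q c V' u' \<alpha>x' \<alpha>y' \<Lambda>'"
      using is_Vxy_weight_module[OF V' n_pos] by auto
    then interpret V': weight_module G \<chi> t n q c V' u' \<alpha>x' \<alpha>y' \<Lambda>' .
    have f_smult: "f (a \<odot>\<^bsub>V\<^esub> v) = a \<odot>\<^bsub>V'\<^esub> f v" if "a \<in> carrier H" "v \<in> carrier V" for a v
      using f that by (simp add: module_iso_def)
    have f_bij: "bij_betw f (carrier V) (carrier V')" using f by (simp add: module_iso_def iso_def)
    have fu: "f u \<in> carrier V'" using f_bij V.u by (auto simp: bij_betw_def)
    have "f \<zero>\<^bsub>V\<^esub> = \<zero>\<^bsub>V'\<^esub>"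
      using f_smult[of "\<zero>\<^bsub>H\<^esub>" u] V.zero_smult[of u] V'.zero_smult[of "f u"] V.u fu by simp
    then have fu0: "f u \<noteq> \<zero>\<^bsub>V'\<^esub>"
      using f_bij V.u inj_onD[of f "carrier V" u "\<zero>\<^bsub>V\<^esub>"] by (auto simp: bij_betw_def)
    have eig: "(\<forall>h\<in>N. \<Lambda> h = \<Lambda>' h) \<and>
        (\<exists>j. \<alpha>x = \<alpha>x' * q powi (- int j) \<and> \<alpha>y = \<alpha>y' * q powi (- (int j * t)))"
    proof (rule V'.weight_unique[OF fu fu0])
      show "gen_x G \<odot>\<^bsub>V'\<^esub> f u = scalar G \<alpha>x \<odot>\<^bsub>V'\<^esub> f u"
        using f_smult[of "gen_x G" u] f_smult[of "scalar G \<alpha>x" u] V.x_u V.u by simp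
      show "gen_y G \<odot>\<^bsub>V'\<^esub> f u = scalar G \<alpha>y \<odot>\<^bsub>V'\<^esub> f u"
        using f_smult[of "gen_y G" u] f_smult[of "scalar G \<alpha>y" u] V.y_u V.u by simp
      show "grp h \<odot>\<^bsub>V'\<^esub> f u = scalar G (\<Lambda> h) \<odot>\<^bsub>V'\<^esub> f u" if "h \<in> N" for h
        using f_smult[of "grp h" u] f_smult[of "scalar G (\<Lambda> h)" u] V.N_u[OF that] V.u that by simp
    qed
    then show "\<forall>h\<in>N. \<Lambda> h = \<Lambda>' h" ..
    from eig obtain j where "\<alpha>x = \<alpha>x' * q powi (- int j)" "\<alpha>y = \<alpha>y' * q powi (- (int j * t))" by blast
    then show "\<exists>i::int. \<alpha>x = q powi (- i) * \<alpha>x' \<and> \<alpha>y = q powi (- (i * t)) * \<alpha>y'"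
      by (intro exI[of _ "int j"]) (simp add: mult.commute)
  next
    assume *: "(\<forall>h\<in>N. \<Lambda> h = \<Lambda>' h) \<and>
      (\<exists>i::int. \<alpha>x = q powi (- i) * \<alpha>x' \<and> \<alpha>y = q powi (- (i * t)) * \<alpha>y')"
    then obtain i :: int where i: "\<alpha>x = q powi (- i) * \<alpha>x'" "\<alpha>y = q powi (- (i * t)) * \<alpha>y'" by blast
    \<comment> \<open>an index below \<open>n\<close> is needed, and \<open>q^n = 1\<close> allows the reduction\<close>
    define k where "k = nat (i mod int n)"
    have k: "k < n" "int k = i mod int n" using n_pos by (simp_all add: k_def nat_less_iff)
    have qk: "q powi (- int k) = q powi (- i)"
      using q_powi_mod[of i] k(2) by (simp add: power_int_minus)
    have qkt: "q powi (- (int k * t)) = q powi (- (i * t))"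
      using qk by (metis mult_minus_left power_int_mult)
    obtain u' where "weight_module G \<chi> t n q c V' u' \<alpha>x \<alpha>y \<Lambda>'"
      using is_Vxy_weight_module[OF V' k(1)] i qk qkt by (auto simp: mult.commute)
    then interpret V'': weight_module G \<chi> t n q c V' u' \<alpha>x \<alpha>y \<Lambda>' .
    interpret V': weight_module G \<chi> t n q c V' u' \<alpha>x \<alpha>y \<Lambda>
      using V''.u V''.x_u V''.y_u V''.N_u V''.nonzero V''.cyclic *
      by (intro weight_module.intro V''.hopf_module_axioms weight_module_axioms.intro) auto
    show "isomorphic_modules H V V'"
      using isomorphic_modules_trans[OF V.isomorphic_induced(1) V'.isomorphic_induced(2)] .
  qed
qed

theorem corollary5p7:
  fixes G :: "('g, 'r) monoid_scheme"
    and \<chi> :: "'g \<Rightarrow> 'k::{alg_closed_field, field_char_0}"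
    and b c :: 'g and q :: 'k and n :: nat and t :: int
  defines "\<eta> \<equiv> (\<lambda>g. \<chi> g powi t)"
  defines "N \<equiv> kernel G field_units \<chi>"
  defines "H \<equiv> hopf_algebra G \<chi> \<eta>"
  defines "RN \<equiv> poly_group_ring G \<chi> \<eta> N"
  assumes "comm_group G" and "finitely_generated_group G"
    and "\<chi> \<in> hom G field_units" and "\<exists>m::nat. m > 0 \<and> (\<forall>g\<in>carrier G. \<chi> g ^ m = 1)"
    and "b \<in> carrier G" and "c \<in> carrier G"
    and "q = \<eta> b" and "q = inverse (\<chi> c)"
    and "primitive_root_of_unity n q"
    and "generate field_units {q} = \<chi> ` carrier G"
    and "coprime t (int n)"
  shows "(\<forall>V :: (nat \<times> nat \<times> 'g \<Rightarrow>\<^sub>0 'k, 'v) module.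
      simple_module H V \<and> torsion_free H V (gen_x G) \<and> torsion_free H V (gen_y G) \<longrightarrow>
        has_dim G V n \<and>
        (\<exists>M :: (nat \<times> nat \<times> 'g \<Rightarrow>\<^sub>0 'k, 'k) module.
          left_module RN M \<and> has_dim G M 1 \<and> isomorphic_modules H V (induced_module H RN M)) \<and>
        (\<exists>\<alpha>x \<alpha>y \<Lambda>. is_Vxy G \<chi> t n q c \<alpha>x \<alpha>y \<Lambda> V)) \<and>
    (\<forall>(V :: (nat \<times> nat \<times> 'g \<Rightarrow>\<^sub>0 'k, 'v) module) (V' :: (nat \<times> nat \<times> 'g \<Rightarrow>\<^sub>0 'k, 'w) module)
        \<alpha>x \<alpha>y \<Lambda> \<alpha>x' \<alpha>y' \<Lambda>'.
      is_Vxy G \<chi> t n q c \<alpha>x \<alpha>y \<Lambda> V \<and> is_Vxy G \<chi> t n q c \<alpha>x' \<alpha>y' \<Lambda>' V' \<longrightarrow>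
        (isomorphic_modules H V V' \<longleftrightarrow>
          (\<forall>h\<in>N. \<Lambda> h = \<Lambda>' h) \<and>
          (\<exists>i::int. \<alpha>x = q powi (- i) * \<alpha>x' \<and> \<alpha>y = q powi (- (i * t)) * \<alpha>y')))"
proof -
  have setting: "hopf_setting G \<chi> n q c"
    using assms(5-) by (intro hopf_setting.intro) auto
  note defs = \<eta>_def N_def H_def RN_def
  have "has_dim G V n \<and>
      (\<exists>M :: (nat \<times> nat \<times> 'g \<Rightarrow>\<^sub>0 'k, 'k) module.
        left_module RN M \<and> has_dim G M 1 \<and> isomorphic_modules H V (induced_module H RN M)) \<and>
      (\<exists>\<alpha>x \<alpha>y \<Lambda>. is_Vxy G \<chi> t n q c \<alpha>x \<alpha>y \<Lambda> V)"
    if V: "simple_module H V" "torsion_free H V (gen_x G)" "torsion_free H V (gen_y G)"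
    for V :: "(nat \<times> nat \<times> 'g \<Rightarrow>\<^sub>0 'k, 'v) module"
  proof -
    have "left_module H V" using V(1) by (simp add: simple_module_def)
    then interpret simple_hopf_module G \<chi> t n q c V
      using setting V(1) assms(6) unfolding defs
      by (intro simple_hopf_module.intro simple_hopf_module_axioms.intro hopf_module.intro)
    obtain u \<alpha>x \<alpha>y \<Lambda> where wm: "weight_module G \<chi> t n q c V u \<alpha>x \<alpha>y \<Lambda>"
      using weight_vector_exists V(2,3) unfolding defs by blast
    then interpret weight_module G \<chi> t n q c V u \<alpha>x \<alpha>y \<Lambda> .
    show ?thesis
      unfolding defs using weight_basis(2) left_module_M has_dim_M isomorphic_induced(1) weight_module_is_Vxy[OF wm]
      by blast
  qed
  moreover have "isomorphic_modules H V V' \<longleftrightarrow> (\<forall>h\<in>N. \<Lambda> h = \<Lambda>' h) \<and>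
      (\<exists>i::int. \<alpha>x = q powi (- i) * \<alpha>x' \<and> \<alpha>y = q powi (- (i * t)) * \<alpha>y')"
    if "is_Vxy G \<chi> t n q c \<alpha>x \<alpha>y \<Lambda> V" "is_Vxy G \<chi> t n q c \<alpha>x' \<alpha>y' \<Lambda>' V'"
    for V :: "(nat \<times> nat \<times> 'g \<Rightarrow>\<^sub>0 'k, 'v) module" and V' :: "(nat \<times> nat \<times> 'g \<Rightarrow>\<^sub>0 'k, 'w) module"
      and \<alpha>x \<alpha>y \<Lambda> \<alpha>x' \<alpha>y' \<Lambda>'
    unfolding defs by (rule hopf_setting.is_Vxy_isomorphic_iff[OF setting that])
  ultimately show ?thesis by blast
qed

end
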